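(* Fix a constant $\epsilon$ with $0<\epsilon<1$. There is a deterministic fully dynamic algorithm which, given a sequence of edge insertions and deletions applied to an initially empty graph $G$ on a fixed set of $n$ nodes, explicitly maintains after every update a proper $(\Delta+(4+\epsilon)\alpha)$-edge coloring of $G$, where $\Delta$ and $\alpha$ denote the current (dynamically changing) maximum degree and arboricity of $G$. The algorithm has $O(\log^4 n/\epsilon^5)$ amortized recourse per update and $O(\log^5 n\log\Delta/\epsilon^6)$ amortized update time, where in the latter bound $\Delta$ denotes an upper bound on the maximum degree of $G$ over the whole update sequence.
   Context: A proper $\lambda$-edge coloring of a graph $G=(V,E)$ assigns to each edge a color from $\{1,\dots,\lfloor\lambda\rfloor\}$ such that adjacent edges (edges sharing an endpoint) receive different colors. The arboricity of $G$ is the smallest integer $\alpha$ such that $\lceil |E(G[S])|/(|S|-1)\rceil\le\alpha$ for every $S\subseteq V$ with $|S|\ge 2$, where $G[S]$ is the subgraph induced by $S$. In the dynamic setting, the graph starts with no edges and undergoes a sequence of updates, each inserting or deleting one edge. The update time of an update is the time taken to process it; the recourse of an update is the number of edges whose color changes while processing it. An algorithm has amortized update time (resp. amortized recourse) $\lambda$ if for every sequence of $T$ updates starting from the empty graph, the total time (resp. total number of color changes) is at most $O(T\lambda)$. The $O(\cdot)$ notation hides absolute constants. *)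

theory Defs
  imports Complex_Main
begin

section \<open>Graphs and edge colorings\<close>

text \<open>A graph on the nodes \<open>{..<n}\<close> is given by its set of edges, each edge being a two-element
  set of nodes.\<close>

type_synonym edge = "nat set"

definition degree :: "edge set \<Rightarrow> nat \<Rightarrow> nat" where
  "degree E v = card {e \<in> E. v \<in> e}"

definition max_degree :: "nat \<Rightarrow> edge set \<Rightarrow> nat" where
  "max_degree n E = Max (insert 0 (degree E ` {..<n}))"

definition induced_edges :: "edge set \<Rightarrow> nat set \<Rightarrow> edge set" where
  "induced_edges E S = {e \<in> E. e \<subseteq> S}"

text \<open>For \<open>n < 2\<close> there is no admissible \<open>S\<close>, and the value is \<open>0\<close>.\<close>

definition arboricity :: "nat \<Rightarrow> edge set \<Rightarrow> nat" where
  "arboricity n E =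
     (LEAST a. \<forall>S \<subseteq> {..<n}. 2 \<le> card S \<longrightarrow>
        \<lceil>real (card (induced_edges E S)) / (real (card S) - 1)\<rceil> \<le> int a)"

definition proper_edge_coloring :: "edge set \<Rightarrow> real \<Rightarrow> (edge \<rightharpoonup> nat) \<Rightarrow> bool" where
  "proper_edge_coloring E l \<chi> \<longleftrightarrow>
     dom \<chi> = E \<and>
     (\<forall>k \<in> ran \<chi>. 1 \<le> k \<and> int k \<le> \<lfloor>l\<rfloor>) \<and>
     (\<forall>e \<in> E. \<forall>f \<in> E. e \<noteq> f \<and> e \<inter> f \<noteq> {} \<longrightarrow> \<chi> e \<noteq> \<chi> f)"

text \<open>An edge that is inserted or deleted changes between \<open>None\<close> and \<open>Some\<close>, so it is counted.\<close>

definition recourse :: "(edge \<rightharpoonup> nat) \<Rightarrow> (edge \<rightharpoonup> nat) \<Rightarrow> nat" where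
  "recourse \<chi> \<chi>' = card {e. \<chi> e \<noteq> \<chi>' e}"


section \<open>Update sequences\<close>

datatype update = Insert nat nat | Delete nat nat

fun apply_update :: "update \<Rightarrow> edge set \<Rightarrow> edge set" where
  "apply_update (Insert u v) E = insert {u, v} E"
| "apply_update (Delete u v) E = E - {{u, v}}"

fun valid_update :: "nat \<Rightarrow> edge set \<Rightarrow> update \<Rightarrow> bool" where
  "valid_update n E (Insert u v) \<longleftrightarrow> u < n \<and> v < n \<and> u \<noteq> v \<and> {u, v} \<notin> E"
| "valid_update n E (Delete u v) \<longleftrightarrow> u < n \<and> v < n \<and> u \<noteq> v \<and> {u, v} \<in> E"

definition graph_after :: "update list \<Rightarrow> nat \<Rightarrow> edge set" where
  "graph_after us i = fold apply_update (take i us) {}"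

definition valid_updates :: "nat \<Rightarrow> update list \<Rightarrow> bool" where
  "valid_updates n us \<longleftrightarrow> (\<forall>i < length us. valid_update n (graph_after us i) (us ! i))"


section \<open>A word RAM\<close>

text \<open>The machine has word size \<open>w\<close>: all arithmetic is performed modulo \<open>2 ^ w\<close>. A program uses
  finitely many registers and finitely many memory segments, each of them addressed by words.
  Every operation, memory access, assignment and test takes one time step. Division follows the
  HOL conventions \<open>x div 0 = 0\<close> and \<open>x mod 0 = x\<close>.\<close>

datatype binop = Add | Sub | Mul | Div | Mod | Less | Eq

datatype expr =
    Const nat
  | Reg string
  | Load string expr
  | Op binop expr expr

datatype com =
    Skip
  | Assign string expr
  | Store string expr expr
  | Seq com com
  | Cond expr com com
  | While expr com

record state =
  reg :: "string \<Rightarrow> nat"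
  mem :: "string \<Rightarrow> nat \<Rightarrow> nat"

fun binop_val :: "nat \<Rightarrow> binop \<Rightarrow> nat \<Rightarrow> nat \<Rightarrow> nat" where
  "binop_val w Add x y = (x + y) mod 2 ^ w"
| "binop_val w Sub x y = (x + 2 ^ w - y) mod 2 ^ w"
| "binop_val w Mul x y = (x * y) mod 2 ^ w"
| "binop_val w Div x y = x div y"
| "binop_val w Mod x y = x mod y"
| "binop_val w Less x y = of_bool (x < y) mod 2 ^ w"
| "binop_val w Eq x y = of_bool (x = y) mod 2 ^ w"

fun expr_val :: "nat \<Rightarrow> expr \<Rightarrow> state \<Rightarrow> nat" where
  "expr_val w (Const k) s = k mod 2 ^ w"
| "expr_val w (Reg x) s = reg s x"
| "expr_val w (Load a e) s = mem s a (expr_val w e s)"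
| "expr_val w (Op f e1 e2) s = binop_val w f (expr_val w e1 s) (expr_val w e2 s)"

fun expr_time :: "expr \<Rightarrow> nat" where
  "expr_time (Const k) = 1"
| "expr_time (Reg x) = 1"
| "expr_time (Load a e) = 1 + expr_time e"
| "expr_time (Op f e1 e2) = 1 + expr_time e1 + expr_time e2"

text \<open>\<open>exec w c s t s'\<close>: started in state \<open>s\<close>, the program \<open>c\<close> terminates in state \<open>s'\<close> after
  \<open>t\<close> time steps.\<close>

inductive exec :: "nat \<Rightarrow> com \<Rightarrow> state \<Rightarrow> nat \<Rightarrow> state \<Rightarrow> bool" for w :: nat where
  Skip: "exec w Skip s 1 s"
| Assign: "exec w (Assign x e) s (1 + expr_time e) (s\<lparr>reg := (reg s)(x := expr_val w e s)\<rparr>)"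
| Store: "exec w (Store a e1 e2) s (1 + expr_time e1 + expr_time e2)
    (s\<lparr>mem := (mem s)(a := (mem s a)(expr_val w e1 s := expr_val w e2 s))\<rparr>)"
| Seq: "exec w c1 s t1 s1 \<Longrightarrow> exec w c2 s1 t2 s2 \<Longrightarrow> exec w (Seq c1 c2) s (t1 + t2) s2"
| CondTrue: "expr_val w b s \<noteq> 0 \<Longrightarrow> exec w c1 s t s' \<Longrightarrow>
    exec w (Cond b c1 c2) s (1 + expr_time b + t) s'"
| CondFalse: "expr_val w b s = 0 \<Longrightarrow> exec w c2 s t s' \<Longrightarrow>
    exec w (Cond b c1 c2) s (1 + expr_time b + t) s'"
| WhileFalse: "expr_val w b s = 0 \<Longrightarrow> exec w (While b c) s (1 + expr_time b) s"
| WhileTrue: "expr_val w b s \<noteq> 0 \<Longrightarrow> exec w c s t1 s1 \<Longrightarrow> exec w (While b c) s1 t2 s2 \<Longrightarrow>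
    exec w (While b c) s (1 + expr_time b + t1 + t2) s2"

inductive_cases exec_SkipE: "exec w Skip s t s'"
inductive_cases exec_AssignE: "exec w (Assign x e) s t s'"
inductive_cases exec_StoreE: "exec w (Store a e1 e2) s t s'"
inductive_cases exec_SeqE: "exec w (Seq c1 c2) s t s'"
inductive_cases exec_CondE: "exec w (Cond b c1 c2) s t s'"
inductive_cases exec_WhileE: "exec w (While b c) s t s'"

lemma exec_deterministic:
  assumes "exec w c s t s'" and "exec w c s t' s''"
  shows "t' = t \<and> s'' = s'"
  using assms
proof (induction arbitrary: t' s'' rule: exec.induct)
  case (Skip s)
  from Skip.prems show ?case by (rule exec_SkipE) simp
next
  case (Assign x e s)
  from Assign.prems show ?case by (rule exec_AssignE) simp
next
  case (Store a e1 e2 s)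
  from Store.prems show ?case by (rule exec_StoreE) simp
next
  case (Seq c1 s t1 s1 c2 t2 s2)
  from Seq.prems obtain ta sa tb
    where *: "t' = ta + tb" "exec w c1 s ta sa" "exec w c2 sa tb s''"
    by (rule exec_SeqE)
  have "ta = t1 \<and> sa = s1" using *(2) by (rule Seq.IH(1))
  with *(3) have "tb = t2 \<and> s'' = s2" by (intro Seq.IH(2)) simp
  with \<open>ta = t1 \<and> sa = s1\<close> show ?case by (simp add: *(1))
next
  case (CondTrue b s c1 t s' c2)
  from CondTrue.prems obtain ta where *: "t' = Suc (expr_time b + ta)" "exec w c1 s ta s''"
    by (rule exec_CondE) (use CondTrue.hyps in simp_all)
  have "ta = t \<and> s'' = s'" using *(2) by (rule CondTrue.IH)
  then show ?case by (simp add: *(1))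
next
  case (CondFalse b s c2 t s' c1)
  from CondFalse.prems obtain ta where *: "t' = Suc (expr_time b + ta)" "exec w c2 s ta s''"
    by (rule exec_CondE) (use CondFalse.hyps in simp_all)
  have "ta = t \<and> s'' = s'" using *(2) by (rule CondFalse.IH)
  then show ?case by (simp add: *(1))
next
  case (WhileFalse b s c)
  from WhileFalse.prems show ?case by (rule exec_WhileE) (use WhileFalse.hyps in simp_all)
next
  case (WhileTrue b s c t1 s1 t2 s2)
  from WhileTrue.prems obtain ta sa tb
    where *: "t' = Suc (expr_time b + ta + tb)" "exec w c s ta sa" "exec w (While b c) sa tb s''"
    by (rule exec_WhileE) (use WhileTrue.hyps in simp_all)
  have "ta = t1 \<and> sa = s1" using *(2) by (rule WhileTrue.IH(1))
  with *(3) have "tb = t2 \<and> s'' = s2" by (intro WhileTrue.IH(2)) simp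
  with \<open>ta = t1 \<and> sa = s1\<close> show ?case by (simp add: *(1))
qed


section \<open>Dynamic algorithms\<close>

text \<open>A dynamic algorithm is a program that is run once for each update. At the beginning the
  number of nodes is in a register and everything else is zero; there is no separate
  preprocessing phase. All registers and memory cells persist between updates.\<close>

definition initial_state :: "nat \<Rightarrow> state" where
  "initial_state n = \<lparr>reg = (\<lambda>_. 0)(''n'' := n), mem = (\<lambda>_ _. 0)\<rparr>"

fun receive :: "update \<Rightarrow> state \<Rightarrow> state" where
  "receive (Insert u v) s = s\<lparr>reg := (reg s)(''op'' := 1, ''u'' := u, ''v'' := v)\<rparr>"
| "receive (Delete u v) s = s\<lparr>reg := (reg s)(''op'' := 0, ''u'' := u, ''v'' := v)\<rparr>"

text \<open>\<open>s i\<close> is the state after the first \<open>i\<close> updates and \<open>t i\<close> is the time spent on the update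
  with index \<open>i\<close>. The program sees the updates one at a time.\<close>

definition dynamic_run ::
  "nat \<Rightarrow> com \<Rightarrow> nat \<Rightarrow> update list \<Rightarrow> (nat \<Rightarrow> nat) \<Rightarrow> (nat \<Rightarrow> state) \<Rightarrow> bool" where
  "dynamic_run w P n us t s \<longleftrightarrow>
     s 0 = initial_state n \<and>
     (\<forall>i < length us. exec w P (receive (us ! i) (s i)) (t i) (s (Suc i)))"

text \<open>The color of an edge between \<open>u < v\<close> has to be stored explicitly, in cell \<open>u * n + v\<close> of the
  segment \<open>color\<close>.\<close>

definition stored_coloring :: "nat \<Rightarrow> edge set \<Rightarrow> state \<Rightarrow> (edge \<rightharpoonup> nat)" where
  "stored_coloring n E s = (\<lambda>e. Some (mem s ''color'' (Min e * n + Max e))) |` E"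

end

theory Submission
  imports Defs
begin

text \<open>
  Every node has a level, and the level of an edge is the smaller level of its endpoints. The
  levels form groups of \<open>R\<close> levels; a group has a parameter \<open>a\<close>, and the parameters grow by a
  factor of about \<open>1 + 1/N\<close>, where \<open>N\<close> is about \<open>12/\<epsilon>\<close>. A node moves up if it has more than about
  \<open>4a\<close> neighbors on its level or above, and down if it has at most about \<open>2a\<close> neighbors on the level
  below it or above. If the arboricity is at most \<open>a\<close>, then the number of nodes above a level of the
  group shrinks by a constant factor per level, so that no node gets past the group. Hence the upper
  threshold on any occupied level is at most \<open>(4 + \<epsilon>) \<alpha> + 1\<close>.

  The color of an edge \<open>{x, y}\<close> is kept below the sum of \<open>max (deg x) (deg y)\<close> and the upper threshold
  on the level of the edge. To color an edge with lower endpoint \<open>x\<close> and upper endpoint \<open>y\<close>, one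
  avoids the colors of all edges at \<open>y\<close> and of the edges at \<open>x\<close> that go to the same or to a higher
  level. The chosen color may still occur on one edge from \<open>x\<close> to a strictly lower node; that edge
  is recolored next, so the chain of recolorings is at most as long as the number of levels.

  When the degree of \<open>x\<close> drops by one, then for each threshold at most one edge at \<open>x\<close> violates its
  bound, because its color is determined. Level changes are paid for by a potential that counts, for
  each edge, the distance of its level from the top and, for each node and each level below it, the
  number of neighbors missing to the upper threshold. The factor of two between the thresholds makes
  the second part pay for moves down.
\<close>

section \<open>Weakest preconditions with a clock\<close>

text \<open>Levels are restored completely before any color is repaired, because the bound on a new
  color uses that the lower endpoint has at most the upper threshold of neighbors on its level or
  above. A single queue of edges connects the two phases. An entry announces that its endpoints may
  violate a degree threshold and that its color may violate its bound. The level phase works through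
  the queue and appends every edge of a moved node that lay on its old level; the color phase reads
  the queue again from its start. The potential pays for each appended entry, so that potential plus
  queue length never grows and limits both phases.

  With \<open>K\<close> about \<open>log n\<close> and \<open>N\<close> about
  \<open>12 / \<epsilon>\<close> there are \<open>L = 2 * N\<^sup>2 * K\<^sup>2\<close> levels. An
  update raises the potential by \<open>O(N * L)\<close>, and each unit allows one chain of at most
  \<open>L + 1\<close> recolorings, which gives \<open>O(N ^ 5 * K ^ 4)\<close> recourse; the trees
  cost a further factor \<open>K\<close> in time. The queue must be addressed by words of
  \<open>O(log (n / \<epsilon>))\<close> bits, so the potential also needs an outright polynomial
  bound.\<close>

definition wp :: "nat \<Rightarrow> com \<Rightarrow> (nat \<Rightarrow> state \<Rightarrow> bool) \<Rightarrow> nat \<Rightarrow> state \<Rightarrow> bool" where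
  "wp w c Q t s \<longleftrightarrow> (\<exists>t' s'. exec w c s t' s' \<and> Q (t + t') s')"

text \<open>Determinism of \<open>exec\<close> makes this an equivalence, so that the rules below
  can be simplifier equations that run a program symbolically. The clock is an argument, so that
  postconditions speak of absolute time.\<close>

lemma wp_iff_exec:
  assumes "exec w c s t' s'"
  shows "wp w c Q t s \<longleftrightarrow> Q (t + t') s'"
  unfolding wp_def using assms exec_deterministic by blast

lemma wp_Skip [simp]: "wp w Skip Q t s \<longleftrightarrow> Q (t + 1) s"
  by (rule wp_iff_exec[OF exec.Skip])

lemma wp_Assign [simp]:
  "wp w (Assign x e) Q t s \<longleftrightarrow>
     Q (t + (1 + expr_time e)) (s\<lparr>reg := (reg s)(x := expr_val w e s)\<rparr>)"
  by (rule wp_iff_exec[OF exec.Assign])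

lemma wp_Store [simp]:
  "wp w (Store a e1 e2) Q t s \<longleftrightarrow>
     Q (t + (1 + expr_time e1 + expr_time e2))
       (s\<lparr>mem := (mem s)(a := (mem s a)(expr_val w e1 s := expr_val w e2 s))\<rparr>)"
  by (rule wp_iff_exec[OF exec.Store])

lemma wp_Seq [simp]: "wp w (Seq c1 c2) Q t s \<longleftrightarrow> wp w c1 (wp w c2 Q) t s"
proof
  assume "wp w (Seq c1 c2) Q t s"
  then obtain t' s' where "exec w (Seq c1 c2) s t' s'" "Q (t + t') s'" unfolding wp_def by blast
  then show "wp w c1 (wp w c2 Q) t s"
    unfolding wp_def by (elim exec_SeqE) (metis add.assoc)
next
  assume "wp w c1 (wp w c2 Q) t s"
  then show "wp w (Seq c1 c2) Q t s"
    unfolding wp_def by (metis add.assoc exec.Seq)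
qed

lemma wp_Cond [simp]:
  "wp w (Cond b c1 c2) Q t s \<longleftrightarrow>
     (if expr_val w b s \<noteq> 0 then wp w c1 Q (t + (1 + expr_time b)) s
      else wp w c2 Q (t + (1 + expr_time b)) s)" (is "_ \<longleftrightarrow> ?rhs")
proof
  assume "wp w (Cond b c1 c2) Q t s"
  then obtain t' s' where "exec w (Cond b c1 c2) s t' s'" "Q (t + t') s'" unfolding wp_def by blast
  then show ?rhs
    unfolding wp_def by (elim exec_CondE) (auto simp: add.assoc)
next
  assume ?rhs
  then show "wp w (Cond b c1 c2) Q t s"
    unfolding wp_def by (metis (no_types, lifting) add.assoc exec.CondTrue exec.CondFalse)
qed

fun wr :: "com \<Rightarrow> string set" where
  "wr Skip = {}"
| "wr (Assign x e) = {x}"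
| "wr (Store a e1 e2) = {}"
| "wr (Seq c1 c2) = wr c1 \<union> wr c2"
| "wr (Cond b c1 c2) = wr c1 \<union> wr c2"
| "wr (While b c) = wr c"

fun wm :: "com \<Rightarrow> string set" where
  "wm Skip = {}"
| "wm (Assign x e) = {}"
| "wm (Store a e1 e2) = {a}"
| "wm (Seq c1 c2) = wm c1 \<union> wm c2"
| "wm (Cond b c1 c2) = wm c1 \<union> wm c2"
| "wm (While b c) = wm c"

definition frame :: "state \<Rightarrow> state \<Rightarrow> string set \<Rightarrow> string set \<Rightarrow> bool" where
  "frame s s' X A \<longleftrightarrow> (\<forall>r. r \<notin> X \<longrightarrow> reg s' r = reg s r) \<and> (\<forall>a. a \<notin> A \<longrightarrow> mem s' a = mem s a)"

lemma frame_refl [simp]: "frame s s X A"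
  by (simp add: frame_def)

lemma frame_trans:
  "frame s s' X A \<Longrightarrow> frame s' s'' Y C \<Longrightarrow> X \<subseteq> Z \<Longrightarrow> Y \<subseteq> Z \<Longrightarrow> A \<subseteq> D \<Longrightarrow> C \<subseteq> D \<Longrightarrow> frame s s'' Z D"
  unfolding frame_def by (metis subset_iff)

lemma exec_frame: "exec w c s t s' \<Longrightarrow> frame s s' (wr c) (wm c)"
proof (induction rule: exec.induct)
  case (Seq c1 s t1 s1 c2 t2 s2) then show ?case by (auto intro: frame_trans)
next
  case (CondTrue b s c1 t s' c2) then show ?case by (auto simp: frame_def)
next
  case (CondFalse b s c2 t s' c1) then show ?case by (auto simp: frame_def)
next
  case (WhileTrue b s c t1 s1 t2 s2) then show ?case by (auto simp: frame_def)
qed (auto simp: frame_def)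

text \<open>The syntactic write sets give for free what a program leaves unchanged; loop invariants
  then mention only what changes.\<close>

lemma wp_frame:
  "wp w c (\<lambda>t' s'. t \<le> t' \<longrightarrow> frame s s' (wr c) (wm c) \<longrightarrow> Q t' s') t s \<Longrightarrow> wp w c Q t s"
  unfolding wp_def using exec_frame le_add1 by blast

text \<open>Every iteration takes time, so a bound on the clock that follows from the invariant
  also gives termination.\<close>

lemma wp_While:
  assumes init: "I t s"
    and bd: "\<And>t' s'. I t' s' \<Longrightarrow> frame s s' (wr c) (wm c) \<Longrightarrow> t' \<le> Bd"
    and body: "\<And>t' s'. I t' s' \<Longrightarrow> frame s s' (wr c) (wm c) \<Longrightarrow> expr_val w b s' \<noteq> 0 \<Longrightarrow>
      wp w c I (t' + (1 + expr_time b)) s'"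
    and exit: "\<And>t' s'. I t' s' \<Longrightarrow> frame s s' (wr c) (wm c) \<Longrightarrow> expr_val w b s' = 0 \<Longrightarrow>
      Q (t' + (1 + expr_time b)) s'"
  shows "wp w (While b c) Q t s"
proof -
  have "\<exists>t2 s2. exec w (While b c) s1 t2 s2 \<and> Q (t1 + t2) s2"
    if "I t1 s1" "frame s s1 (wr c) (wm c)" for t1 s1
    using that
  proof (induction "Bd - t1" arbitrary: t1 s1 rule: less_induct)
    case less
    show ?case
    proof (cases "expr_val w b s1 = 0")
      case True
      then show ?thesis using exit[OF less.prems] exec.WhileFalse[OF True, of c] by blast
    next
      case False
      obtain t2 s2 where e: "exec w c s1 t2 s2" and I: "I (t1 + (1 + expr_time b) + t2) s2"
        using body[OF less.prems False] unfolding wp_def by blast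
      have f: "frame s s2 (wr c) (wm c)"
        using frame_trans[OF less.prems(2) exec_frame[OF e]] by blast
      have "Bd - (t1 + (1 + expr_time b) + t2) < Bd - t1"
        using bd[OF I f] by linarith
      then obtain t3 s3 where "exec w (While b c) s2 t3 s3"
          "Q (t1 + (1 + expr_time b) + t2 + t3) s3"
        using less.hyps I f by blast
      then show ?thesis using exec.WhileTrue[OF False e] by (metis add.assoc)
    qed
  qed
  from this[OF init] show ?thesis unfolding wp_def by simp
qed

abbreviation add_e (infixl \<open>+.\<close> 65) where "a +. b \<equiv> Op Add a b"
abbreviation sub_e (infixl \<open>-.\<close> 65) where "a -. b \<equiv> Op Sub a b"
abbreviation mul_e (infixl \<open>*.\<close> 70) where "a *. b \<equiv> Op Mul a b"
abbreviation div_e (infixl \<open>'/.\<close> 70) where "a /. b \<equiv> Op Div a b"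
abbreviation less_e (infix \<open><.\<close> 50) where "a <. b \<equiv> Op Less a b"
abbreviation assign_c (infix \<open>::=\<close> 42) where "x ::= e \<equiv> Assign x e"
abbreviation seq_c (infixr \<open>;;\<close> 40) where "c1 ;; c2 \<equiv> Seq c1 c2"

section \<open>Counter trees\<close>

definition baddr :: "expr \<Rightarrow> expr \<Rightarrow> expr" where
  "baddr x y = x *. Reg ''B'' +. y"

text \<open>In heap order halving an index gives the parent. The loop ends at index 0, one step
  above the root.\<close>

definition tree_upd :: "binop \<Rightarrow> com" where
  "tree_upd f = (''i'' ::= Reg ''M'' +. Reg ''k'' ;;
     While (Reg ''i'')
      (Store ''T'' (Reg ''p'' +. Reg ''i'') (Op f (Load ''T'' (Reg ''p'' +. Reg ''i'')) (Const 1)) ;;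
       ''i'' ::= Reg ''i'' /. Const 2))"

text \<open>A color used in both trees is counted twice, but every subtree that the search skips is full in
  this sense. Hence the color that is found is at most the sum of the sizes of the two sets.\<close>

definition find_free :: com where
  "find_free = (''i'' ::= Const 1 ;; ''z'' ::= Reg ''M'' ;;
     While (Reg ''i'' <. Reg ''M'')
      (''z'' ::= Reg ''z'' /. Const 2 ;;
       ''i'' ::= Reg ''i'' *. Const 2 ;;
       Cond (Load ''T'' (Reg ''p'' +. Reg ''i'') +. Load ''T'' (Reg ''q'' +. Reg ''i'') <. Reg ''z'')
         Skip (''i'' ::= Reg ''i'' +. Const 1)) ;;
     ''k'' ::= Reg ''i'' -. Reg ''M'')"

text \<open>Finds the color of rank \<open>r\<close>, counted from one. This enumerates the edges of
  a node on a level without any linked lists.\<close>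

definition select_rank :: com where
  "select_rank = (''i'' ::= Const 1 ;; ''z'' ::= Reg ''r'' ;;
     While (Reg ''i'' <. Reg ''M'')
      (''i'' ::= Reg ''i'' *. Const 2 ;;
       Cond (Load ''T'' (Reg ''p'' +. Reg ''i'') <. Reg ''z'')
         (''z'' ::= Reg ''z'' -. Load ''T'' (Reg ''p'' +. Reg ''i'') ;;
          ''i'' ::= Reg ''i'' +. Const 1) Skip) ;;
     ''k'' ::= Reg ''i'' -. Reg ''M'')"

lemma writes_tree [simp]:
  "wr (tree_upd f) = {''i''}" "wm (tree_upd f) = {''T''}"
  "wr find_free = {''i'', ''z'', ''k''}" "wm find_free = {}"
  "wr select_rank = {''i'', ''z'', ''k''}" "wm select_rank = {}"
  by (auto simp: tree_upd_def find_free_def select_rank_def)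

text \<open>The term that is cubed is \<open>B\<close> below. The last assumption makes room in a
  word for the potential, which is at most \<open>400 * N * B ^ 3\<close> and limits the queue
  length, and for tree addresses of three digits in radix \<open>B\<close>.\<close>

locale ctx =
  fixes w n N K :: nat
  assumes n2: "2 \<le> n" and N1: "1 \<le> N" and K2n: "2 * n \<le> 2 ^ K"
    and big: "1000 * N * (2 * N * K * (N * K) + 2 + 2 * 2 ^ K) ^ 3 \<le> 2 ^ w"
begin

text \<open>\<open>M\<close> is the number of available colors: a new color is at most the sum of
  two degrees, each less than \<open>n\<close>. The value of \<open>R\<close> comes from shrinking
  by \<open>1 + 1 / (2 * N)\<close>, which after \<open>2 * N * K\<close> levels leaves fewer than
  one of \<open>n < 2 ^ K\<close> nodes. The value of \<open>J\<close> comes from growth by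
  \<open>1 + 1 / N\<close>, which in \<open>N * K\<close> steps brings a group parameter from 1 to
  \<open>M\<close>. \<open>B\<close> is a common radix for levels, heap positions and
  colors.\<close>

definition "M = (2::nat) ^ K"
definition "R = 2 * N * K"
definition "J = N * K"
definition "L = R * J"
definition "B = L + 2 + 2 * M"
definition "WW = (2::nat) ^ w"

lemma WW_big: "1000 * N * B ^ 3 \<le> WW"
  using big by (simp add: B_def L_def R_def J_def M_def WW_def)

lemma B_bounds: "2 * n \<le> M" "2 * M \<le> B" "L + 2 \<le> B" "4 \<le> M" "8 \<le> B"
  using K2n n2 by (auto simp: M_def B_def)

lemma WW_B: "1000 * B \<le> WW" "1000 * N \<le> WW" "1000 * (B * B) \<le> WW" "1000 * (B * B * B) \<le> WW"
proof -
  have b: "1 \<le> B" using B_bounds by simp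
  have 3: "B * B * B \<le> N * B ^ 3" using N1 by (simp add: power3_eq_cube)
  have 2: "B * B \<le> B * B * B" using b by simp
  have 1: "B \<le> B * B" using b by simp
  have 4: "N \<le> N * B ^ 3" using b by simp
  have W: "1000 * (N * B ^ 3) \<le> WW" using WW_big by (simp add: mult.assoc)
  show "1000 * B \<le> WW" "1000 * N \<le> WW" "1000 * (B * B) \<le> WW" "1000 * (B * B * B) \<le> WW"
    using 1 2 3 4 W by linarith+
qed

lemma WW1000: "1000 < WW" using WW_B(1) B_bounds by linarith

lemma w_pos: "1 mod 2 ^ w = (1::nat)" using WW1000 by (intro mod_less) (simp add: WW_def)

section \<open>Machine arithmetic without overflow\<close>

lemma ev_Const: "k < WW \<Longrightarrow> expr_val w (Const k) s = k"
  by (simp add: WW_def)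
lemma ev_numeral [simp]: "(numeral k :: nat) \<le> 1000 \<Longrightarrow> expr_val w (Const (numeral k)) s = numeral k"
  using WW1000 by (intro ev_Const) linarith
lemma ev_0 [simp]: "expr_val w (Const 0) s = 0" by simp
lemma ev_1 [simp]: "expr_val w (Const 1) s = 1" "expr_val w (Const (Suc 0)) s = 1" using w_pos by simp_all
lemma ev_Add [simp]: "expr_val w a s + expr_val w b s < WW \<Longrightarrow> expr_val w (a +. b) s = expr_val w a s + expr_val w b s"
  by (simp add: WW_def)
lemma ev_Mul [simp]: "expr_val w a s * expr_val w b s < WW \<Longrightarrow> expr_val w (a *. b) s = expr_val w a s * expr_val w b s"
  by (simp add: WW_def)
lemma ev_Sub [simp]: "expr_val w b s \<le> expr_val w a s \<Longrightarrow> expr_val w a s < WW \<Longrightarrow> expr_val w (a -. b) s = expr_val w a s - expr_val w b s"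
proof -
  assume a: "expr_val w b s \<le> expr_val w a s" "expr_val w a s < WW"
  then have "expr_val w a s + 2 ^ w - expr_val w b s = (expr_val w a s - expr_val w b s) + 2 ^ w" by linarith
  then have "expr_val w (a -. b) s = (expr_val w a s - expr_val w b s) mod 2 ^ w"
    by (simp only: expr_val.simps binop_val.simps mod_add_self2)
  then show ?thesis using a by (simp add: WW_def)
qed
lemma ev_Div [simp]: "expr_val w (a /. b) s = expr_val w a s div expr_val w b s"
  by simp
lemma ev_Less [simp]: "expr_val w (a <. b) s = of_bool (expr_val w a s < expr_val w b s)"
  using w_pos by simp

text \<open>From here on the modular equations are withheld, so that evaluating an expression
  requires a proof that constants, sums and products fit into a word and that differences are not
  negative.\<close>

declare expr_val.simps(1,4) [simp del]

lemma ev_baddr: "reg s ''B'' = B \<Longrightarrow> expr_val w x s < B * n \<Longrightarrow> expr_val w y s < B \<Longrightarrow>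
   expr_val w (baddr x y) s = expr_val w x s * B + expr_val w y s \<and> expr_val w x s * B + expr_val w y s < B * B * n"
proof -
  assume a: "reg s ''B'' = B" "expr_val w x s < B * n" "expr_val w y s < B"
  have "Suc (expr_val w x s) * B \<le> (B * n) * B" using a by (intro mult_right_mono) auto
  then have 1: "expr_val w x s * B + expr_val w y s < B * n * B" using a(3) by simp
  have "B * n * B \<le> B * B * B" using B_bounds by simp
  moreover have "(0::nat) < B * B * B" using B_bounds by simp
  ultimately have "B * n * B < WW" using WW_B(4) by linarith
  then have "expr_val w x s * B + expr_val w y s < WW" using 1 by linarith
  then show ?thesis using 1 a(1) by (simp add: baddr_def mult_ac)
qed

lemma B_inj: "x * B + y = x' * B + y' \<longleftrightarrow> x = x' \<and> y = y'" if "y < B" "y' < B"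
proof -
  have "(x * B + y) div B = x" "(x' * B + y') div B = x'" "(x * B + y) mod B = y" "(x' * B + y') mod B = y'"
    using that by auto
  then show ?thesis by metis
qed

text \<open>\<open>B\<close> exceeds both \<open>L + 1\<close> and the heap positions below
  \<open>2 * M\<close>, so an address \<open>tb x l + i\<close> has the digits \<open>x\<close>,
  \<open>l\<close>, \<open>i\<close> and the trees do not overlap.\<close>

definition "tb x l = (x * B + l) * B" for x l :: nat

text \<open>The counters of a set of colors below \<open>M = 2 ^ K\<close> form a complete binary tree in heap order: the
  leaf of color \<open>k\<close> is \<open>M + k\<close>, and its ancestor at height \<open>e\<close> is \<open>(M + k) div 2 ^ e\<close>.\<close>

definition treeset :: "(nat \<Rightarrow> nat) \<Rightarrow> nat set \<Rightarrow> bool" where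
  "treeset f S \<longleftrightarrow> S \<subseteq> {..<M} \<and>
     (\<forall>e\<le>K. \<forall>i. 2 ^ (K - e) \<le> i \<and> i < 2 * 2 ^ (K - e) \<longrightarrow> f i = card {k \<in> S. (M + k) div 2 ^ e = i})"

definition forest :: "(nat \<Rightarrow> nat) \<Rightarrow> (nat \<Rightarrow> nat \<Rightarrow> nat set) \<Rightarrow> bool" where
  "forest T F \<longleftrightarrow> (\<forall>x<n. \<forall>l\<le>L+1. treeset (\<lambda>i. T (tb x l + i)) (F x l))"

lemma treeset_root: "treeset f S \<Longrightarrow> f 1 = card S"
proof -
  assume a: "treeset f S"
  then have "f 1 = card {k \<in> S. (M + k) div 2 ^ K = 1}" unfolding treeset_def by (elim conjE allE[of _ K]) auto
  also have "{k \<in> S. (M + k) div 2 ^ K = 1} = S" using a by (auto simp: treeset_def M_def)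
  finally show ?thesis .
qed

lemma forest_root: "forest T F \<Longrightarrow> x < n \<Longrightarrow> l \<le> L + 1 \<Longrightarrow> T (tb x l + 1) = card (F x l)"
  unfolding forest_def by (metis treeset_root)

text \<open>Prefix counts over leaf positions, which start at \<open>M\<close>. Both searches
  descend by comparing such counts.\<close>

definition below :: "nat set \<Rightarrow> nat \<Rightarrow> nat" where
  "below S b = card {k \<in> S. M + k < b}"

lemma treeset_finite: "treeset f S \<Longrightarrow> finite S"
  unfolding treeset_def using finite_subset by blast

text \<open>The node \<open>i\<close> at height \<open>e\<close> has exactly the leaf positions from
  \<open>i * 2 ^ e\<close> to \<open>(i + 1) * 2 ^ e - 1\<close> below it, so its counter is a
  difference of two prefix counts.\<close>

lemma treeset_below:
  assumes "treeset f S" "e \<le> K" "2 ^ (K - e) \<le> i" "i < 2 * 2 ^ (K - e)"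
  shows "f i + below S (i * 2 ^ e) = below S ((i + 1) * 2 ^ e)"
proof -
  have fin: "finite S" using assms(1) by (rule treeset_finite)
  have "f i = card {k \<in> S. (M + k) div 2 ^ e = i}" using assms by (auto simp: treeset_def)
  also have "{k \<in> S. (M + k) div 2 ^ e = i} = {k \<in> S. i * 2 ^ e \<le> M + k \<and> M + k < (i + 1) * 2 ^ e}"
  proof -
    have "(m div 2 ^ e = i) = (i * 2 ^ e \<le> m \<and> m < (i + 1) * 2 ^ e)" for m :: nat
    proof -
      have "i \<le> m div 2 ^ e \<longleftrightarrow> i * 2 ^ e \<le> m" by (simp add: less_eq_div_iff_mult_less_eq)
      moreover have "m div 2 ^ e < i + 1 \<longleftrightarrow> m < (i + 1) * 2 ^ e" by (simp add: div_less_iff_less_mult)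
      ultimately show ?thesis by linarith
    qed
    then show ?thesis by simp
  qed
  also have "card \<dots> + below S (i * 2 ^ e) = below S ((i + 1) * 2 ^ e)"
  proof -
    have split: "card {k \<in> S. a \<le> M + k \<and> M + k < b} + card {k \<in> S. M + k < a} = card {k \<in> S. M + k < b}"
      if "a \<le> b" for a b
    proof -
      have "{k \<in> S. M + k < b} = {k \<in> S. a \<le> M + k \<and> M + k < b} \<union> {k \<in> S. M + k < a}"
        using that by auto
      then show ?thesis using fin by (simp add: card_Un_disjoint disjoint_iff)
    qed
    show ?thesis unfolding below_def by (rule split) simp
  qed
  finally show ?thesis .
qed

lemma below_M: "below S M = 0" by (simp add: below_def)

lemma below_2M: "treeset f S \<Longrightarrow> below S (2 * M) = card S"
  unfolding below_def treeset_def by (intro arg_cong[of _ _ card]) auto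

lemma below_le: "treeset f S \<Longrightarrow> below S b \<le> card S"
  unfolding below_def by (intro card_mono) (auto intro: treeset_finite)

lemma below_Suc: "finite S \<Longrightarrow> below S (M + k + 1) = below S (M + k) + (if k \<in> S then 1 else 0)"
proof -
  assume fin: "finite S"
  have "{j \<in> S. M + j < M + k + 1} = (if k \<in> S then insert k {j \<in> S. M + j < M + k} else {j \<in> S. M + j < M + k})"
    by (auto simp: less_Suc_eq)
  then show ?thesis using fin by (auto simp: below_def)
qed

lemma treeset_card_le: "treeset f S \<Longrightarrow> card S \<le> M"
  unfolding treeset_def using card_mono[of "{..<M}" S] by auto

lemma treeset_le:
  assumes "treeset f S" "e \<le> K" "2 ^ (K - e) \<le> i" "i < 2 * 2 ^ (K - e)"
  shows "f i \<le> M"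
proof -
  have "f i = card {k \<in> S. (M + k) div 2 ^ e = i}" using assms by (auto simp: treeset_def)
  also have "\<dots> \<le> card S" by (intro card_mono) (use assms(1) treeset_finite in auto)
  finally show ?thesis using treeset_card_le[OF assms(1)] by simp
qed

lemma node_range:
  assumes "k < M" "e \<le> K"
  shows "2 ^ (K - e) \<le> (M + k) div 2 ^ e" "(M + k) div 2 ^ e < 2 * 2 ^ (K - e)"
proof -
  have M: "M = 2 ^ (K - e) * 2 ^ e" using assms(2) by (simp add: M_def flip: power_add)
  show "2 ^ (K - e) \<le> (M + k) div 2 ^ e"
    by (subst less_eq_div_iff_mult_less_eq) (use M in auto)
  show "(M + k) div 2 ^ e < 2 * 2 ^ (K - e)"
    by (subst div_less_iff_less_mult) (use M assms(1) in \<open>auto simp: mult.commute\<close>)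
qed

text \<open>The height of a node is determined by its heap index. Hence a path meets each index at
  most once, and membership of an index in a path can be tested at its own height only.\<close>

lemma range_disjoint:
  assumes "(2::nat) ^ (K - e) \<le> i" "i < 2 * 2 ^ (K - e)" "2 ^ (K - e') \<le> i" "i < 2 * 2 ^ (K - e')"
    "e \<le> K" "e' \<le> K"
  shows "e = e'"
proof -
  have "(2::nat) ^ (K - e) < 2 ^ Suc (K - e')" "(2::nat) ^ (K - e') < 2 ^ Suc (K - e)"
    using assms(1-4) by simp_all
  then have "K - e < Suc (K - e')" "K - e' < Suc (K - e)"
    by (simp_all only: power_strict_increasing_iff one_less_numeral_iff semiring_norm)
  then show ?thesis using assms(5,6) by linarith
qed

lemma node_lt: "k < M \<Longrightarrow> (M + k) div 2 ^ e < 2 * M"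
  using div_le_dividend[of "M + k" "2 ^ e"] by linarith

lemma node_at_height:
  fixes i :: nat
  assumes k: "k < M" and e: "e \<le> K" and i: "2 ^ (K - e) \<le> i \<and> i < 2 * 2 ^ (K - e)"
  shows "(\<exists>e\<le>K. i = (M + k) div 2 ^ e) \<longleftrightarrow> (M + k) div 2 ^ e = i"
proof
  assume "\<exists>e\<le>K. i = (M + k) div 2 ^ e"
  then obtain e' where e': "e' \<le> K" "i = (M + k) div 2 ^ e'" by blast
  then have "e = e'" using range_disjoint[OF _ _ _ _ e e'(1)] node_range[OF k e'(1)] i by blast
  then show "(M + k) div 2 ^ e = i" using e' by simp
qed (use e in blast)

lemma treeset_insert:
  fixes f :: "nat \<Rightarrow> nat"
  assumes t: "treeset f S" and k: "k < M" "k \<notin> S"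
  shows "treeset (\<lambda>i::nat. if \<exists>e\<le>K. i = (M + k) div 2 ^ e then f i + 1 else f i) (insert k S)"
  unfolding treeset_def
proof (intro conjI allI impI)
  show "insert k S \<subseteq> {..<M}" using t k by (auto simp: treeset_def)
  fix e i :: nat assume e: "e \<le> K" and i: "2 ^ (K - e) \<le> i \<and> i < 2 * 2 ^ (K - e)"
  have "(\<exists>e\<le>K. i = (M + k) div 2 ^ e) \<longleftrightarrow> (M + k) div 2 ^ e = i"
    by (rule node_at_height[OF k(1) e i])
  moreover have "f i = card {k \<in> S. (M + k) div 2 ^ e = i}" using t e i by (auto simp: treeset_def)
  moreover have "{j \<in> insert k S. (M + j) div 2 ^ e = i} = (if (M + k) div 2 ^ e = i then
     insert k {k \<in> S. (M + k) div 2 ^ e = i} else {k \<in> S. (M + k) div 2 ^ e = i})" by auto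
  ultimately show "(if \<exists>e\<le>K. i = (M + k) div 2 ^ e then f i + 1 else f i) =
      card {j \<in> insert k S. (M + j) div 2 ^ e = i}"
    using k(2) treeset_finite[OF t] by auto
qed

lemma treeset_remove:
  fixes f :: "nat \<Rightarrow> nat"
  assumes t: "treeset f S" and k: "k \<in> S"
  shows "treeset (\<lambda>i::nat. if \<exists>e\<le>K. i = (M + k) div 2 ^ e then f i - 1 else f i) (S - {k})"
    and "e \<le> K \<Longrightarrow> 1 \<le> f ((M + k) div 2 ^ e)"
proof -
  have kM: "k < M" using t k by (auto simp: treeset_def)
  have fin: "finite S" by (rule treeset_finite[OF t])
  show "treeset (\<lambda>i::nat. if \<exists>e\<le>K. i = (M + k) div 2 ^ e then f i - 1 else f i) (S - {k})"
    unfolding treeset_def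
  proof (intro conjI allI impI)
    show "S - {k} \<subseteq> {..<M}" using t k by (auto simp: treeset_def)
    fix e i :: nat assume e: "e \<le> K" and i: "2 ^ (K - e) \<le> i \<and> i < 2 * 2 ^ (K - e)"
    have "(\<exists>e\<le>K. i = (M + k) div 2 ^ e) \<longleftrightarrow> (M + k) div 2 ^ e = i"
      by (rule node_at_height[OF kM e i])
    moreover have "f i = card {k \<in> S. (M + k) div 2 ^ e = i}" using t e i by (auto simp: treeset_def)
    moreover have "{j \<in> S - {k}. (M + j) div 2 ^ e = i} = {k \<in> S. (M + k) div 2 ^ e = i} - {k}" by auto
    ultimately show "(if \<exists>e\<le>K. i = (M + k) div 2 ^ e then f i - 1 else f i) =
        card {j \<in> S - {k}. (M + j) div 2 ^ e = i}"
      using k fin by (auto simp: card_Diff_singleton_if)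
  qed
  assume e: "e \<le> K"
  have "f ((M + k) div 2 ^ e) = card {j \<in> S. (M + j) div 2 ^ e = (M + k) div 2 ^ e}"
    using t e node_range[OF kM e] by (auto simp: treeset_def)
  moreover have "card {j \<in> S. (M + j) div 2 ^ e = (M + k) div 2 ^ e} \<noteq> 0" using fin k by auto
  ultimately show "1 \<le> f ((M + k) div 2 ^ e)" by simp
qed

section \<open>Disjointness of the trees and effect of the tree programs\<close>

lemma tb_lt: "x < n \<Longrightarrow> l \<le> L + 1 \<Longrightarrow> i < 2 * M \<Longrightarrow> tb x l + i < B * B * n"
proof -
  assume a: "x < n" "l \<le> L + 1" "i < 2 * M"
  have "x * B + l < n * B"
  proof -
    have "(x + 1) * B \<le> n * B" using a(1) by (intro mult_right_mono) auto
    then show ?thesis using a(2) B_bounds(3) by simp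
  qed
  then have "(x * B + l + 1) * B \<le> n * B * B" by (intro mult_right_mono) auto
  then show ?thesis using a(3) B_bounds(2) by (simp add: tb_def mult_ac)
qed

lemma BBn: "B * B * n < WW"
proof -
  have "B * B * n \<le> B * B * B" using B_bounds by simp
  moreover have "(0::nat) < B * B * B" using B_bounds by simp
  ultimately show ?thesis using WW_B(4) by linarith
qed

lemma tb_inj: "x < n \<Longrightarrow> l \<le> L + 1 \<Longrightarrow> i < 2 * M \<Longrightarrow> x' < n \<Longrightarrow> l' \<le> L + 1 \<Longrightarrow> i' < 2 * M \<Longrightarrow>
    tb x l + i = tb x' l' + i' \<longleftrightarrow> x = x' \<and> l = l' \<and> i = i'"
proof -
  assume a: "x < n" "l \<le> L + 1" "i < 2 * M" "x' < n" "l' \<le> L + 1" "i' < 2 * M"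
  have "i < B" "i' < B" "l < B" "l' < B" using a B_bounds by linarith+
  then show ?thesis unfolding tb_def by (simp add: B_inj)
qed

text \<open>The effect \<open>g\<close> on a counter is abstract because the two uses avoid
  wrap-around for different reasons: counters to be increased are at most \<open>M\<close>, and
  counters to be decreased are at least 1.\<close>

lemma tree_upd_wp:
  assumes r: "reg s ''M'' = M" "reg s ''p'' = tb x l" "reg s ''k'' = k" "x < n" "l \<le> L + 1" "k < M"
    and g: "\<And>e. e \<le> K \<Longrightarrow> binop_val w f (mem s ''T'' (tb x l + (M + k) div 2 ^ e)) 1 = g (mem s ''T'' (tb x l + (M + k) div 2 ^ e))"
    and Q: "\<And>t' s'. t' \<le> t + 40 * K \<Longrightarrow> frame s s' {''i''} {''T''} \<Longrightarrow>
       mem s' ''T'' = (\<lambda>a. if \<exists>e\<le>K. a = tb x l + (M + k) div 2 ^ e then g (mem s ''T'' a) else mem s ''T'' a) \<Longrightarrow> Q t' s'"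
  shows "wp w (tree_upd f) Q t s"
proof -
  have Mk: "M + k < WW" using r(6) B_bounds WW_B(1) by linarith
  have K1: "2 \<le> K"
  proof -
    have "(2::nat) ^ 2 \<le> 2 ^ K" using K2n n2 by simp
    then show ?thesis by (simp only: power_increasing_iff one_less_numeral_iff semiring_norm)
  qed
  define I where "I = (\<lambda>t' (s'::state). \<exists>e\<le>K+1. t' \<le> t + 4 + e * 20 \<and> reg s' ''i'' = (M + k) div 2 ^ e \<and>
      mem s' ''T'' = (\<lambda>a. if \<exists>e'<e. a = tb x l + (M + k) div 2 ^ e' then g (mem s ''T'' a) else mem s ''T'' a))"
  have lt: "tb x l + (M + k) div 2 ^ e < WW" for e
    using tb_lt[OF r(4,5) node_lt[OF r(6)]] BBn by (meson less_trans)
  show ?thesis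
    unfolding tree_upd_def wp_Seq wp_Assign
  proof (rule wp_frame, rule wp_While[where I = I and Bd = "t + 4 + (K + 1) * 20"], goal_cases)
    case 1
    show ?case using r Mk by (auto simp: I_def intro!: exI[of _ 0])
  next
    case (2 t' s')
    then obtain e where "e \<le> K + 1" "t' \<le> t + 4 + e * 20" by (auto simp: I_def)
    then show ?case by (meson add_left_mono le_trans mult_le_mono1)
  next
    case (3 t' s')
    then obtain e where e: "e \<le> K + 1" "t' \<le> t + 4 + e * 20" "reg s' ''i'' = (M + k) div 2 ^ e"
      "mem s' ''T'' = (\<lambda>a. if \<exists>e'<e. a = tb x l + (M + k) div 2 ^ e' then g (mem s ''T'' a) else mem s ''T'' a)"
      by (auto simp: I_def)
    have regs: "reg s' ''p'' = tb x l" using 3(2) r by (simp add: frame_def)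
    \<comment> \<open>Index 0 is reached exactly at height \<open>K + 1\<close>, after the root has
      been updated.\<close>
    have "(M + k) div 2 ^ (K + 1) = 0" using r(6) by (simp add: M_def)
    then have "e \<noteq> K + 1" using e(3) 3(3) by auto
    then have eK: "e \<le> K" using e(1) by simp
    have neq: "(M + k) div 2 ^ e' \<noteq> (M + k) div 2 ^ e" if "e' < e" for e'
    proof
      assume h: "(M + k) div 2 ^ e' = (M + k) div 2 ^ e"
      have e': "e' \<le> K" using that eK by simp
      have "e' = e"
        using range_disjoint[OF node_range[OF r(6) e'] _ _ e' eK] node_range[OF r(6) eK] h by simp
      then show False using that by simp
    qed
    have nex: "\<not> (\<exists>e'<e. (M + k) div 2 ^ e = (M + k) div 2 ^ e')" using neq by metis
    have T: "mem s' ''T'' (tb x l + (M + k) div 2 ^ e) = mem s ''T'' (tb x l + (M + k) div 2 ^ e)"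
      by (simp add: e(4) nex)
    show ?case
      unfolding I_def
      apply (simp add: regs e(3) lt)
      apply (rule exI[of _ "Suc e"])
      using eK e(2) g[OF eK] regs T lt nex
      by (auto simp: e(3,4) less_Suc_eq fun_eq_iff expr_val.simps(4) WW_def mult.commute simp flip: div_mult2_eq)
  next
    case (4 t' s')
    then obtain e where e: "e \<le> K + 1" "t' \<le> t + 4 + e * 20" "reg s' ''i'' = (M + k) div 2 ^ e"
      "mem s' ''T'' = (\<lambda>a. if \<exists>e'<e. a = tb x l + (M + k) div 2 ^ e' then g (mem s ''T'' a) else mem s ''T'' a)"
      by (auto simp: I_def)
    have "(M + k) div 2 ^ e = 0" using 4(3) e(3) by simp
    then have "\<not> e \<le> K" using node_range(1)[OF r(6), of e] by auto
    then have "e = K + 1" using e(1) by simp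
    then show ?case using e(2,4) K1 4(2) by (intro impI Q) (auto simp: frame_def less_Suc_eq_le)
  qed
qed

lemma K_ge2: "2 \<le> K"
proof -
  have "(2::nat) ^ 2 \<le> 2 ^ K" using K2n n2 by simp
  then show ?thesis by (simp only: power_increasing_iff one_less_numeral_iff semiring_norm)
qed

lemma forest_upd:
  assumes F: "forest T F" and x: "x < n" "l \<le> L + 1" and k: "k < M"
    and S: "treeset (\<lambda>i. if \<exists>e\<le>K. i = (M + k) div 2 ^ e then g (T (tb x l + i)) else T (tb x l + i)) S"
  shows "forest (\<lambda>a. if \<exists>e\<le>K. a = tb x l + (M + k) div 2 ^ e then g (T a) else T a) (F(x := (F x)(l := S)))"
  unfolding forest_def
proof (intro allI impI)
  fix x' l' assume x': "x' < n" "l' \<le> L + 1"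
  define T' where "T' = (\<lambda>a. if \<exists>e\<le>K. a = tb x l + (M + k) div 2 ^ e then g (T a) else T a)"
  show "treeset (\<lambda>i. T' (tb x' l' + i)) ((F(x := (F x)(l := S))) x' l')"
  proof (cases "x' = x \<and> l' = l")
    case True
    then show ?thesis using S by (simp add: T'_def)
  next
    case False
    have eq: "T' (tb x' l' + i) = T (tb x' l' + i)" if "i < 2 * M" for i
      using tb_inj[OF x' that x node_lt[OF k]] False by (auto simp: T'_def)
    have "treeset (\<lambda>i. T (tb x' l' + i)) (F x' l')" using F x' by (simp add: forest_def)
    moreover have "i < 2 * M" if "i < 2 * 2 ^ (K - e)" for i e
    proof -
      have "(2::nat) ^ (K - e) \<le> 2 ^ K" by (rule power_increasing) auto
      then show ?thesis using that unfolding M_def by linarith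
    qed
    ultimately have "treeset (\<lambda>i. T' (tb x' l' + i)) (F x' l')"
      unfolding treeset_def using eq by auto
    then show ?thesis using False by auto
  qed
qed

lemma tree_inc_wp:
  assumes r: "reg s ''M'' = M" "reg s ''p'' = tb x l" "reg s ''k'' = k" "x < n" "l \<le> L + 1" "k < M"
    and F: "forest (mem s ''T'') F" and k: "k \<notin> F x l"
    and Q: "\<And>t' s'. t' \<le> t + 40 * K \<Longrightarrow> frame s s' {''i''} {''T''} \<Longrightarrow>
       forest (mem s' ''T'') (F(x := (F x)(l := insert k (F x l)))) \<Longrightarrow> Q t' s'"
  shows "wp w (tree_upd Add) Q t s"
proof (rule tree_upd_wp[OF r, where g = Suc])
  have ts: "treeset (\<lambda>i. mem s ''T'' (tb x l + i)) (F x l)" using F r(4,5) by (simp add: forest_def)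
  fix e assume e: "e \<le> K"
  have "mem s ''T'' (tb x l + (M + k) div 2 ^ e) \<le> M"
    using treeset_le[OF ts e node_range[OF r(6) e]] .
  then show "binop_val w Add (mem s ''T'' (tb x l + (M + k) div 2 ^ e)) 1 = Suc (mem s ''T'' (tb x l + (M + k) div 2 ^ e))"
    using B_bounds WW_B(1) by (simp flip: WW_def)
next
  fix t' s' assume a: "t' \<le> t + 40 * K" "frame s s' {''i''} {''T''}"
    "mem s' ''T'' = (\<lambda>a. if \<exists>e\<le>K. a = tb x l + (M + k) div 2 ^ e then Suc (mem s ''T'' a) else mem s ''T'' a)"
  have "treeset (\<lambda>i. if \<exists>e\<le>K. i = (M + k) div 2 ^ e then Suc (mem s ''T'' (tb x l + i)) else mem s ''T'' (tb x l + i)) (insert k (F x l))"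
    unfolding Suc_eq_plus1
    by (rule treeset_insert[OF _ r(6) k, of "\<lambda>i. mem s ''T'' (tb x l + i)"]) (use F r(4,5) in \<open>simp add: forest_def\<close>)
  from forest_upd[OF F r(4,5,6), of Suc, OF this] show "Q t' s'"
    using a by (intro Q) auto
qed

lemma tree_dec_wp:
  assumes r: "reg s ''M'' = M" "reg s ''p'' = tb x l" "reg s ''k'' = k" "x < n" "l \<le> L + 1" "k < M"
    and F: "forest (mem s ''T'') F" and k: "k \<in> F x l"
    and Q: "\<And>t' s'. t' \<le> t + 40 * K \<Longrightarrow> frame s s' {''i''} {''T''} \<Longrightarrow>
       forest (mem s' ''T'') (F(x := (F x)(l := F x l - {k}))) \<Longrightarrow> Q t' s'"
  shows "wp w (tree_upd Sub) Q t s"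
proof (rule tree_upd_wp[OF r, where g = "\<lambda>m. m - 1"])
  have ts: "treeset (\<lambda>i. mem s ''T'' (tb x l + i)) (F x l)" using F r(4,5) by (simp add: forest_def)
  fix e assume e: "e \<le> K"
  let ?m = "mem s ''T'' (tb x l + (M + k) div 2 ^ e)"
  have "?m \<le> M"
    using treeset_le[OF ts e node_range[OF r(6) e]] .
  then have "?m < WW" using B_bounds WW_B(1) by linarith
  moreover have "1 \<le> ?m" using treeset_remove(2)[OF ts k e] .
  moreover from this have "?m + 2 ^ w - 1 = (?m - 1) + 2 ^ w" by linarith
  ultimately show "binop_val w Sub ?m 1 = ?m - 1"
    unfolding binop_val.simps by (simp only: mod_add_self2) (simp add: WW_def)
next
  fix t' s' assume a: "t' \<le> t + 40 * K" "frame s s' {''i''} {''T''}"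
    "mem s' ''T'' = (\<lambda>a. if \<exists>e\<le>K. a = tb x l + (M + k) div 2 ^ e then mem s ''T'' a - 1 else mem s ''T'' a)"
  have "treeset (\<lambda>i. if \<exists>e\<le>K. i = (M + k) div 2 ^ e then mem s ''T'' (tb x l + i) - 1 else mem s ''T'' (tb x l + i)) (F x l - {k})"
    using treeset_remove(1)[OF _ k, of "\<lambda>i. mem s ''T'' (tb x l + i)"] F r(4,5) by (simp add: forest_def)
  from forest_upd[OF F r(4,5,6), of "\<lambda>m. m - 1", OF this] show "Q t' s'"
    using a by (intro Q) auto
qed

lemma find_free_wp:
  assumes r: "reg s ''M'' = M" "reg s ''p'' = tb x l" "reg s ''q'' = tb y m"
    "x < n" "l \<le> L + 1" "y < n" "m \<le> L + 1"
    and F: "forest (mem s ''T'') F" and c: "card (F x l) + card (F y m) < M"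
    and Q: "\<And>t' s' k. t' \<le> t + 40 * K \<Longrightarrow> frame s s' {''i'', ''z'', ''k''} {} \<Longrightarrow>
       reg s' ''k'' = k \<Longrightarrow> k < M \<Longrightarrow> k \<notin> F x l \<Longrightarrow> k \<notin> F y m \<Longrightarrow> k \<le> card (F x l) + card (F y m) \<Longrightarrow> Q t' s'"
  shows "wp w find_free Q t s"
proof -
  let ?T = "mem s ''T''"
  define S1 where "S1 = F x l"
  define S2 where "S2 = F y m"
  have t1: "treeset (\<lambda>i. ?T (tb x l + i)) S1" and t2: "treeset (\<lambda>i. ?T (tb y m + i)) S2"
    using F r by (simp_all add: forest_def S1_def S2_def)
  \<comment> \<open>First inequality: the \<open>i * 2 ^ e - M\<close> colors to the left of the
    current subtree are at most as many as the entries of both sets there, counted with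
    multiplicity. Second: the subtree has fewer than \<open>2 ^ e\<close> entries, so it contains a
    free color. At \<open>e = 0\<close> the second says that color \<open>k\<close> is free and the
    first bounds \<open>k\<close>.\<close>
  define I where "I = (\<lambda>t' (s'::state). \<exists>e\<le>K. \<exists>i. t' + e * 32 \<le> t + 4 + K * 32 \<and> reg s' ''i'' = i \<and> reg s' ''z'' = 2 ^ e \<and>
      2 ^ (K - e) \<le> i \<and> i < 2 * 2 ^ (K - e) \<and> i * 2 ^ e \<le> M + below S1 (i * 2 ^ e) + below S2 (i * 2 ^ e) \<and>
      below S1 ((i + 1) * 2 ^ e) + below S2 ((i + 1) * 2 ^ e) < 2 ^ e + below S1 (i * 2 ^ e) + below S2 (i * 2 ^ e))"
  have MW: "8 * M < WW" using B_bounds WW_B(1) by linarith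
  show ?thesis
    unfolding find_free_def wp_Seq wp_Assign
  proof (rule wp_While[where I = I and Bd = "t + 4 + K * 32"], goal_cases)
    case 1
    show ?case unfolding I_def
      by (rule exI[of _ K], rule conjI[OF order_refl], rule exI[of _ 1])
        (use below_2M[OF t1, unfolded mult_2] below_2M[OF t2, unfolded mult_2] c r(1) in
          \<open>simp add: below_M S1_def S2_def flip: M_def\<close>)
  next
    case (2 t' s')
    then show ?case by (auto simp: I_def)
  next
    case (3 t' s')
    then obtain e i where e: "e \<le> K" "t' + e * 32 \<le> t + 4 + K * 32" "reg s' ''i'' = i" "reg s' ''z'' = 2 ^ e"
      "2 ^ (K - e) \<le> i" "i < 2 * 2 ^ (K - e)" "i * 2 ^ e \<le> M + below S1 (i * 2 ^ e) + below S2 (i * 2 ^ e)"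
      "below S1 ((i + 1) * 2 ^ e) + below S2 ((i + 1) * 2 ^ e) < 2 ^ e + below S1 (i * 2 ^ e) + below S2 (i * 2 ^ e)"
      unfolding I_def by blast
    have regs: "reg s' ''p'' = tb x l" "reg s' ''q'' = tb y m" "reg s' ''M'' = M" "mem s' ''T'' = ?T"
      using 3(2) r by (simp_all add: frame_def)
    have iM: "i < M" using 3(3) e(3) regs by simp
    then have "e \<noteq> 0" using e(5) unfolding M_def by (cases "e = 0") auto
    then obtain d where d: "e = Suc d" by (cases e) auto
    have dK: "d \<le> K" using e(1) d by simp
    have pd: "(2::nat) ^ (K - d) = 2 * 2 ^ (K - e)" using d e(1) by (simp flip: power_Suc add: Suc_diff_Suc)
    have rng: "2 ^ (K - d) \<le> 2 * i" "2 * i < 2 * 2 ^ (K - d)" "2 ^ (K - d) \<le> 2 * i + 1" "2 * i + 1 < 2 * 2 ^ (K - d)"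
      using e(5,6) pd by linarith+
    define a1 where "a1 = ?T (tb x l + 2 * i)"
    define a2 where "a2 = ?T (tb y m + 2 * i)"
    define P where "P = (2::nat) ^ d"
    have b1: "a1 + below S1 (2 * i * P) = below S1 ((2 * i + 1) * P)" "a2 + below S2 (2 * i * P) = below S2 ((2 * i + 1) * P)"
      using treeset_below[OF t1 dK rng(1,2)] treeset_below[OF t2 dK rng(1,2)] by (simp_all add: a1_def a2_def P_def)
    have le: "a1 \<le> M" "a2 \<le> M"
      using treeset_le[OF t1 dK rng(1,2)] treeset_le[OF t2 dK rng(1,2)] by (simp_all add: a1_def a2_def)
    have e2: "(2::nat) ^ e = 2 * P" "i * 2 ^ e = 2 * i * P" "(i + 1) * 2 ^ e = (2 * i + 2) * P" by (simp_all add: d P_def)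
    have e7: "2 * i * P \<le> M + below S1 (2 * i * P) + below S2 (2 * i * P)"
      and e8: "below S1 ((2 * i + 2) * P) + below S2 ((2 * i + 2) * P) < 2 * P + below S1 (2 * i * P) + below S2 (2 * i * P)"
      using e(7,8) unfolding e2(2,3) unfolding e2(1) by auto
    have ev: "expr_val w (Load ''T'' (Reg ''p'' +. Reg ''i'')) s2 = mem s2 ''T'' (tb x l + reg s2 ''i'')"
      "expr_val w (Load ''T'' (Reg ''q'' +. Reg ''i'')) s2 = mem s2 ''T'' (tb y m + reg s2 ''i'')"
      if "reg s2 ''p'' = tb x l" "reg s2 ''q'' = tb y m" "reg s2 ''i'' < 2 * M" for s2
      using tb_lt[OF r(4,5) that(3)] tb_lt[OF r(6,7) that(3)] BBn that by simp_all
    have z: "(2::nat) ^ e div 2 = P" by (simp add: d P_def)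
    have W: "a1 + a2 < WW" "2 * i + 1 < WW" "2 * i < WW" "i * 2 = 2 * i" "2 * i < 2 * M" using le iM MW by linarith+
    show ?case
    proof (cases "a1 + a2 < P")
      case True
      have "I t2 s2" if "t2 \<le> t' + 32"
          "reg s2 ''i'' = 2 * i" "reg s2 ''z'' = P" for t2 s2
        unfolding I_def
      proof (rule exI[of _ d], rule conjI[OF dK], rule exI[of _ "2 * i"], intro conjI)
        show "t2 + d * 32 \<le> t + 4 + K * 32" using e(2) d that(1) by simp
        show "2 * i * 2 ^ d \<le> M + below S1 (2 * i * 2 ^ d) + below S2 (2 * i * 2 ^ d)" using e7 by (simp add: P_def)
        show "below S1 ((2 * i + 1) * 2 ^ d) + below S2 ((2 * i + 1) * 2 ^ d) < 2 ^ d + below S1 (2 * i * 2 ^ d) + below S2 (2 * i * 2 ^ d)"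
          using b1 True unfolding P_def[symmetric] by linarith
      qed (use that rng dK P_def in auto)
      then show ?thesis using True W(1,2,3) iM
        by (simp add: regs e(3,4) z W(4) ev a1_def[symmetric] a2_def[symmetric] del: expr_val.simps(3)) 
    next
      case False
      have s: "2 * i + 1 + 1 = 2 * i + 2" by simp
      have g: "(2 * i + 1) * P = 2 * i * P + P" by (simp add: algebra_simps)
      have "I t2 s2" if "t2 \<le> t' + 32"
          "reg s2 ''i'' = 2 * i + 1" "reg s2 ''z'' = P" for t2 s2
        unfolding I_def
      proof (rule exI[of _ d], rule conjI[OF dK], rule exI[of _ "2 * i + 1"], intro conjI)
        show "t2 + d * 32 \<le> t + 4 + K * 32" using e(2) d that(1) by simp
        show "(2 * i + 1) * 2 ^ d \<le> M + below S1 ((2 * i + 1) * 2 ^ d) + below S2 ((2 * i + 1) * 2 ^ d)"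
          using e7 b1 False g unfolding P_def[symmetric] by linarith
        show "below S1 ((2 * i + 1 + 1) * 2 ^ d) + below S2 ((2 * i + 1 + 1) * 2 ^ d) < 2 ^ d + below S1 ((2 * i + 1) * 2 ^ d) + below S2 ((2 * i + 1) * 2 ^ d)"
          using b1 False e8 unfolding P_def[symmetric] s by linarith
      qed (use that rng dK P_def in auto)
      then show ?thesis using False W(1,2,3) iM
        by (simp add: regs e(3,4) z W(4) ev a1_def[symmetric] a2_def[symmetric] del: expr_val.simps(3))
    qed
  next
    case (4 t' s')
    then obtain e i where e: "e \<le> K" "t' + e * 32 \<le> t + 4 + K * 32" "reg s' ''i'' = i" "reg s' ''z'' = 2 ^ e"
      "2 ^ (K - e) \<le> i" "i < 2 * 2 ^ (K - e)" "i * 2 ^ e \<le> M + below S1 (i * 2 ^ e) + below S2 (i * 2 ^ e)"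
      "below S1 ((i + 1) * 2 ^ e) + below S2 ((i + 1) * 2 ^ e) < 2 ^ e + below S1 (i * 2 ^ e) + below S2 (i * 2 ^ e)"
      unfolding I_def by blast
    have regs: "reg s' ''M'' = M" using 4(2) r by (simp add: frame_def)
    have iM: "M \<le> i" using 4(3) e(3) regs by (auto simp: not_less)
    have "e = 0"
    proof (rule ccontr)
      assume "e \<noteq> 0"
      then have "2 * 2 ^ (K - e) \<le> M" using e(1) unfolding M_def
        by (metis diff_less le_zero_eq not_le power_Suc power_increasing Suc_leI less_le_trans one_le_numeral bot_nat_0.not_eq_extremum)
      then show False using e(6) iM by linarith
    qed
    define k where "k = i - M"
    have i: "i = M + k" using iM k_def by simp
    have kM: "k < M" using e(6) \<open>e = 0\<close> i unfolding M_def by simp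
    have b: "k \<le> below S1 (M + k) + below S2 (M + k)" "below S1 (M + k + 1) + below S2 (M + k + 1) < 1 + below S1 (M + k) + below S2 (M + k)"
      using e(7,8) \<open>e = 0\<close> i by simp_all
    have nin: "k \<notin> S1" "k \<notin> S2"
      using b(2) below_Suc[OF treeset_finite[OF t1], of k] below_Suc[OF treeset_finite[OF t2], of k] by (auto split: if_splits)
    have kle: "k \<le> card S1 + card S2" using b(1) below_le[OF t1, of "M + k"] below_le[OF t2, of "M + k"] by linarith
    have W: "i < WW" using i kM MW by linarith
    show ?case
      by (simp add: e(3) regs W iM) (rule Q[where k = k]; use kM nin kle k_def e(2) \<open>e = 0\<close> K_ge2 4(2) in \<open>simp add: S1_def S2_def frame_def\<close>)
  qed
qed

lemma select_rank_wp:
  assumes r: "reg s ''M'' = M" "reg s ''p'' = tb x l" "reg s ''r'' = rk" "x < n" "l \<le> L + 1"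
    and F: "forest (mem s ''T'') F" and c: "1 \<le> rk" "rk \<le> card (F x l)"
    and Q: "\<And>t' s' k. t' \<le> t + 40 * K \<Longrightarrow> frame s s' {''i'', ''z'', ''k''} {} \<Longrightarrow>
       reg s' ''k'' = k \<Longrightarrow> k < M \<Longrightarrow> k \<in> F x l \<Longrightarrow> card {j \<in> F x l. j < k} = rk - 1 \<Longrightarrow> Q t' s'"
  shows "wp w select_rank Q t s"
proof -
  let ?T = "mem s ''T''"
  define S1 where "S1 = F x l"
  have t1: "treeset (\<lambda>i. ?T (tb x l + i)) S1"
    using F r by (simp_all add: forest_def S1_def)
  \<comment> \<open>\<open>z\<close> is the rank still to be found inside the current subtree: the
    entries to its left have been subtracted from \<open>rk\<close>.\<close>
  define I where "I = (\<lambda>t' (s'::state). \<exists>e\<le>K. \<exists>i. t' + e * 32 \<le> t + 4 + K * 32 \<and> reg s' ''i'' = i \<and>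
      reg s' ''z'' + below S1 (i * 2 ^ e) = rk \<and> 1 \<le> reg s' ''z'' \<and> rk \<le> below S1 ((i + 1) * 2 ^ e) \<and>
      2 ^ (K - e) \<le> i \<and> i < 2 * 2 ^ (K - e))"
  have MW: "8 * M < WW" using B_bounds WW_B(1) by linarith
  have rkW: "rk < WW" using c(2) treeset_card_le[OF t1] MW by (simp add: S1_def)
  show ?thesis
    unfolding select_rank_def wp_Seq wp_Assign
  proof (rule wp_While[where I = I and Bd = "t + 4 + K * 32"], goal_cases)
    case 1
    show ?case unfolding I_def
      by (rule exI[of _ K], rule conjI[OF order_refl], rule exI[of _ 1])
        (use below_2M[OF t1, unfolded mult_2] c r(1,3) in \<open>simp add: below_M S1_def flip: M_def\<close>)
  next
    case (2 t' s')
    then show ?case by (auto simp: I_def)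
  next
    case (3 t' s')
    then obtain e i where e: "e \<le> K" "t' + e * 32 \<le> t + 4 + K * 32" "reg s' ''i'' = i"
      "reg s' ''z'' + below S1 (i * 2 ^ e) = rk" "1 \<le> reg s' ''z''" "rk \<le> below S1 ((i + 1) * 2 ^ e)"
      "2 ^ (K - e) \<le> i" "i < 2 * 2 ^ (K - e)"
      unfolding I_def by blast
    have regs: "reg s' ''p'' = tb x l" "reg s' ''M'' = M" "mem s' ''T'' = ?T"
      using 3(2) r by (simp_all add: frame_def)
    have iM: "i < M" using 3(3) e(3) regs by simp
    then have "e \<noteq> 0" using e(7) unfolding M_def by (cases "e = 0") auto
    then obtain d where d: "e = Suc d" by (cases e) auto
    have dK: "d \<le> K" using e(1) d by simp
    have pd: "(2::nat) ^ (K - d) = 2 * 2 ^ (K - e)" using d e(1) by (simp flip: power_Suc add: Suc_diff_Suc)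
    have rng: "2 ^ (K - d) \<le> 2 * i" "2 * i < 2 * 2 ^ (K - d)" "2 ^ (K - d) \<le> 2 * i + 1" "2 * i + 1 < 2 * 2 ^ (K - d)"
      using e(7,8) pd by linarith+
    define a1 where "a1 = ?T (tb x l + 2 * i)"
    define P where "P = (2::nat) ^ d"
    have b1: "a1 + below S1 (2 * i * P) = below S1 ((2 * i + 1) * P)"
      using treeset_below[OF t1 dK rng(1,2)] by (simp_all add: a1_def P_def)
    have le: "a1 \<le> M"
      using treeset_le[OF t1 dK rng(1,2)] by (simp_all add: a1_def)
    have e2: "(2::nat) ^ e = 2 * P" "i * 2 ^ e = 2 * i * P" "(i + 1) * 2 ^ e = (2 * i + 2) * P" by (simp_all add: d P_def)
    have e4: "reg s' ''z'' + below S1 (2 * i * P) = rk" "rk \<le> below S1 ((2 * i + 2) * P)"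
      using e(4,6) unfolding e2(2,3) unfolding e2(1) by auto
    have ev: "expr_val w (Load ''T'' (Reg ''p'' +. Reg ''i'')) s2 = mem s2 ''T'' (tb x l + reg s2 ''i'')"
      if "reg s2 ''p'' = tb x l" "reg s2 ''i'' < 2 * M" for s2
      using tb_lt[OF r(4,5) that(2)] BBn that by simp_all
    have zW: "reg s' ''z'' < WW" using e4(1) rkW by linarith
    have W: "2 * i + 1 < WW" "2 * i < WW" "i * 2 = 2 * i" "2 * i < 2 * M" using le iM MW by linarith+
    show ?case
    proof (cases "a1 < reg s' ''z''")
      case False
      have "I t2 s2" if "t2 \<le> t' + 32"
          "reg s2 ''i'' = 2 * i" "reg s2 ''z'' = reg s' ''z''" for t2 s2
        unfolding I_def
      proof (rule exI[of _ d], rule conjI[OF dK], rule exI[of _ "2 * i"], intro conjI)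
        show "t2 + d * 32 \<le> t + 4 + K * 32" using e(2) d that(1) by simp
        show "reg s2 ''z'' + below S1 (2 * i * 2 ^ d) = rk" using e4 that by (simp add: P_def)
        show "rk \<le> below S1 ((2 * i + 1) * 2 ^ d)" using b1 False e4 unfolding P_def by linarith
      qed (use that rng dK P_def e(5) in auto)
      then show ?thesis using False W(1,2) iM
        by (simp add: regs e(3) W(3) ev a1_def[symmetric] del: expr_val.simps(3)) 
    next
      case True
      have s: "2 * i + 1 + 1 = 2 * i + 2" by simp
      have "I t2 s2" if "t2 \<le> t' + 32"
          "reg s2 ''i'' = 2 * i + 1" "reg s2 ''z'' = reg s' ''z'' - a1" for t2 s2
        unfolding I_def
      proof (rule exI[of _ d], rule conjI[OF dK], rule exI[of _ "2 * i + 1"], intro conjI)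
        show "t2 + d * 32 \<le> t + 4 + K * 32" using e(2) d that(1) by simp
        show "reg s2 ''z'' + below S1 ((2 * i + 1) * 2 ^ d) = rk" using b1 e4 that True unfolding P_def by linarith
        show "rk \<le> below S1 ((2 * i + 1 + 1) * 2 ^ d)" using e4(2) unfolding s P_def .
      qed (use that rng dK P_def True in auto)
      then show ?thesis using True W(1,2) iM
        by (simp add: regs e(3) W(3) ev zW a1_def[symmetric] del: expr_val.simps(3))
    qed
  next
    case (4 t' s')
    then obtain e i where e: "e \<le> K" "t' + e * 32 \<le> t + 4 + K * 32" "reg s' ''i'' = i"
      "reg s' ''z'' + below S1 (i * 2 ^ e) = rk" "1 \<le> reg s' ''z''" "rk \<le> below S1 ((i + 1) * 2 ^ e)"
      "2 ^ (K - e) \<le> i" "i < 2 * 2 ^ (K - e)"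
      unfolding I_def by blast
    have regs: "reg s' ''M'' = M" using 4(2) r by (simp add: frame_def)
    have iM: "M \<le> i" using 4(3) e(3) regs by (auto simp: not_less)
    have "e = 0"
    proof (rule ccontr)
      assume "e \<noteq> 0"
      then have "2 * 2 ^ (K - e) \<le> M" using e(1) unfolding M_def
        by (metis diff_less le_zero_eq not_le power_Suc power_increasing Suc_leI less_le_trans one_le_numeral bot_nat_0.not_eq_extremum)
      then show False using e(8) iM by linarith
    qed
    define k where "k = i - M"
    have i: "i = M + k" using iM k_def by simp
    have kM: "k < M" using e(8) \<open>e = 0\<close> i unfolding M_def by simp
    have fin: "finite S1" by (rule treeset_finite[OF t1])
    have b: "below S1 (M + k) < rk" "rk \<le> below S1 (M + k + 1)" using e(4,5,6) \<open>e = 0\<close> i by auto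
    have kin: "k \<in> S1" and kr: "below S1 (M + k) = rk - 1"
      using b below_Suc[OF fin, of k] by (auto split: if_splits)
    have W: "i < WW" using i kM MW by linarith
    show ?case
      by (simp add: e(3) regs W iM) (rule Q[where k = k]; use kM kin kr k_def e(2) \<open>e = 0\<close> K_ge2 4(2) in \<open>simp add: S1_def frame_def below_def\<close>)
  qed
qed

end

section \<open>Edge operations\<close>

definition caddr :: "expr \<Rightarrow> expr \<Rightarrow> expr" where
  "caddr x y = x *. Reg ''n'' +. y"

definition tbase :: "expr \<Rightarrow> expr \<Rightarrow> expr" where
  "tbase x l = baddr x l *. Reg ''B''"

definition upd_tree :: "binop \<Rightarrow> expr \<Rightarrow> expr \<Rightarrow> com" where
  "upd_tree f x l = (''p'' ::= tbase x l ;; tree_upd f)"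

definition all_e :: expr where "all_e = Reg ''L'' +. Const 1"

text \<open>The output format reads the cell with the smaller endpoint first. The color is stored in
  both orders, so that programs can look up an edge without comparing its endpoints.\<close>

definition set_color :: com where
  "set_color =
    (Store ''color'' (caddr (Reg ''x'') (Reg ''y'')) (Reg ''k'' +. Const 1) ;;
     Store ''color'' (caddr (Reg ''y'') (Reg ''x'')) (Reg ''k'' +. Const 1) ;;
     Store ''at'' (baddr (Reg ''x'') (Reg ''k'')) (Reg ''y'' +. Const 1) ;;
     Store ''at'' (baddr (Reg ''y'') (Reg ''k'')) (Reg ''x'' +. Const 1) ;;
     upd_tree Add (Reg ''x'') (Reg ''l'') ;; upd_tree Add (Reg ''x'') all_e ;;
     upd_tree Add (Reg ''y'') (Reg ''l'') ;; upd_tree Add (Reg ''y'') all_e)"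

definition unset_color :: com where
  "unset_color =
    (Store ''color'' (caddr (Reg ''x'') (Reg ''y'')) (Const 0) ;;
     Store ''color'' (caddr (Reg ''y'') (Reg ''x'')) (Const 0) ;;
     Store ''at'' (baddr (Reg ''x'') (Reg ''k'')) (Const 0) ;;
     Store ''at'' (baddr (Reg ''y'') (Reg ''k'')) (Const 0) ;;
     upd_tree Sub (Reg ''x'') (Reg ''l'') ;; upd_tree Sub (Reg ''x'') all_e ;;
     upd_tree Sub (Reg ''y'') (Reg ''l'') ;; upd_tree Sub (Reg ''y'') all_e)"

definition relevel :: com where
  "relevel =
    (upd_tree Sub (Reg ''x'') (Reg ''l'') ;; upd_tree Add (Reg ''x'') (Reg ''m'') ;;
     upd_tree Sub (Reg ''y'') (Reg ''l'') ;; upd_tree Add (Reg ''y'') (Reg ''m''))"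

lemma writes_edge [simp]:
  "wr (upd_tree f x l) = {''i'', ''p''}" "wm (upd_tree f x l) = {''T''}"
  "wr set_color = {''i'', ''p''}" "wm set_color = {''color'', ''at'', ''T''}"
  "wr unset_color = {''i'', ''p''}" "wm unset_color = {''color'', ''at'', ''T''}"
  "wr relevel = {''i'', ''p''}" "wm relevel = {''T''}"
  by (auto simp: upd_tree_def set_color_def unset_color_def relevel_def)

definition upd2 :: "(nat \<Rightarrow> nat \<Rightarrow> nat) \<Rightarrow> nat \<Rightarrow> nat \<Rightarrow> nat \<Rightarrow> nat \<Rightarrow> nat \<Rightarrow> nat" where
  "upd2 c x y v = (\<lambda>a b. if a = x \<and> b = y \<or> a = y \<and> b = x then v else c a b)"

text \<open>The summand 1 makes the step at least \<open>a / N\<close> in spite of the rounding,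
  also where \<open>a div N = 0\<close>. Stopping at \<open>M\<close> keeps all parameters at most
  \<open>2 * M\<close>.\<close>

fun next_val :: "nat \<Rightarrow> nat \<Rightarrow> nat \<Rightarrow> nat" where
  "next_val N M a = (if a < M then a + 1 + a div N else a)"

context ctx begin

definition Av :: "nat \<Rightarrow> nat" where
  "Av j = (next_val N M ^^ j) 1"

text \<open>Register \<open>1\<close> tells whether the initialization has been run.\<close>

definition glob :: "state \<Rightarrow> bool" where
  "glob s \<longleftrightarrow> reg s ''n'' = n \<and> reg s ''M'' = M \<and> reg s ''B'' = B \<and> reg s ''L'' = L \<and>
     reg s ''R'' = R \<and> reg s ''J'' = J \<and> reg s ''1'' = 1 \<and> (\<forall>j\<le>J. mem s ''tab'' j = Av j)"

lemma globD: "glob s \<Longrightarrow> reg s ''n'' = n" "glob s \<Longrightarrow> reg s ''M'' = M" "glob s \<Longrightarrow> reg s ''B'' = B"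
  "glob s \<Longrightarrow> reg s ''L'' = L" "glob s \<Longrightarrow> reg s ''R'' = R" "glob s \<Longrightarrow> reg s ''J'' = J"
  by (simp_all add: glob_def)

lemma glob_frame: "frame s s' X A \<Longrightarrow> glob s \<Longrightarrow>
    {''n'', ''M'', ''B'', ''L'', ''R'', ''J'', ''1''} \<inter> X = {} \<Longrightarrow> ''tab'' \<notin> A \<Longrightarrow> glob s'"
  by (auto simp: glob_def frame_def)

lemma L_WW: "L + 1 < WW" "n < WW" "M < WW"
  using B_bounds WW_B(1) by linarith+

lemma ev_all [simp]: "glob s \<Longrightarrow> expr_val w all_e s = L + 1"
  using L_WW by (simp add: globD all_e_def)

lemma ev_tbase [simp]:
  assumes "glob s" "expr_val w X s < n" "expr_val w l s \<le> L + 1"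
  shows "expr_val w (tbase X l) s = tb (expr_val w X s) (expr_val w l s)"
proof -
  have "expr_val w X s < B * n" "expr_val w l s < B"
    using assms B_bounds by (auto intro: less_le_trans)
  then have "expr_val w (baddr X l) s = expr_val w X s * B + expr_val w l s"
    using ev_baddr globD assms(1) by blast
  moreover have "tb (expr_val w X s) (expr_val w l s) < WW"
    using tb_lt[OF assms(2,3), of 0] BBn B_bounds by simp
  ultimately show ?thesis using assms(1) unfolding tbase_def tb_def by (simp add: globD)
qed

lemma ev_baddr' [simp]:
  assumes "glob s" "expr_val w X s < n" "expr_val w l s < B"
  shows "expr_val w (baddr X l) s = expr_val w X s * B + expr_val w l s"
proof -
  have "expr_val w X s < B * n" 
    using assms B_bounds by (auto intro: less_le_trans)
  then show ?thesis using ev_baddr globD assms by blast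
qed

lemma ev_caddr [simp]:
  assumes "glob s" "expr_val w X s < n" "expr_val w Y s < n"
  shows "expr_val w (caddr X Y) s = expr_val w X s * n + expr_val w Y s"
proof -
  have "(expr_val w X s + 1) * n \<le> n * n" using assms(2) by (intro mult_right_mono) auto
  then have 1: "expr_val w X s * n + expr_val w Y s < n * n" using assms(3) by simp
  have "n * n \<le> B * B" using B_bounds by (intro mult_mono) auto
  moreover have "0 < B * B" using B_bounds(5) by simp
  ultimately have "n * n < WW" using WW_B(3) by linarith
  then show ?thesis using assms 1 unfolding caddr_def by (simp add: globD)
qed

lemma n_inj: "x * n + y = x' * n + y' \<longleftrightarrow> x = x' \<and> y = y'" if "y < n" "y' < n"
proof -
  have "(x * n + y) div n = x" "(x' * n + y') div n = x'" "(x * n + y) mod n = y" "(x' * n + y') mod n = y'"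
    using that by auto
  then show ?thesis by metis
qed

lemma times [simp]: "expr_time (caddr X Y) = expr_time X + expr_time Y + 3"
  "expr_time (baddr X Y) = expr_time X + expr_time Y + 3"
  "expr_time (tbase X Y) = expr_time X + expr_time Y + 5"
  "expr_time all_e = 3"
  by (simp_all add: caddr_def baddr_def tbase_def all_e_def)

section \<open>Ghost colorings and their representation in memory\<close>

definition cols :: "(nat \<Rightarrow> nat \<Rightarrow> nat) \<Rightarrow> nat \<Rightarrow> nat set" where
  "cols c x = {k. \<exists>y<n. c x y = Suc k}"

definition FF :: "(nat \<Rightarrow> nat \<Rightarrow> nat) \<Rightarrow> (nat \<Rightarrow> nat \<Rightarrow> nat) \<Rightarrow> nat \<Rightarrow> nat \<Rightarrow> nat set" where
  "FF c el x l = (if l = L + 1 then cols c x else {k. \<exists>y<n. c x y = Suc k \<and> el x y = l})"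

definition okc :: "(nat \<Rightarrow> nat \<Rightarrow> nat) \<Rightarrow> bool" where
  "okc c \<longleftrightarrow> (\<forall>x<n. \<forall>y<n. c x y = c y x \<and> c x y \<le> M) \<and> (\<forall>x<n. c x x = 0) \<and>
     (\<forall>x<n. \<forall>y<n. \<forall>z<n. c x y = c x z \<longrightarrow> c x y \<noteq> 0 \<longrightarrow> y = z)"

lemma okc_sym: "okc c \<Longrightarrow> x < n \<Longrightarrow> y < n \<Longrightarrow> c x y = c y x"
  unfolding okc_def by blast
lemma okc_le: "okc c \<Longrightarrow> x < n \<Longrightarrow> y < n \<Longrightarrow> c x y \<le> M"
  unfolding okc_def by blast
lemma okc_irrefl: "okc c \<Longrightarrow> x < n \<Longrightarrow> c x x = 0"
  unfolding okc_def by blast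
lemma okc_uniq: "okc c \<Longrightarrow> x < n \<Longrightarrow> y < n \<Longrightarrow> z < n \<Longrightarrow> c x y = Suc k \<Longrightarrow> c x z = Suc k \<Longrightarrow> y = z"
  unfolding okc_def by (metis nat.distinct(1))

text \<open>Color \<open>k\<close> is stored as \<open>k + 1\<close> in segment \<open>color\<close>, where \<open>0\<close> means that there is no edge or that the
  edge is uncolored, and segment \<open>at\<close> maps a node and a color to the neighbor plus one. For each node
  there is a tree for each level, with the colors of its edges on that level, and a tree with index
  \<open>L + 1\<close> for the colors of all its edges. The ghost variable \<open>el\<close> gives the levels of the edges; it
  differs from the minimum of the levels of the endpoints only while a node is being moved.\<close>

definition rep :: "(string \<Rightarrow> nat \<Rightarrow> nat) \<Rightarrow> (nat \<Rightarrow> nat \<Rightarrow> nat) \<Rightarrow> (nat \<Rightarrow> nat \<Rightarrow> nat) \<Rightarrow> bool" where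
  "rep \<mu> c el \<longleftrightarrow> (\<forall>x<n. \<forall>y<n. \<mu> ''color'' (x * n + y) = c x y) \<and>
     (\<forall>x<n. \<forall>k<M. \<mu> ''at'' (x * B + k) \<le> n \<and> (\<forall>y<n. \<mu> ''at'' (x * B + k) = Suc y \<longleftrightarrow> c x y = Suc k)) \<and>
     forest (\<mu> ''T'') (FF c el)"

lemma rep_color: "rep \<mu> c el \<Longrightarrow> x < n \<Longrightarrow> y < n \<Longrightarrow> \<mu> ''color'' (x * n + y) = c x y"
  by (simp add: rep_def)
lemma rep_at: "rep \<mu> c el \<Longrightarrow> x < n \<Longrightarrow> k < M \<Longrightarrow> y < n \<Longrightarrow> \<mu> ''at'' (x * B + k) = Suc y \<longleftrightarrow> c x y = Suc k"
  by (simp add: rep_def)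
lemma rep_at_le: "rep \<mu> c el \<Longrightarrow> x < n \<Longrightarrow> k < M \<Longrightarrow> \<mu> ''at'' (x * B + k) \<le> n"
  by (simp add: rep_def)
lemma rep_forest: "rep \<mu> c el \<Longrightarrow> forest (\<mu> ''T'') (FF c el)"
  by (simp add: rep_def)

lemma forest_cong: "forest T F \<Longrightarrow> (\<And>x l. x < n \<Longrightarrow> l \<le> L + 1 \<Longrightarrow> F x l = F' x l) \<Longrightarrow> forest T F'"
  by (simp add: forest_def)

lemma upd_inc_wp:
  assumes r: "glob s" "expr_val w X s = x" "expr_val w le s = l" "reg s ''k'' = k" "x < n" "l \<le> L + 1" "k < M"
    and F: "forest (mem s ''T'') F" and k: "k \<notin> F x l"
    and Q: "\<And>t' s'. t' \<le> t + (40 * K + 6 + expr_time X + expr_time le) \<Longrightarrow> frame s s' {''i'', ''p''} {''T''} \<Longrightarrow>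
       forest (mem s' ''T'') (F(x := (F x)(l := insert k (F x l)))) \<Longrightarrow> Q t' s'"
  shows "wp w (upd_tree Add X le) Q t s"
  unfolding upd_tree_def wp_Seq wp_Assign
  by (rule tree_inc_wp[where x = x and l = l and F = F and k = k])
     (use r F k in \<open>auto simp: globD intro!: Q simp: frame_def\<close>)

lemma upd_dec_wp:
  assumes r: "glob s" "expr_val w X s = x" "expr_val w le s = l" "reg s ''k'' = k" "x < n" "l \<le> L + 1" "k < M"
    and F: "forest (mem s ''T'') F" and k: "k \<in> F x l"
    and Q: "\<And>t' s'. t' \<le> t + (40 * K + 6 + expr_time X + expr_time le) \<Longrightarrow> frame s s' {''i'', ''p''} {''T''} \<Longrightarrow>
       forest (mem s' ''T'') (F(x := (F x)(l := F x l - {k}))) \<Longrightarrow> Q t' s'"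
  shows "wp w (upd_tree Sub X le) Q t s"
  unfolding upd_tree_def wp_Seq wp_Assign
  by (rule tree_dec_wp[where x = x and l = l and F = F and k = k])
     (use r F k in \<open>auto simp: globD intro!: Q simp: frame_def\<close>)

lemma FF_mem: "b \<noteq> L + 1 \<Longrightarrow> j \<in> FF c el x b \<longleftrightarrow> (\<exists>z<n. c x z = Suc j \<and> el x z = b)"
  by (simp add: FF_def)

lemma FF_notin:
  assumes "okc c" "x < n" "y < n" "c x y = Suc k" "b \<noteq> L + 1" "el x y \<noteq> b"
  shows "k \<notin> FF c el x b"
  using okc_uniq[OF assms(1,2,3) _ assms(4)] assms(5,6) by (auto simp: FF_mem)

lemma FF_upd2:
  assumes "okc c" "x < n" "y < n" "c x y = Suc k" "b \<noteq> L + 1"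
  shows "FF c (upd2 el x y m) x b = (if b = m then insert k (FF c el x b) else FF c el x b - {k})"
proof (rule set_eqI)
  have xy: "x \<noteq> y" using okc_irrefl assms by fastforce
  fix j
  show "j \<in> FF c (upd2 el x y m) x b \<longleftrightarrow> j \<in> (if b = m then insert k (FF c el x b) else FF c el x b - {k})"
  proof (cases "j = k")
    case True
    have "j \<in> FF c (upd2 el x y m) x b \<longleftrightarrow> m = b"
    proof
      assume "j \<in> FF c (upd2 el x y m) x b"
      then obtain z where z: "z < n" "c x z = Suc k" "upd2 el x y m x z = b" using True assms(5) by (auto simp: FF_mem)
      then have "z = y" using okc_uniq[OF assms(1,2) z(1) assms(3) z(2) assms(4)] by simp
      then show "m = b" using z by (simp add: upd2_def)
    next
      assume "m = b"
      then show "j \<in> FF c (upd2 el x y m) x b" using True assms by (auto simp: FF_mem upd2_def)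
    qed
    then show ?thesis using True by auto
  next
    case False
    have "upd2 el x y m x z = el x z" if "c x z = Suc j" for z
      using that False assms(4) xy by (auto simp: upd2_def)
    then have "j \<in> FF c (upd2 el x y m) x b \<longleftrightarrow> j \<in> FF c el x b"
      using assms(5) by (auto simp: FF_mem)
    then show ?thesis using False by auto
  qed
qed

lemma upd2_swap: "upd2 c x y v = upd2 c y x v"
  by (auto simp: upd2_def fun_eq_iff)

lemma relevel_wp:
  assumes g: "glob s" and r: "reg s ''x'' = x" "reg s ''y'' = y" "reg s ''k'' = k" "reg s ''l'' = l" "reg s ''m'' = m"
    "x < n" "y < n" "l \<le> L" "m \<le> L"
    and R: "rep (mem s) c el" and ok: "okc c" and c: "c x y = Suc k" and el: "el x y = l" "el y x = l"
    and Q: "\<And>t' s'. t' \<le> t + 200 * K \<Longrightarrow> frame s s' {''i'', ''p''} {''T''} \<Longrightarrow>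
       rep (mem s') c (upd2 el x y m) \<Longrightarrow> Q t' s'"
  shows "wp w relevel Q t s"
proof -
  let ?F = "FF c el"
  define F1 where "F1 = ?F(x := (?F x)(l := ?F x l - {k}))"
  define F2 where "F2 = F1(x := (F1 x)(m := insert k (F1 x m)))"
  define F3 where "F3 = F2(y := (F2 y)(l := F2 y l - {k}))"
  define F4 where "F4 = F3(y := (F3 y)(m := insert k (F3 y m)))"
  have xy: "x \<noteq> y" using okc_irrefl[OF ok r(6)] c by auto
  have cy: "c y x = Suc k" using okc_sym[OF ok r(6,7)] c by simp
  have kM: "k < M" using okc_le[OF ok r(6,7)] c by simp
  have F: "forest (mem s ''T'') ?F" using R by (rule rep_forest)
  have p1: "k \<in> ?F x l" using c r el by (auto simp: FF_def)
  \<comment> \<open>The case \<open>m = l\<close> does occur: when \<open>x\<close> moves up and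
    \<open>y\<close> stays on level \<open>l\<close>, so does the edge. Its color is then removed
    and inserted again.\<close>
  have p2: "k \<notin> F1 x m"
  proof
    assume "k \<in> F1 x m"
    then have "m \<noteq> l" "k \<in> ?F x m" by (auto simp: F1_def split: if_splits)
    then show False using FF_notin[OF ok r(6,7) c, of m el] el r by simp
  qed
  have p3: "k \<in> F2 y l" using xy cy r el by (auto simp: F2_def F1_def FF_def)
  have p4: "k \<notin> F3 y m"
  proof
    assume "k \<in> F3 y m"
    then have "m \<noteq> l" "k \<in> ?F y m" using xy by (auto simp: F3_def F2_def F1_def split: if_splits)
    then show False using FF_notin[OF ok r(7,6) cy, of m el] el r by simp
  qed
  have fin: "F4 a b = FF c (upd2 el x y m) a b" if "a < n" "b \<le> L + 1" for a b
  proof (cases "b = L + 1")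
    case True
    then show ?thesis using r by (simp add: F4_def F3_def F2_def F1_def FF_def)
  next
    case False
    consider "a = x" | "a = y" | "a \<noteq> x" "a \<noteq> y" by blast
    then show ?thesis
    proof cases
      case 1
      have "F4 x b = (if b = m then insert k (if b = l then ?F x b - {k} else ?F x b) else if b = l then ?F x b - {k} else ?F x b)"
        using xy by (simp add: F4_def F3_def F2_def F1_def)
      also have "\<dots> = FF c (upd2 el x y m) x b"
        using FF_notin[OF ok r(6,7) c False, of el] el unfolding FF_upd2[OF ok r(6,7) c False] by auto
      finally show ?thesis using 1 by simp
    next
      case 2
      have "F4 y b = (if b = m then insert k (if b = l then ?F y b - {k} else ?F y b) else if b = l then ?F y b - {k} else ?F y b)"
        using xy by (simp add: F4_def F3_def F2_def F1_def)
      also have "\<dots> = FF c (upd2 el x y m) y b"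
        using FF_notin[OF ok r(7,6) cy False, of el] el
        unfolding upd2_swap[of el x] FF_upd2[OF ok r(7,6) cy False] by auto
      finally show ?thesis using 2 by simp
    next
      case 3
      then show ?thesis using False by (simp add: F4_def F3_def F2_def F1_def FF_def upd2_def)
    qed
  qed
  show ?thesis
    unfolding relevel_def wp_Seq
  proof (rule upd_dec_wp[where x = x and l = l and F = ?F and k = k], goal_cases)
    case (10 t1 s1)
    note A = 10
    have g1: "glob s1" by (rule glob_frame[OF A(2) g]) auto
    have r1: "reg s1 z = reg s z" if "z \<notin> {''i'', ''p''}" for z using A(2) that by (simp add: frame_def)
    show ?case
    proof (rule upd_inc_wp[where x = x and l = m and F = F1 and k = k], goal_cases)
      case (10 t2 s2)
      note A2 = 10
      have g2: "glob s2" by (rule glob_frame[OF A2(2) g1]) auto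
      have r2: "reg s2 z = reg s z" if "z \<notin> {''i'', ''p''}" for z using A2(2) that r1 by (simp add: frame_def)
      show ?case
      proof (rule upd_dec_wp[where x = y and l = l and F = F2 and k = k], goal_cases)
        case (10 t3 s3)
        note A3 = 10
        have g3: "glob s3" by (rule glob_frame[OF A3(2) g2]) auto
        have r3: "reg s3 z = reg s z" if "z \<notin> {''i'', ''p''}" for z using A3(2) that r2 by (simp add: frame_def)
        show ?case
        proof (rule upd_inc_wp[where x = y and l = m and F = F3 and k = k], goal_cases)
          case (10 t4 s4)
          have fr: "frame s s4 {''i'', ''p''} {''T''}"
            using A(2) A2(2) A3(2) 10(2) by (auto simp: frame_def)
          have "forest (mem s4 ''T'') (FF c (upd2 el x y m))"
            using 10(3) fin unfolding F4_def[symmetric] by (rule forest_cong)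
          then have "rep (mem s4) c (upd2 el x y m)"
            using R fr by (simp add: rep_def frame_def)
          then show ?case using A(1) A2(1) A3(1) 10(1) K_ge2 fr by (intro Q) (auto simp: frame_def)
        qed (use g3 r kM p4 A3(3) in \<open>auto simp: r3 F3_def\<close>)
      qed (use g2 r kM p3 A2(3) in \<open>auto simp: r2 F2_def\<close>)
    qed (use g1 r kM p2 A(3) in \<open>auto simp: r1 F1_def\<close>)
  qed (use g r kM p1 F in auto)
qed

lemma glob_mem [simp]: "m ''tab'' = mem s ''tab'' \<Longrightarrow> glob (s\<lparr>mem := m\<rparr>) = glob s"
  by (simp add: glob_def)

lemma glob_reg [simp]: "\<forall>r\<in>{''n'', ''M'', ''B'', ''L'', ''R'', ''J'', ''1''}. \<rho> r = reg s r \<Longrightarrow> glob (s\<lparr>reg := \<rho>\<rparr>) = glob s"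
  by (simp add: glob_def)

lemma okc_set:
  assumes ok: "okc c" and r: "x < n" "y < n" "x \<noteq> y" "k < M" and k: "k \<notin> cols c x" "k \<notin> cols c y"
  shows "okc (upd2 c x y (Suc k))"
proof -
  have nx: "c x z \<noteq> Suc k" "c y z \<noteq> Suc k" if "z < n" for z using k that by (auto simp: cols_def)
  show ?thesis unfolding okc_def
  proof (intro conjI allI impI)
    fix a b assume "a < n" "b < n"
    then show "upd2 c x y (Suc k) a b = upd2 c x y (Suc k) b a" "upd2 c x y (Suc k) a b \<le> M"
      using okc_sym[OF ok] okc_le[OF ok] r by (auto simp: upd2_def)
  next
    fix a assume "a < n"
    then show "upd2 c x y (Suc k) a a = 0" using okc_irrefl[OF ok] r by (auto simp: upd2_def)
  next
    fix a b d assume "a < n" "b < n" "d < n" "upd2 c x y (Suc k) a b = upd2 c x y (Suc k) a d" "upd2 c x y (Suc k) a b \<noteq> 0"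
    moreover from this have "c a b = c a d \<Longrightarrow> c a b \<noteq> 0 \<Longrightarrow> b = d" using ok unfolding okc_def by blast
    ultimately show "b = d" using nx[of b] nx[of d] r by (auto simp: upd2_def split: if_splits)
  qed
qed

lemma okc_unset:
  assumes ok: "okc c" and r: "x < n" "y < n"
  shows "okc (upd2 c x y 0)"
  unfolding okc_def
proof (intro conjI allI impI)
  fix a b assume "a < n" "b < n"
  then show "upd2 c x y 0 a b = upd2 c x y 0 b a" "upd2 c x y 0 a b \<le> M"
    using okc_sym[OF ok] okc_le[OF ok] r by (auto simp: upd2_def)
next
  fix a assume "a < n"
  then show "upd2 c x y 0 a a = 0" using okc_irrefl[OF ok] r by (auto simp: upd2_def)
next
  fix a b d assume "a < n" "b < n" "d < n" "upd2 c x y 0 a b = upd2 c x y 0 a d" "upd2 c x y 0 a b \<noteq> 0"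
  moreover from this have "c a b = c a d \<Longrightarrow> c a b \<noteq> 0 \<Longrightarrow> b = d" using ok unfolding okc_def by blast
  ultimately show "b = d" by (auto simp: upd2_def split: if_splits)
qed

lemma FF_set:
  assumes r: "x < n" "y < n" "x \<noteq> y" and c0: "c x y = 0"
  shows "FF (upd2 c x y (Suc k)) el x b = (if b = L + 1 \<or> b = el x y then insert k (FF c el x b) else FF c el x b)"
proof (rule set_eqI)
  fix j
  have "upd2 c x y (Suc k) x z = Suc j \<longleftrightarrow> (z = y \<and> j = k) \<or> c x z = Suc j" for z
    using r c0 by (auto simp: upd2_def)
  then show "j \<in> FF (upd2 c x y (Suc k)) el x b \<longleftrightarrow> j \<in> (if b = L + 1 \<or> b = el x y then insert k (FF c el x b) else FF c el x b)"
    using r by (auto simp: FF_def cols_def)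
qed

lemma FF_unset:
  assumes ok: "okc c" and r: "x < n" "y < n" "x \<noteq> y" and c0: "c x y = Suc k"
  shows "FF (upd2 c x y 0) el x b = FF c el x b - {k}"
proof (rule set_eqI)
  fix j
  have "upd2 c x y 0 x z = Suc j \<longleftrightarrow> (j \<noteq> k \<and> c x z = Suc j)" if "z < n" for z
  proof (cases "z = y")
    case False
    then have "c x z \<noteq> Suc k" using okc_uniq[OF ok r(1,2) that c0] by blast
    then show ?thesis using False r by (auto simp: upd2_def)
  qed (use r c0 in \<open>auto simp: upd2_def\<close>)
  then show "j \<in> FF (upd2 c x y 0) el x b \<longleftrightarrow> j \<in> FF c el x b - {k}"
    by (auto simp: FF_def cols_def)
qed

lemma FF_other: "a \<noteq> x \<Longrightarrow> a \<noteq> y \<Longrightarrow> FF (upd2 c x y v) el a b = FF c el a b"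
  by (simp add: FF_def cols_def upd2_def)

lemma color_store:
  assumes "\<forall>x<n. \<forall>y<n. f (x * n + y) = c x y" "x < n" "y < n"
  shows "\<forall>a<n. \<forall>b<n. (f(x * n + y := v, y * n + x := v)) (a * n + b) = upd2 c x y v a b"
proof (intro allI impI)
  fix a b assume ab: "a < n" "b < n"
  have e: "f (a * n + b) = c a b" using assms(1) ab by blast
  have e1: "a * n + b = x * n + y \<longleftrightarrow> a = x \<and> b = y" by (rule n_inj[OF ab(2) assms(3)])
  have e2: "a * n + b = y * n + x \<longleftrightarrow> a = y \<and> b = x" by (rule n_inj[OF ab(2) assms(2)])
  have or: "(if Q then v else if P then v else u) = (if P \<or> Q then v else u)" for P Q u by simp
  show "(f(x * n + y := v, y * n + x := v)) (a * n + b) = upd2 c x y v a b"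
    unfolding upd2_def fun_upd_apply e1 e2 e by (rule or)
qed

lemma set_color_wp:
  assumes g: "glob s" and r: "reg s ''x'' = x" "reg s ''y'' = y" "reg s ''k'' = k" "reg s ''l'' = l"
    "x < n" "y < n" "l \<le> L" "k < M" "x \<noteq> y"
    and R: "rep (mem s) c el" and ok: "okc c" and c: "c x y = 0" and el: "el x y = l" "el y x = l"
    and k: "k \<notin> cols c x" "k \<notin> cols c y"
    and Q: "\<And>t' s'. t' \<le> t + 220 * K \<Longrightarrow> frame s s' {''i'', ''p''} {''T'', ''color'', ''at''} \<Longrightarrow>
       rep (mem s') (upd2 c x y (Suc k)) el \<Longrightarrow> okc (upd2 c x y (Suc k)) \<Longrightarrow> Q t' s'"
  shows "wp w set_color Q t s"
proof -
  let ?F = "FF c el"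
  let ?c = "upd2 c x y (Suc k)"
  define F1 where "F1 = ?F(x := (?F x)(l := insert k (?F x l)))"
  define F2 where "F2 = F1(x := (F1 x)(L + 1 := insert k (F1 x (L + 1))))"
  define F3 where "F3 = F2(y := (F2 y)(l := insert k (F2 y l)))"
  define F4 where "F4 = F3(y := (F3 y)(L + 1 := insert k (F3 y (L + 1))))"
  have cy: "c y x = 0" using okc_sym[OF ok r(5,6)] c by simp
  have F: "forest (mem s ''T'') ?F" using R by (rule rep_forest)
  have nin: "k \<notin> ?F x b" "k \<notin> ?F y b" for b using k by (auto simp: FF_def cols_def)
  have p: "k \<notin> ?F x l" "k \<notin> F1 x (L + 1)" "k \<notin> F2 y l" "k \<notin> F3 y (L + 1)"
    using nin r(7,9) by (auto simp: F1_def F2_def F3_def)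
  have fin: "F4 a b = FF ?c el a b" if "a < n" "b \<le> L + 1" for a b
  proof -
    consider "a = x" | "a = y" | "a \<noteq> x" "a \<noteq> y" by blast
    then show ?thesis
    proof cases
      case 1
      then show ?thesis using r(9) el FF_set[where c = c and k = k and el = el and b = b, OF r(5,6,9) c] by (auto simp: F4_def F3_def F2_def F1_def)
    next
      case 2
      then show ?thesis using r(9) el FF_set[where c = c and k = k and el = el and b = b, OF r(6,5) not_sym[OF r(9)] cy] unfolding upd2_swap[of c x]
        by (auto simp: F4_def F3_def F2_def F1_def)
    next
      case 3
      then show ?thesis by (simp add: F4_def F3_def F2_def F1_def FF_other)
    qed
  qed
  let ?col = "(mem s ''color'')(x * n + y := Suc k, y * n + x := Suc k)"
  let ?at = "(mem s ''at'')(x * B + k := Suc y, y * B + k := Suc x)"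
  define s0 where "s0 = s\<lparr>mem := (mem s)(''color'' := ?col, ''at'' := ?at)\<rparr>"
  have kB: "k < B" using r(8) B_bounds by linarith
  have W: "Suc k < WW" "Suc x < WW" "Suc y < WW" using r L_WW by linarith+
  have st: "wp w (Store ''color'' (caddr (Reg ''x'') (Reg ''y'')) (Reg ''k'' +. Const 1) ;;
     Store ''color'' (caddr (Reg ''y'') (Reg ''x'')) (Reg ''k'' +. Const 1) ;;
     Store ''at'' (baddr (Reg ''x'') (Reg ''k'')) (Reg ''y'' +. Const 1) ;;
     Store ''at'' (baddr (Reg ''y'') (Reg ''k'')) (Reg ''x'' +. Const 1) ;; d) Q t s \<longleftrightarrow> wp w d Q (t + 36) s0" for d
    using r W kB g by (simp add: s0_def add.commute[of t] fun_upd_twist)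
  have g0: "glob s0" using g by (simp add: s0_def)
  have r0: "reg s0 = reg s" "mem s0 ''T'' = mem s ''T''" by (simp_all add: s0_def)
  have col: "\<forall>a<n. \<forall>b<n. ?col (a * n + b) = ?c a b"
    using R r by (intro color_store) (auto simp: rep_def)
  have at: "\<forall>a<n. \<forall>j<M. ?at (a * B + j) \<le> n \<and> (\<forall>b<n. ?at (a * B + j) = Suc b \<longleftrightarrow> ?c a b = Suc j)"
  proof (intro allI impI)
    fix a j assume a: "a < n" "j < M"
    have jB: "j < B" using a B_bounds by linarith
    have e: "?at (a * B + j) = (if a = y \<and> j = k then Suc x else if a = x \<and> j = k then Suc y else mem s ''at'' (a * B + j))"
      by (simp only: fun_upd_apply B_inj[OF jB kB])
    have old: "mem s ''at'' (a * B + j) \<le> n" "\<And>b. b < n \<Longrightarrow> mem s ''at'' (a * B + j) = Suc b \<longleftrightarrow> c a b = Suc j"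
      using R a by (auto simp: rep_def)
    have nc: "c x b \<noteq> Suc k" "c y b \<noteq> Suc k" if "b < n" for b using k that by (auto simp: cols_def)
    show "?at (a * B + j) \<le> n \<and> (\<forall>b<n. ?at (a * B + j) = Suc b \<longleftrightarrow> ?c a b = Suc j)"
      unfolding e using old nc r c cy by (auto simp: upd2_def)
  qed
  show ?thesis
    unfolding set_color_def unfolding st unfolding wp_Seq
  proof (rule upd_inc_wp[where x = x and l = l and F = ?F and k = k], goal_cases)
    case (10 t1 s1)
    note A = 10
    have g1: "glob s1" by (rule glob_frame[OF A(2) g0]) auto
    have r1: "reg s1 z = reg s z" if "z \<notin> {''i'', ''p''}" for z using A(2) that by (simp add: frame_def r0)
    show ?case
    proof (rule upd_inc_wp[where x = x and l = "L + 1" and F = F1 and k = k], goal_cases)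
      case (10 t2 s2)
      note A2 = 10
      have g2: "glob s2" by (rule glob_frame[OF A2(2) g1]) auto
      have r2: "reg s2 z = reg s z" if "z \<notin> {''i'', ''p''}" for z using A2(2) that r1 by (simp add: frame_def)
      show ?case
      proof (rule upd_inc_wp[where x = y and l = l and F = F2 and k = k], goal_cases)
        case (10 t3 s3)
        note A3 = 10
        have g3: "glob s3" by (rule glob_frame[OF A3(2) g2]) auto
        have r3: "reg s3 z = reg s z" if "z \<notin> {''i'', ''p''}" for z using A3(2) that r2 by (simp add: frame_def)
        show ?case
        proof (rule upd_inc_wp[where x = y and l = "L + 1" and F = F3 and k = k], goal_cases)
          case (10 t4 s4)
          have fr: "frame s0 s4 {''i'', ''p''} {''T''}"
            using A(2) A2(2) A3(2) 10(2) by (auto simp: frame_def)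
          have "forest (mem s4 ''T'') (FF ?c el)"
            using 10(3) fin unfolding F4_def[symmetric] by (rule forest_cong)
          then have "rep (mem s4) ?c el"
            using col at fr unfolding rep_def by (simp add: frame_def s0_def)
          moreover have "frame s s4 {''i'', ''p''} {''T'', ''color'', ''at''}"
            using fr by (auto simp: frame_def s0_def)
          ultimately show ?case
            using A(1) A2(1) A3(1) 10(1) K_ge2 okc_set[OF ok r(5,6,9,8) k] by (intro Q) auto
        qed (use g3 r p A3(3) in \<open>auto simp: r3 F3_def\<close>)
      qed (use g2 r p A2(3) in \<open>auto simp: r2 F2_def\<close>)
    qed (use g1 r p A(3) in \<open>auto simp: r1 F1_def\<close>)
  qed (use g0 r p F r0 in auto)
qed

lemma unset_color_wp:
  assumes g: "glob s" and r: "reg s ''x'' = x" "reg s ''y'' = y" "reg s ''k'' = k" "reg s ''l'' = l"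
    "x < n" "y < n" "l \<le> L"
    and R: "rep (mem s) c el" and ok: "okc c" and c: "c x y = Suc k" and el: "el x y = l" "el y x = l"
    and Q: "\<And>t' s'. t' \<le> t + 220 * K \<Longrightarrow> frame s s' {''i'', ''p''} {''T'', ''color'', ''at''} \<Longrightarrow>
       rep (mem s') (upd2 c x y 0) el \<Longrightarrow> okc (upd2 c x y 0) \<Longrightarrow> Q t' s'"
  shows "wp w unset_color Q t s"
proof -
  let ?F = "FF c el"
  let ?c = "upd2 c x y 0"
  define F1 where "F1 = ?F(x := (?F x)(l := ?F x l - {k}))"
  define F2 where "F2 = F1(x := (F1 x)(L + 1 := F1 x (L + 1) - {k}))"
  define F3 where "F3 = F2(y := (F2 y)(l := F2 y l - {k}))"
  define F4 where "F4 = F3(y := (F3 y)(L + 1 := F3 y (L + 1) - {k}))"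
  have cy: "c y x = Suc k" using okc_sym[OF ok r(5,6)] c by simp
  have xy: "x \<noteq> y" using okc_irrefl[OF ok r(5)] c by auto
  have kM: "k < M" using okc_le[OF ok r(5,6)] c by simp
  have F: "forest (mem s ''T'') ?F" using R by (rule rep_forest)
  have pin: "k \<in> ?F x l" "k \<in> ?F x (L + 1)" "k \<in> ?F y l" "k \<in> ?F y (L + 1)"
    using c cy el r by (auto simp: FF_def cols_def)
  have p: "k \<in> ?F x l" "k \<in> F1 x (L + 1)" "k \<in> F2 y l" "k \<in> F3 y (L + 1)"
    using pin r(7) xy by (auto simp: F1_def F2_def F3_def)
  have fin: "F4 a b = FF ?c el a b" if "a < n" "b \<le> L + 1" for a b
  proof -
    consider "a = x" | "a = y" | "a \<noteq> x" "a \<noteq> y" by blast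
    then show ?thesis
    proof cases
      case 1
      then show ?thesis using xy el FF_unset[OF ok r(5,6) xy c, of el b] FF_notin[OF ok r(5,6) c, of b el]
        by (auto simp: F4_def F3_def F2_def F1_def)
    next
      case 2
      then show ?thesis using xy el FF_unset[OF ok r(6,5) not_sym[OF xy] cy, of el b] FF_notin[OF ok r(6,5) cy, of b el]
        unfolding upd2_swap[of c x] by (auto simp: F4_def F3_def F2_def F1_def)
    next
      case 3
      then show ?thesis by (simp add: F4_def F3_def F2_def F1_def FF_other)
    qed
  qed
  let ?col = "(mem s ''color'')(x * n + y := 0, y * n + x := 0)"
  let ?at = "(mem s ''at'')(x * B + k := 0, y * B + k := 0)"
  define s0 where "s0 = s\<lparr>mem := (mem s)(''color'' := ?col, ''at'' := ?at)\<rparr>"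
  have kB: "k < B" using kM B_bounds by linarith
  have st: "wp w (Store ''color'' (caddr (Reg ''x'') (Reg ''y'')) (Const 0) ;;
     Store ''color'' (caddr (Reg ''y'') (Reg ''x'')) (Const 0) ;;
     Store ''at'' (baddr (Reg ''x'') (Reg ''k'')) (Const 0) ;;
     Store ''at'' (baddr (Reg ''y'') (Reg ''k'')) (Const 0) ;; d) Q t s \<longleftrightarrow> wp w d Q (t + 28) s0" for d
    using r kB g by (simp add: s0_def add.commute[of t] fun_upd_twist)
  have g0: "glob s0" using g by (simp add: s0_def)
  have r0: "reg s0 = reg s" "mem s0 ''T'' = mem s ''T''" by (simp_all add: s0_def)
  have col: "\<forall>a<n. \<forall>b<n. ?col (a * n + b) = ?c a b"
    using R r by (intro color_store) (auto simp: rep_def)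
  have at: "\<forall>a<n. \<forall>j<M. ?at (a * B + j) \<le> n \<and> (\<forall>b<n. ?at (a * B + j) = Suc b \<longleftrightarrow> ?c a b = Suc j)"
  proof (intro allI impI)
    fix a j assume a: "a < n" "j < M"
    have jB: "j < B" using a B_bounds by linarith
    have e: "?at (a * B + j) = (if (a = x \<or> a = y) \<and> j = k then 0 else mem s ''at'' (a * B + j))"
      by (simp only: fun_upd_apply B_inj[OF jB kB]) (simp split: if_splits)
    have old: "mem s ''at'' (a * B + j) \<le> n" "\<And>b. b < n \<Longrightarrow> mem s ''at'' (a * B + j) = Suc b \<longleftrightarrow> c a b = Suc j"
      using R a by (auto simp: rep_def)
    have nc: "c x b \<noteq> Suc k" if "b < n" "b \<noteq> y" for b using okc_uniq[OF ok r(5) that(1) r(6) _ c] that by blast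
    have nc': "c y b \<noteq> Suc k" if "b < n" "b \<noteq> x" for b using okc_uniq[OF ok r(6) that(1) r(5) _ cy] that by blast
    show "?at (a * B + j) \<le> n \<and> (\<forall>b<n. ?at (a * B + j) = Suc b \<longleftrightarrow> ?c a b = Suc j)"
    proof (cases "(a = x \<or> a = y) \<and> j = k")
      case True
      then show ?thesis unfolding e using nc nc' by (auto simp: upd2_def)
    next
      case False
      then have "?c a b = Suc j \<longleftrightarrow> c a b = Suc j" if "b < n" for b using c cy by (auto simp: upd2_def)
      then show ?thesis unfolding e using False old by auto
    qed
  qed
  show ?thesis
    unfolding unset_color_def unfolding st unfolding wp_Seq
  proof (rule upd_dec_wp[where x = x and l = l and F = ?F and k = k], goal_cases)
    case (10 t1 s1)
    note A = 10
    have g1: "glob s1" by (rule glob_frame[OF A(2) g0]) auto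
    have r1: "reg s1 z = reg s z" if "z \<notin> {''i'', ''p''}" for z using A(2) that by (simp add: frame_def r0)
    show ?case
    proof (rule upd_dec_wp[where x = x and l = "L + 1" and F = F1 and k = k], goal_cases)
      case (10 t2 s2)
      note A2 = 10
      have g2: "glob s2" by (rule glob_frame[OF A2(2) g1]) auto
      have r2: "reg s2 z = reg s z" if "z \<notin> {''i'', ''p''}" for z using A2(2) that r1 by (simp add: frame_def)
      show ?case
      proof (rule upd_dec_wp[where x = y and l = l and F = F2 and k = k], goal_cases)
        case (10 t3 s3)
        note A3 = 10
        have g3: "glob s3" by (rule glob_frame[OF A3(2) g2]) auto
        have r3: "reg s3 z = reg s z" if "z \<notin> {''i'', ''p''}" for z using A3(2) that r2 by (simp add: frame_def)
        show ?case
        proof (rule upd_dec_wp[where x = y and l = "L + 1" and F = F3 and k = k], goal_cases)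
          case (10 t4 s4)
          have fr: "frame s0 s4 {''i'', ''p''} {''T''}"
            using A(2) A2(2) A3(2) 10(2) by (auto simp: frame_def)
          have "forest (mem s4 ''T'') (FF ?c el)"
            using 10(3) fin unfolding F4_def[symmetric] by (rule forest_cong)
          then have "rep (mem s4) ?c el"
            using col at fr unfolding rep_def by (simp add: frame_def s0_def)
          moreover have "frame s s4 {''i'', ''p''} {''T'', ''color'', ''at''}"
            using fr by (auto simp: frame_def s0_def)
          ultimately show ?case
            using A(1) A2(1) A3(1) 10(1) K_ge2 okc_unset[OF ok r(5,6)] by (intro Q) auto
        qed (use g3 r p kM A3(3) in \<open>auto simp: r3 F3_def\<close>)
      qed (use g2 r p kM A2(3) in \<open>auto simp: r2 F2_def\<close>)
    qed (use g1 r p kM A(3) in \<open>auto simp: r1 F1_def\<close>)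
  qed (use g0 r p kM F r0 in auto)
qed

end

section \<open>Levels, potential and arboricity\<close>

definition adj :: "edge set \<Rightarrow> nat \<Rightarrow> nat set" where
  "adj E v = {y. {v, y} \<in> E}"

definition dg :: "edge set \<Rightarrow> (nat \<Rightarrow> nat) \<Rightarrow> nat \<Rightarrow> nat \<Rightarrow> nat" where
  "dg E lv j v = card {y \<in> adj E v. j \<le> lv y}"

context ctx begin

section \<open>Neighborhoods and degrees\<close>

definition wfE :: "edge set \<Rightarrow> bool" where
  "wfE E \<longleftrightarrow> (\<forall>e\<in>E. \<exists>x y. e = {x, y} \<and> x \<noteq> y \<and> x < n \<and> y < n)"

lemma adj_sym: "y \<in> adj E x \<longleftrightarrow> x \<in> adj E y"
  by (simp add: adj_def insert_commute)

lemma adj_lt: "wfE E \<Longrightarrow> y \<in> adj E x \<Longrightarrow> x < n \<and> y < n \<and> x \<noteq> y"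
  unfolding wfE_def adj_def by (force simp: doubleton_eq_iff)

lemma adj_finite: "wfE E \<Longrightarrow> finite (adj E x)"
  by (rule finite_subset[of _ "{..<n}"]) (auto dest: adj_lt)

lemma adj_card: "wfE E \<Longrightarrow> card (adj E x) < n"
proof -
  assume a: "wfE E"
  show ?thesis
  proof (cases "x < n")
    case True
    have "adj E x \<subseteq> {..<n} - {x}" using adj_lt[OF a] by auto
    then have "card (adj E x) \<le> card ({..<n} - {x})" by (intro card_mono) auto
    then show ?thesis using True by simp
  next
    case False
    then have "adj E x = {}" using adj_lt[OF a] by auto
    then show ?thesis using n2 by simp
  qed
qed

lemma degree_adj: "wfE E \<Longrightarrow> degree E v = card (adj E v)"
proof -
  assume a: "wfE E"
  have "bij_betw (\<lambda>y. {v, y}) (adj E v) {e \<in> E. v \<in> e}"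
  proof (rule bij_betwI')
    fix x y assume "x \<in> adj E v" "y \<in> adj E v"
    then show "({v, x} = {v, y}) = (x = y)" by (auto simp: doubleton_eq_iff)
  next
    fix e assume "e \<in> {e \<in> E. v \<in> e}"
    then obtain x y where e: "e \<in> E" "v \<in> e" "e = {x, y}" using a by (auto simp: wfE_def)
    then have "e = {v, if v = x then y else x}" by auto
    then show "\<exists>y\<in>adj E v. e = {v, y}" using e(1) unfolding adj_def by blast
  qed (auto simp: adj_def)
  then show ?thesis unfolding degree_def by (simp add: bij_betw_same_card)
qed

lemma dg_fin: "wfE E \<Longrightarrow> finite {y \<in> adj E v. P y}"
  using adj_finite by simp

lemma dg_antimono: "wfE E \<Longrightarrow> i \<le> j \<Longrightarrow> dg E lv j v \<le> dg E lv i v"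
  unfolding dg_def by (intro card_mono dg_fin) auto

lemma dg_lt: "wfE E \<Longrightarrow> dg E lv j v < n"
proof -
  assume a: "wfE E"
  have "dg E lv j v \<le> card (adj E v)" unfolding dg_def by (intro card_mono adj_finite a) auto
  then show ?thesis using adj_card[OF a, of v] by simp
qed

text \<open>With \<open>a\<close> the parameter of the group, the excess \<open>a div N\<close> of
  the lower threshold over \<open>2 * a\<close> makes the node sets shrink from level to level, and
  the excess \<open>2 * (a div N) + 1\<close> of the upper threshold over twice the lower one pays
  for moves down.\<close>

definition "Ul l = 4 * Av (l div R) + 1 + 4 * (Av (l div R) div N)"
definition "Dl l = 2 * Av (l div R) + Av (l div R) div N"

section \<open>Growth of the group parameters\<close>

lemma Av_0: "Av 0 = 1" by (simp add: Av_def)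
lemma Av_Suc: "Av (Suc j) = (if Av j < M then Av j + 1 + Av j div N else Av j)"
  by (simp add: Av_def)

lemma Av_mono: "i \<le> j \<Longrightarrow> Av i \<le> Av j"
  by (rule lift_Suc_mono_le[of Av]) (simp_all add: Av_Suc)

lemma Av_ge1: "1 \<le> Av j" using Av_mono[of 0 j] by (simp add: Av_0)

lemma Av_le: "Av j \<le> 2 * M"
proof (induction j)
  case 0 then show ?case using B_bounds by (simp add: Av_0)
next
  case (Suc j)
  show ?case
  proof (cases "Av j < M")
    case True
    have "Av j div N \<le> Av j" by (rule div_le_dividend)
    with True have "Av j + 1 + Av j div N \<le> 2 * M" by linarith
    with True show ?thesis by (simp add: Av_Suc)
  qed (use Suc in \<open>simp add: Av_Suc\<close>)
qed

text \<open>Bernoulli gives \<open>2 \<le> (1 + 1 / m) ^ m\<close>. It is used with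
  \<open>m = N\<close> for the growth of the parameters and with \<open>m = 2 * N\<close> for the
  shrinking of the node sets.\<close>

lemma bern2: "m \<ge> 1 \<Longrightarrow> (2::real) ^ k \<le> (1 + 1 / real m) ^ (m * k)"
proof -
  assume m: "m \<ge> 1"
  have "1 + real m * (1 / real m) \<le> (1 + 1 / real m) ^ m"
    by (rule Bernoulli_inequality) (simp add: order_trans[of _ 0])
  then have "2 \<le> (1 + 1 / real m) ^ m" using m by simp
  then have "(2::real) ^ k \<le> ((1 + 1 / real m) ^ m) ^ k" by (rule power_mono) simp
  then show ?thesis by (simp add: power_mult)
qed

lemma div_bound: "m \<ge> 1 \<Longrightarrow> a < m * (a div m + 1)" for a m :: nat
proof -
  assume "m \<ge> 1"
  then have "a mod m < m" by simp
  moreover have "m * (a div m) + a mod m = a" by simp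
  moreover have "m * (a div m + 1) = m * (a div m) + m" by simp
  ultimately show ?thesis by linarith
qed

text \<open>Until \<open>M\<close> is reached every step multiplies by at least
  \<open>1 + 1 / N\<close>, since \<open>a div N + 1\<close> exceeds \<open>a / N\<close>.\<close>

lemma Av_J: "M \<le> Av J"
proof -
  have "M \<le> Av j \<or> (1 + 1 / real N) ^ j \<le> real (Av j)" for j
  proof (induction j)
    case 0 then show ?case by (simp add: Av_0)
  next
    case (Suc j)
    show ?case
    proof (cases "M \<le> Av j")
      case True
      then show ?thesis using Av_mono[of j "Suc j"] by simp
    next
      case False
      have "real (Av j) \<le> real (N * (Av j div N + 1))" using div_bound[OF N1, of "Av j"] by linarith
      then have "real (Av j) / real N \<le> real (Av j div N) + 1" using N1 by (simp add: field_simps)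
      then have "(1 + 1 / real N) * real (Av j) \<le> real (Av (Suc j))" using False by (simp add: Av_Suc algebra_simps)
      moreover have "(1 + 1 / real N) * (1 + 1 / real N) ^ j \<le> (1 + 1 / real N) * real (Av j)"
        using Suc False by (intro mult_left_mono) auto
      ultimately show ?thesis by simp
    qed
  qed
  from this[of J] show ?thesis
  proof
    assume "(1 + 1 / real N) ^ J \<le> real (Av J)"
    then have "(2::real) ^ K \<le> real (Av J)" using bern2[OF N1, of K] unfolding J_def by linarith
    then have "real M \<le> real (Av J)" by (simp add: M_def)
    then show ?thesis by simp
  qed
qed

lemma RJ_pos: "1 \<le> R" "1 \<le> J" using N1 K_ge2 by (simp_all add: R_def J_def)

lemma lev_div: "l \<le> L \<Longrightarrow> l div R \<le> J"
  unfolding L_def using RJ_pos by (metis div_le_mono div_mult_self_is_m less_le_trans zero_less_one mult.commute)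

lemma Dl_mono: "i \<le> j \<Longrightarrow> Dl i \<le> Dl j"
  unfolding Dl_def using Av_mono[OF div_le_mono[of i j R]] by (meson add_le_mono div_le_mono le_refl mult_le_mono)

text \<open>No node can have more than \<open>Ul L\<close> neighbors, so a node on the top level
  never has to move up.\<close>

lemma Ul_L: "n < Ul L"
proof -
  have "L div R = J" using RJ_pos by (simp add: L_def)
  then show ?thesis using Av_J B_bounds n2 by (simp add: Ul_def)
qed

lemma Ul_le: "Ul l \<le> 16 * M + 1"
proof -
  have "Av (l div R) div N \<le> Av (l div R)" by simp
  then show ?thesis using Av_le[of "l div R"] unfolding Ul_def by linarith
qed

text \<open>The summand 2 for equal levels makes every edge from \<open>v\<close> on level
  \<open>i\<close> to a node on level \<open>i\<close> or above cheaper by at least 2 when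
  \<open>v\<close> moves up: to a node on level \<open>i\<close> the minimum stays but equality is
  lost, to one on level \<open>i + 1\<close> the gain of 4 is diminished by the new equality, and
  above that it is 4.\<close>

definition pe :: "nat \<Rightarrow> nat \<Rightarrow> nat" where
  "pe a b = 4 * (L - min a b) + (if a = b then 2 else 0)"

text \<open>The weight \<open>16 * N\<close> has this origin. When a node with \<open>k\<close>
  neighbors on level \<open>i\<close> or above moves down to level \<open>i\<close>, each of them
  may miss one more neighbor, while the own deficit at \<open>i\<close> that disappears exceeds
  \<open>k\<close> only by at least \<open>2 * (a + 1) / N\<close>. Weighting by a multiple of
  \<open>N\<close> turns this excess into a multiple of \<open>a\<close>, enough for the edge terms
  and the work.\<close>

definition nd :: "edge set \<Rightarrow> (nat \<Rightarrow> nat) \<Rightarrow> nat \<Rightarrow> nat" where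
  "nd E lv v = (\<Sum>y\<in>adj E v. pe (lv v) (lv y)) + 16 * N * (\<Sum>j<lv v. Ul j + 1 - dg E lv j v)"

text \<open>Natural number subtraction cuts off the terms of levels on which no neighbor is missing. Each edge
  is counted at both endpoints.\<close>

definition pot :: "edge set \<Rightarrow> (nat \<Rightarrow> nat) \<Rightarrow> nat" where
  "pot E lv = (\<Sum>v<n. nd E lv v)"

lemma pot_split: "v < n \<Longrightarrow> pot E lv = nd E lv v + (\<Sum>x\<in>{..<n} - {v}. nd E lv x)"
  unfolding pot_def by (simp add: sum.remove)

lemma pe_up: "i < L \<Longrightarrow> pe (Suc i) b + (if i \<le> b then 2 else 0) \<le> pe i b"
  by (auto simp: pe_def min_def)
lemma pe_sym: "pe a b = pe b a" by (auto simp: pe_def min.commute)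
lemma pe_down: "pe i b \<le> pe (Suc i) b + (if i \<le> b then 4 else 0)"
  by (auto simp: pe_def min_def)
lemma pe_le: "pe a b \<le> 4 * L + 2"
  by (auto simp: pe_def)

lemma sum_if_card: "finite A \<Longrightarrow> (\<Sum>y\<in>A. if P y then (c::nat) else 0) = c * card {y \<in> A. P y}"
proof -
  assume a: "finite A"
  have "(\<Sum>y\<in>A. if P y then c else 0) = (\<Sum>y\<in>{y \<in> A. P y}. c)"
    using a by (rule sum.inter_filter[symmetric])
  then show ?thesis by (simp add: mult.commute)
qed

lemma diff_Suc_bound: "d \<le> d' + c \<Longrightarrow> u - d' \<le> u - d + c" for d d' c u :: nat
  by linarith

text \<open>The edge terms at \<open>v\<close> alone drop by \<open>2 * dg E lv i v\<close>, and
  \<open>dg E lv i v\<close> is at least 1. The new deficit of \<open>v\<close> for level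
  \<open>i\<close> is 0, because \<open>v\<close> has more than \<open>Ul i\<close> neighbors there,
  and no term of another node grows.\<close>

lemma pot_up:
  assumes wf: "wfE E" and v: "v < n" "lv v = i" "i < L" and up: "Ul i < dg E lv i v"
  shows "pot E (lv(v := Suc i)) + dg E lv i v + 1 \<le> pot E lv"
proof -
  let ?l = "lv(v := Suc i)"
  have nv: "y \<noteq> v" if "y \<in> adj E v" for y using adj_lt[OF wf that] by simp
  have others: "nd E ?l x \<le> nd E lv x" if "x \<noteq> v" for x
  proof -
    have "pe (lv x) (?l y) \<le> pe (lv x) (lv y)" for y
      using pe_up[OF v(3), of "lv x"] v(2) pe_sym[of "lv x"] by (auto split: if_splits)
    then have "(\<Sum>y\<in>adj E x. pe (lv x) (?l y)) \<le> (\<Sum>y\<in>adj E x. pe (lv x) (lv y))" by (intro sum_mono)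
    moreover have "dg E lv j x \<le> dg E ?l j x" for j
      unfolding dg_def by (intro card_mono dg_fin wf) (use v(2) in auto)
    then have "(\<Sum>j<lv x. Ul j + 1 - dg E ?l j x) \<le> (\<Sum>j<lv x. Ul j + 1 - dg E lv j x)"
      by (intro sum_mono diff_le_mono2)
    ultimately show ?thesis using that unfolding nd_def by (intro add_mono mult_le_mono2) simp_all
  qed
  have own: "nd E ?l v + 2 * dg E lv i v \<le> nd E lv v"
  proof -
    have "(\<Sum>y\<in>adj E v. pe (Suc i) (?l y)) + 2 * dg E lv i v
        = (\<Sum>y\<in>adj E v. pe (Suc i) (lv y) + (if i \<le> lv y then 2 else 0))"
      using nv by (simp add: sum.distrib sum_if_card adj_finite[OF wf] dg_def cong: sum.cong)
    also have "\<dots> \<le> (\<Sum>y\<in>adj E v. pe i (lv y))" by (intro sum_mono pe_up v)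
    finally have 1: "(\<Sum>y\<in>adj E v. pe (Suc i) (?l y)) + 2 * dg E lv i v \<le> (\<Sum>y\<in>adj E v. pe i (lv y))" .
    have d: "dg E ?l j v = dg E lv j v" for j
      unfolding dg_def by (rule arg_cong[of _ _ card]) (use nv in auto)
    have "(\<Sum>j<Suc i. Ul j + 1 - dg E ?l j v) = (\<Sum>j<i. Ul j + 1 - dg E lv j v)"
      using up by (simp add: d)
    then show ?thesis using 1 v(2) by (simp add: nd_def)
  qed
  have "(\<Sum>x\<in>{..<n} - {v}. nd E ?l x) \<le> (\<Sum>x\<in>{..<n} - {v}. nd E lv x)"
    by (intro sum_mono others) auto
  then show ?thesis using own up unfolding pot_split[OF v(1)] by linarith
qed

text \<open>Moving a node with \<open>k\<close> neighbors down frees the right-hand side. It pays for the larger edge terms, for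
  the neighbor that each of the \<open>k\<close> neighbors loses, and for the work.\<close>

lemma threshold_gap:
  assumes "k \<le> Dl i"
  shows "16 * N * k + 9 * k + 1 \<le> 16 * N * (Ul i + 1 - k)"
proof -
  define a where "a = Av (i div R)"
  define d where "d = a div N"
  have k: "k \<le> 2 * a + d" using assms by (simp add: Dl_def a_def d_def)
  have "d \<le> a" by (simp add: d_def)
  have Nd: "a + 1 \<le> N * (d + 1)" using div_bound[OF N1, of a] by (simp add: d_def)
  \<comment> \<open>The two units per \<open>d + 1\<close> become
    \<open>32 * N * (d + 1) \<ge> 32 * (a + 1)\<close>, and
    \<open>9 * k + 1 \<le> 27 * a + 1\<close> because of \<open>d \<le> a\<close>. In
    \<open>pot_down\<close> the 9 consists of 4 for the edge terms of \<open>v\<close>, 4 for those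
    of its neighbors and 1 for the work.\<close>
  have "k + 2 * (d + 1) \<le> Ul i + 1 - k" using k by (simp add: Ul_def a_def[symmetric] d_def[symmetric])
  then have "16 * N * (k + 2 * (d + 1)) \<le> 16 * N * (Ul i + 1 - k)" by (intro mult_le_mono2)
  moreover have "16 * N * (k + 2 * (d + 1)) = 16 * N * k + 32 * (N * (d + 1))" by (simp add: algebra_simps)
  ultimately show ?thesis using Nd k \<open>d \<le> a\<close> by linarith
qed

lemma pot_down:
  assumes wf: "wfE E" and v: "v < n" "lv v = Suc i" and down: "dg E lv i v \<le> Dl i"
  shows "pot E (lv(v := i)) + dg E lv i v + 1 \<le> pot E lv"
proof -
  let ?l = "lv(v := i)"
  let ?k = "dg E lv i v"
  have nv: "y \<noteq> v" if "y \<in> adj E v" for y using adj_lt[OF wf that] by simp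
  have others: "nd E ?l x \<le> nd E lv x + (if x \<in> adj E v \<and> i \<le> lv x then 4 + 16 * N else 0)" if "x \<noteq> v" for x
  proof -
    have 1: "(\<Sum>y\<in>adj E x. pe (lv x) (?l y)) \<le> (\<Sum>y\<in>adj E x. pe (lv x) (lv y)) + (if x \<in> adj E v \<and> i \<le> lv x then 4 else 0)"
    proof -
      have "pe (lv x) (?l y) \<le> pe (lv x) (lv y) + (if y = v \<and> i \<le> lv x then 4 else 0)" for y
        using pe_down[of i "lv x"] v(2) pe_sym[of "lv x"] by (auto split: if_splits)
      then have "(\<Sum>y\<in>adj E x. pe (lv x) (?l y)) \<le> (\<Sum>y\<in>adj E x. pe (lv x) (lv y) + (if y = v \<and> i \<le> lv x then 4 else 0))"
        by (intro sum_mono)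
      also have "\<dots> = (\<Sum>y\<in>adj E x. pe (lv x) (lv y)) + 4 * card {y \<in> adj E x. y = v \<and> i \<le> lv x}"
        by (simp add: sum.distrib sum_if_card adj_finite[OF wf])
      also have "{y \<in> adj E x. y = v \<and> i \<le> lv x} = (if x \<in> adj E v \<and> i \<le> lv x then {v} else {})"
        using adj_sym by auto
      finally show ?thesis by (simp split: if_splits)
    qed
    \<comment> \<open>Seen from \<open>x\<close>, the node \<open>v\<close> disappears only from the
      nodes on level \<open>Suc i\<close> or above, so at most one summand grows, and only by
      1.\<close>
    have 2: "(\<Sum>j<lv x. Ul j + 1 - dg E ?l j x) \<le> (\<Sum>j<lv x. Ul j + 1 - dg E lv j x) + (if x \<in> adj E v \<and> i \<le> lv x then 1 else 0)"
    proof -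
      have "dg E lv j x \<le> dg E ?l j x + (if j = Suc i \<and> x \<in> adj E v then 1 else 0)" for j
      proof (cases "j = Suc i \<and> x \<in> adj E v")
        case True
        have "{y \<in> adj E x. j \<le> lv y} \<subseteq> insert v {y \<in> adj E x. j \<le> ?l y}" by auto
        then have "dg E lv j x \<le> card (insert v {y \<in> adj E x. j \<le> ?l y})"
          unfolding dg_def by (intro card_mono) (use dg_fin[OF wf] in auto)
        then show ?thesis using True by (simp add: dg_def card_insert_if dg_fin[OF wf] split: if_splits)
      next
        case False
        have "{y \<in> adj E x. j \<le> lv y} \<subseteq> {y \<in> adj E x. j \<le> ?l y}" using False v(2) adj_sym by auto
        then have "dg E lv j x \<le> dg E ?l j x" unfolding dg_def by (intro card_mono dg_fin wf)
        then show ?thesis by simp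
      qed
      then have "Ul j + 1 - dg E ?l j x \<le> Ul j + 1 - dg E lv j x + (if j = Suc i \<and> x \<in> adj E v then 1 else 0)" for j
        by (rule diff_Suc_bound)
      then have "(\<Sum>j<lv x. Ul j + 1 - dg E ?l j x) \<le> (\<Sum>j<lv x. Ul j + 1 - dg E lv j x + (if j = Suc i \<and> x \<in> adj E v then 1 else 0))"
        by (intro sum_mono)
      also have "\<dots> = (\<Sum>j<lv x. Ul j + 1 - dg E lv j x) + card {j \<in> {..<lv x}. j = Suc i \<and> x \<in> adj E v}"
        by (subst sum.distrib) (simp only: sum_if_card[OF finite_lessThan] mult_1)
      also have "{j \<in> {..<lv x}. j = Suc i \<and> x \<in> adj E v} = (if x \<in> adj E v \<and> Suc i < lv x then {Suc i} else {})" by auto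
      finally show ?thesis by (rule order_trans) auto
    qed
    have "16 * N * (\<Sum>j<lv x. Ul j + 1 - dg E ?l j x) \<le> 16 * N * ((\<Sum>j<lv x. Ul j + 1 - dg E lv j x) + (if x \<in> adj E v \<and> i \<le> lv x then 1 else 0))"
      by (rule mult_le_mono2[OF 2])
    note 3 = this
    define b :: nat where "b = (if x \<in> adj E v \<and> i \<le> lv x then 1 else 0)"
    have b: "(if x \<in> adj E v \<and> i \<le> lv x then 1 else 0) = b" "(if x \<in> adj E v \<and> i \<le> lv x then 4 else 0) = 4 * b"
      "(if x \<in> adj E v \<and> i \<le> lv x then 4 + 16 * N else 0) = 4 * b + 16 * N * b" by (simp_all add: b_def)
    have lx: "?l x = lv x" using that by simp
    show ?thesis using 1 3 unfolding nd_def lx b distrib_left by linarith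
  qed
  have own: "nd E ?l v + 16 * N * (Ul i + 1 - ?k) \<le> nd E lv v + 4 * ?k"
  proof -
    have "(\<Sum>y\<in>adj E v. pe i (?l y)) = (\<Sum>y\<in>adj E v. pe i (lv y))"
      using nv by (intro sum.cong) auto
    also have "\<dots> \<le> (\<Sum>y\<in>adj E v. pe (Suc i) (lv y) + (if i \<le> lv y then 4 else 0))"
      by (intro sum_mono pe_down)
    also have "\<dots> = (\<Sum>y\<in>adj E v. pe (Suc i) (lv y)) + 4 * ?k"
      by (simp add: sum.distrib sum_if_card adj_finite[OF wf] dg_def)
    finally have 1: "(\<Sum>y\<in>adj E v. pe i (?l y)) \<le> (\<Sum>y\<in>adj E v. pe (Suc i) (lv y)) + 4 * ?k" .
    have d: "dg E ?l j v = dg E lv j v" for j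
      unfolding dg_def by (rule arg_cong[of _ _ card]) (use nv in auto)
    show ?thesis using 1 v(2) by (simp add: nd_def d distrib_left)
  qed
  have "(\<Sum>x\<in>{..<n} - {v}. nd E ?l x) \<le> (\<Sum>x\<in>{..<n} - {v}. nd E lv x + (if x \<in> adj E v \<and> i \<le> lv x then 4 + 16 * N else 0))"
    by (intro sum_mono others) auto
  also have "\<dots> = (\<Sum>x\<in>{..<n} - {v}. nd E lv x) + (4 + 16 * N) * card {x \<in> {..<n} - {v}. x \<in> adj E v \<and> i \<le> lv x}"
    by (subst sum.distrib) (simp only: sum_if_card finite_Diff finite_lessThan)
  also have "{x \<in> {..<n} - {v}. x \<in> adj E v \<and> i \<le> lv x} = {y \<in> adj E v. i \<le> lv y}"
    using adj_lt[OF wf] by auto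
  finally have s: "(\<Sum>x\<in>{..<n} - {v}. nd E ?l x) \<le> (\<Sum>x\<in>{..<n} - {v}. nd E lv x) + (4 + 16 * N) * ?k"
    unfolding dg_def .
  show ?thesis using own s threshold_gap[OF down] unfolding pot_split[OF v(1)] by (simp add: algebra_simps)
qed

section \<open>The potential under insertion and deletion of an edge\<close>

lemma adj_insert: "u \<noteq> v \<Longrightarrow> adj (insert {u, v} E) x = (if x = u then insert v (adj E x) else if x = v then insert u (adj E x) else adj E x)"
  by (auto simp: adj_def doubleton_eq_iff)

lemma adj_delete: "u \<noteq> v \<Longrightarrow> adj (E - {{u, v}}) x = (if x = u then adj E x - {v} else if x = v then adj E x - {u} else adj E x)"
  by (auto simp: adj_def doubleton_eq_iff)

lemma nd_insert:
  assumes wf: "wfE E" "wfE E'" and a: "adj E' x = insert y (adj E x)" "y \<notin> adj E x"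
  shows "nd E' lv x \<le> nd E lv x + (4 * L + 2)"
proof -
  have "dg E lv j x \<le> dg E' lv j x" for j
    unfolding dg_def by (intro card_mono dg_fin wf) (use a in auto)
  then have "(\<Sum>j<lv x. Ul j + 1 - dg E' lv j x) \<le> (\<Sum>j<lv x. Ul j + 1 - dg E lv j x)"
    by (intro sum_mono diff_le_mono2)
  then have "16 * N * (\<Sum>j<lv x. Ul j + 1 - dg E' lv j x) \<le> 16 * N * (\<Sum>j<lv x. Ul j + 1 - dg E lv j x)" by (rule mult_le_mono2)
  moreover have "(\<Sum>y\<in>adj E' x. pe (lv x) (lv y)) = pe (lv x) (lv y) + (\<Sum>y\<in>adj E x. pe (lv x) (lv y))"
    using a adj_finite[OF wf(1)] by simp
  ultimately show ?thesis using pe_le[of "lv x" "lv y"] unfolding nd_def by linarith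
qed

lemma nd_delete:
  assumes wf: "wfE E" "wfE E'" and a: "adj E' x = adj E x - {y}" "lv x \<le> L"
  shows "nd E' lv x \<le> nd E lv x + 16 * N * L"
proof -
  have "dg E lv j x \<le> dg E' lv j x + 1" for j
  proof -
    have "dg E lv j x \<le> card (insert y {z \<in> adj E' x. j \<le> lv z})"
      unfolding dg_def
    proof (rule card_mono)
      show "finite (insert y {z \<in> adj E' x. j \<le> lv z})" using dg_fin[OF wf(2)] by simp
    qed (use a in auto)
    also have "\<dots> \<le> Suc (card {z \<in> adj E' x. j \<le> lv z})" using dg_fin[OF wf(2)] by (simp add: card_insert_if)
    finally show ?thesis by (simp add: dg_def)
  qed
  then have "Ul j + 1 - dg E' lv j x \<le> Ul j + 1 - dg E lv j x + 1" for j
    by (rule diff_Suc_bound)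
  then have "(\<Sum>j<lv x. Ul j + 1 - dg E' lv j x) \<le> (\<Sum>j<lv x. Ul j + 1 - dg E lv j x + 1)"
    by (intro sum_mono)
  also have "\<dots> = (\<Sum>j<lv x. Ul j + 1 - dg E lv j x) + lv x" by (subst sum.distrib) simp
  finally have "(\<Sum>j<lv x. Ul j + 1 - dg E' lv j x) \<le> (\<Sum>j<lv x. Ul j + 1 - dg E lv j x) + L" using a by linarith
  then have "16 * N * (\<Sum>j<lv x. Ul j + 1 - dg E' lv j x) \<le> 16 * N * ((\<Sum>j<lv x. Ul j + 1 - dg E lv j x) + L)" by (rule mult_le_mono2)
  moreover have "(\<Sum>y\<in>adj E' x. pe (lv x) (lv y)) \<le> (\<Sum>y\<in>adj E x. pe (lv x) (lv y))"
    using a adj_finite[OF wf(1)] by (intro sum_mono2) auto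
  ultimately show ?thesis unfolding nd_def by (simp add: distrib_left)
qed

lemma wfE_insert: "wfE E \<Longrightarrow> u \<noteq> v \<Longrightarrow> u < n \<Longrightarrow> v < n \<Longrightarrow> wfE (insert {u, v} E)"
  by (auto simp: wfE_def)

lemma wfE_delete: "wfE E \<Longrightarrow> wfE (E - D)"
  by (auto simp: wfE_def)

lemma nd_cong: "adj E' x = adj E x \<Longrightarrow> nd E' lv x = nd E lv x"
  by (simp add: nd_def dg_def)

lemma sum_two:
  fixes f g :: "nat \<Rightarrow> nat"
  assumes "u < n" "v < n" "u \<noteq> v" "f u \<le> g u + c" "f v \<le> g v + c" "\<And>x. x \<noteq> u \<Longrightarrow> x \<noteq> v \<Longrightarrow> f x = g x"
  shows "(\<Sum>x<n. f x) \<le> (\<Sum>x<n. g x) + 2 * c"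
proof -
  have "(\<Sum>x<n. f x) = f u + (f v + (\<Sum>x\<in>{..<n} - {u} - {v}. f x))" for f :: "nat \<Rightarrow> nat"
    using assms(1-3) by (simp add: sum.remove[of _ u] sum.remove[of _ v])
  moreover have "(\<Sum>x\<in>{..<n} - {u} - {v}. f x) = (\<Sum>x\<in>{..<n} - {u} - {v}. g x)"
    using assms(6) by (intro sum.cong) auto
  ultimately show ?thesis using assms(4,5) by simp
qed

text \<open>Each endpoint gains one edge term, while its deficits can only shrink.\<close>

lemma pot_insert:
  assumes wf: "wfE E" and u: "u < n" "v < n" "u \<noteq> v" "{u, v} \<notin> E"
  shows "pot (insert {u, v} E) lv \<le> pot E lv + 2 * (4 * L + 2)"
  unfolding pot_def
proof (rule sum_two[OF u(1-3)])
  have wf': "wfE (insert {u, v} E)" by (rule wfE_insert[OF wf u(3,1,2)])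
  have n1: "v \<notin> adj E u" "u \<notin> adj E v" using u(4) by (auto simp: adj_def insert_commute)
  show "nd (insert {u, v} E) lv u \<le> nd E lv u + (4 * L + 2)"
    by (rule nd_insert[OF wf wf' _ n1(1)]) (simp add: adj_insert[OF u(3)])
  show "nd (insert {u, v} E) lv v \<le> nd E lv v + (4 * L + 2)"
    by (rule nd_insert[OF wf wf' _ n1(2)]) (use u(3) in \<open>simp add: adj_insert[OF u(3)]\<close>)
qed (rule nd_cong, simp add: adj_insert[OF u(3)])

text \<open>Each endpoint may miss one more neighbor on each of the at most \<open>L\<close> levels
  below it; edge terms only disappear.\<close>

lemma pot_delete:
  assumes wf: "wfE E" and u: "u < n" "v < n" "u \<noteq> v" and lv: "lv u \<le> L" "lv v \<le> L"
  shows "pot (E - {{u, v}}) lv \<le> pot E lv + 2 * (16 * N * L)"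
  unfolding pot_def
proof (rule sum_two[OF u(1-3)])
  have wf': "wfE (E - {{u, v}})" by (rule wfE_delete[OF wf])
  show "nd (E - {{u, v}}) lv u \<le> nd E lv u + 16 * N * L"
    by (rule nd_delete[OF wf wf', where y = v]) (use lv u in \<open>simp_all add: adj_delete[OF u(3)]\<close>)
  show "nd (E - {{u, v}}) lv v \<le> nd E lv v + 16 * N * L"
    by (rule nd_delete[OF wf wf', where y = u]) (use lv u in \<open>simp_all add: adj_delete[OF u(3)]\<close>)
qed (rule nd_cong, simp add: adj_delete[OF u(3)])

text \<open>A crude bound suffices: it serves to show that queue positions fit into a word.\<close>

lemma pot_bound:
  assumes wf: "wfE E" and lv: "\<And>v. v < n \<Longrightarrow> lv v \<le> L"
  shows "pot E lv \<le> 400 * N * B ^ 3"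
proof -
  have "nd E lv v \<le> n * (4 * L + 2) + 16 * N * (L * (16 * M + 2))" if "v < n" for v
  proof -
    have "(\<Sum>y\<in>adj E v. pe (lv v) (lv y)) \<le> card (adj E v) * (4 * L + 2)"
      using sum_bounded_above[of "adj E v" "\<lambda>y. pe (lv v) (lv y)" "4 * L + 2"] pe_le by auto
    also have "\<dots> \<le> n * (4 * L + 2)" using adj_card[OF wf, of v] by (intro mult_right_mono) auto
    finally have 1: "(\<Sum>y\<in>adj E v. pe (lv v) (lv y)) \<le> n * (4 * L + 2)" .
    have "Ul j + 1 - dg E lv j v \<le> 16 * M + 2" for j using Ul_le[of j] by linarith
    then have "(\<Sum>j<lv v. Ul j + 1 - dg E lv j v) \<le> lv v * (16 * M + 2)"
      using sum_bounded_above[of "{..<lv v}" "\<lambda>j. Ul j + 1 - dg E lv j v" "16 * M + 2"] by auto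
    also have "\<dots> \<le> L * (16 * M + 2)" using lv[OF that] by (intro mult_right_mono) auto
    finally have "16 * N * (\<Sum>j<lv v. Ul j + 1 - dg E lv j v) \<le> 16 * N * (L * (16 * M + 2))" by (rule mult_le_mono2)
    then show ?thesis using 1 unfolding nd_def by linarith
  qed
  then have "pot E lv \<le> n * (n * (4 * L + 2) + 16 * N * (L * (16 * M + 2)))"
    unfolding pot_def
    using sum_bounded_above[of "{..<n}" "nd E lv" "n * (4 * L + 2) + 16 * N * (L * (16 * M + 2))"] by auto
  also have "\<dots> \<le> B * (B * (4 * B) + 16 * N * (B * (16 * B)))"
  proof -
    have "n \<le> B" "4 * L + 2 \<le> 4 * B" "L \<le> B" "16 * M + 2 \<le> 16 * B" using B_bounds by linarith+
    then show ?thesis by (intro mult_mono add_mono order_refl) auto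
  qed
  also have "\<dots> = 4 * B ^ 3 + 256 * (N * B ^ 3)" by (simp add: power3_eq_cube algebra_simps)
  also have "\<dots> \<le> 400 * N * B ^ 3"
  proof -
    have "B ^ 3 \<le> N * B ^ 3" using N1 by simp
    then have "4 * B ^ 3 + 256 * (N * B ^ 3) \<le> 400 * (N * B ^ 3)" by linarith
    then show ?thesis by (simp add: mult.assoc)
  qed
  finally show ?thesis .
qed

section \<open>Arboricity bounds the occupied levels\<close>

lemma arboricity_bound:
  assumes wf: "wfE E" and S: "S \<subseteq> {..<n}" "2 \<le> card S"
  shows "card (induced_edges E S) \<le> arboricity n E * (card S - 1)"
proof -
  let ?P = "\<lambda>a. \<forall>S \<subseteq> {..<n}. 2 \<le> card S \<longrightarrow> \<lceil>real (card (induced_edges E S)) / (real (card S) - 1)\<rceil> \<le> int a"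
  have finE: "finite E"
  proof (rule finite_subset)
    show "E \<subseteq> Pow {..<n}" using wf by (auto simp: wfE_def)
  qed simp
  \<comment> \<open>Since the denominator is at least 1, \<open>card E\<close> is an admissible
    value, so the least one exists.\<close>
  have "?P (card E)"
  proof (intro allI impI)
    fix S :: "nat set" assume S: "S \<subseteq> {..<n}" "2 \<le> card S"
    have "real (card (induced_edges E S)) / (real (card S) - 1) \<le> real (card (induced_edges E S)) / 1"
      by (rule divide_left_mono) (use S in auto)
    also have "\<dots> \<le> real (card E)" using card_mono[OF finE, of "induced_edges E S"] by (auto simp: induced_edges_def)
    finally show "\<lceil>real (card (induced_edges E S)) / (real (card S) - 1)\<rceil> \<le> int (card E)"
      by (simp add: ceiling_le_iff)
  qed
  then have "?P (arboricity n E)" unfolding arboricity_def by (rule LeastI[of ?P])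
  then have "\<lceil>real (card (induced_edges E S)) / (real (card S) - 1)\<rceil> \<le> int (arboricity n E)" using S by blast
  then have "real (card (induced_edges E S)) / (real (card S) - 1) \<le> real (arboricity n E)"
    by (simp add: ceiling_le_iff)
  then have "real (card (induced_edges E S)) \<le> real (arboricity n E) * (real (card S) - 1)"
    using S by (simp add: divide_le_eq)
  also have "\<dots> = real (arboricity n E * (card S - 1))" using S by (simp add: of_nat_diff)
  finally show ?thesis by (simp only: of_nat_le_iff)
qed

definition stable :: "edge set \<Rightarrow> (nat \<Rightarrow> nat) \<Rightarrow> nat \<Rightarrow> bool" where
  "stable E lv v \<longleftrightarrow> dg E lv (lv v) v \<le> Ul (lv v) \<and> (0 < lv v \<longrightarrow> Dl (lv v - 1) < dg E lv (lv v - 1) v)"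

lemma handshake:
  assumes wf: "wfE E" and S: "S \<subseteq> {..<n}"
  shows "(\<Sum>v\<in>S. card {y \<in> adj E v. y \<in> S}) \<le> 2 * card (induced_edges E S)"
proof -
  have finE: "finite E"
  proof (rule finite_subset)
    show "E \<subseteq> Pow {..<n}" using wf by (auto simp: wfE_def)
  qed simp
  have finS: "finite S" using S finite_subset by blast
  let ?I = "induced_edges E S"
  have "(\<Sum>v\<in>S. card {y \<in> adj E v. y \<in> S}) = card (SIGMA v:S. {y \<in> adj E v. y \<in> S})"
    using finS dg_fin[OF wf] by (simp add: card_SigmaI)
  also have "\<dots> \<le> card (\<Union>e\<in>?I. {(x, y). {x, y} = e})"
  proof (rule card_mono)
    have "finite {(x, y). {x, y} = e}" if "e \<in> ?I" for e
    proof (rule finite_subset)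
      show "{(x, y). {x, y} = e} \<subseteq> e \<times> e" by auto
      show "finite (e \<times> e)" using that wf by (auto simp: induced_edges_def wfE_def)
    qed
    then show "finite (\<Union>e\<in>?I. {(x, y). {x, y} = e})"
      using finE by (intro finite_UN_I) (auto simp: induced_edges_def)
  qed (auto simp: induced_edges_def adj_def)
  also have "\<dots> \<le> (\<Sum>e\<in>?I. card {(x, y). {x, y} = e})"
    by (rule card_UN_le) (use finE in \<open>simp add: induced_edges_def\<close>)
  also have "\<dots> \<le> (\<Sum>e\<in>?I. 2)"
  proof (rule sum_mono)
    fix e assume "e \<in> ?I"
    then obtain a b where e: "e = {a, b}" using wf by (auto simp: induced_edges_def wfE_def)
    have "{(x, y). {x, y} = e} \<subseteq> {(a, b), (b, a)}" by (auto simp: e doubleton_eq_iff)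
    then have "card {(x, y). {x, y} = e} \<le> card {(a, b), (b, a)}" by (intro card_mono) auto
    also have "\<dots> \<le> 2" by (simp add: card_insert_le_m1)
    finally show "card {(x, y). {x, y} = e} \<le> 2" .
  qed
  finally show ?thesis by (simp add: mult.commute)
qed

text \<open>Suppose that \<open>a = Av j\<close> is at least the arboricity, and let
  \<open>Z i\<close> be the nodes on level \<open>i\<close> or above. Every node of
  \<open>Z (Suc i)\<close> has at least \<open>2 * a + a / N\<close> neighbors in
  \<open>Z i\<close>, whereas the degrees within \<open>Z i\<close> sum up to at most
  \<open>2 * a * card (Z i)\<close>. So the set shrinks by \<open>1 + 1 / (2 * N)\<close> with every
  level of the group, and after \<open>R\<close> levels fewer than one node is left.\<close>

lemma level_arboricity:
  assumes wf: "wfE E" and st: "\<And>v. v < n \<Longrightarrow> stable E lv v" and v: "v < n" "R * Suc j \<le> lv v"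
  shows "Av j < arboricity n E"
proof (rule ccontr)
  assume neg: "\<not> Av j < arboricity n E"
  define a where "a = Av j"
  define Z where "Z i = {v. v < n \<and> i \<le> lv v}" for i
  have finZ: "finite (Z i)" for i by (simp add: Z_def)
  have a1: "1 \<le> a" using Av_ge1 by (simp add: a_def)
  have step: "real (card (Z (Suc i))) * (1 + 1 / real (2 * N)) \<le> real (card (Z i))" if i: "i div R = j" for i
  proof (cases "Z (Suc i) = {}")
    case True
    then show ?thesis by simp
  next
    case False
    have big: "Dl i < card {y \<in> adj E v. y \<in> Z i}" if "v \<in> Z (Suc i)" for v
    proof -
      have v: "v < n" "Suc i \<le> lv v" using that by (auto simp: Z_def)
      \<comment> \<open>Stability bounds the degree only just below the level of \<open>v\<close>,
        which may be far above \<open>i\<close>; monotonicity of both sides carries the bound down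
        to \<open>i\<close>.\<close>
      have "Dl i \<le> Dl (lv v - 1)" using v by (intro Dl_mono) simp
      also have "\<dots> < dg E lv (lv v - 1) v" using st[OF v(1)] v(2) by (simp add: stable_def)
      also have "\<dots> \<le> dg E lv i v" using v by (intro dg_antimono wf) simp
      also have "\<dots> = card {y \<in> adj E v. y \<in> Z i}" unfolding dg_def Z_def
        by (rule arg_cong[of _ _ card]) (use adj_lt[OF wf] in auto)
      finally show ?thesis .
    qed
    have D: "Dl i = 2 * a + a div N" using i by (simp add: Dl_def a_def)
    have "(\<Sum>v\<in>Z (Suc i). Dl i + 1) \<le> (\<Sum>v\<in>Z (Suc i). card {y \<in> adj E v. y \<in> Z i})"
      using big by (intro sum_mono) (simp add: Suc_le_eq)
    also have "\<dots> \<le> (\<Sum>v\<in>Z i. card {y \<in> adj E v. y \<in> Z i})"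
      by (rule sum_mono2) (auto simp: Z_def)
    also have "\<dots> \<le> 2 * card (induced_edges E (Z i))" by (rule handshake[OF wf]) (auto simp: Z_def)
    finally have 1: "card (Z (Suc i)) * (Dl i + 1) \<le> 2 * card (induced_edges E (Z i))" by simp
    obtain v where v: "v \<in> Z (Suc i)" using False by blast
    \<comment> \<open>\<open>Z i\<close> has two elements, as the arboricity bound demands: a node
      of \<open>Z (Suc i)\<close> and one of its neighbors.\<close>
    have "{y \<in> adj E v. y \<in> Z i} \<noteq> {}" using big[OF v] by (metis card.empty not_less_zero)
    then obtain y where y: "y \<in> adj E v" "y \<in> Z i" by blast
    have "card {v, y} \<le> card (Z i)" using y v finZ by (intro card_mono) (auto simp: Z_def)
    then have c2: "2 \<le> card (Z i)" using adj_lt[OF wf y(1)] by simp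
    have "card (induced_edges E (Z i)) \<le> arboricity n E * (card (Z i) - 1)"
      by (rule arboricity_bound[OF wf _ c2]) (auto simp: Z_def)
    also have "\<dots> \<le> a * card (Z i)" using neg by (intro mult_mono) (auto simp: a_def)
    finally have "card (Z (Suc i)) * (Dl i + 1) \<le> 2 * (a * card (Z i))" using 1 by linarith
    then have "N * (card (Z (Suc i)) * (Dl i + 1)) \<le> N * (2 * (a * card (Z i)))" by (rule mult_le_mono2)
    moreover have "card (Z (Suc i)) * (2 * a * N + a) \<le> N * (card (Z (Suc i)) * (Dl i + 1))"
    proof -
      have "2 * a * N + a \<le> N * (Dl i + 1)" using div_bound[OF N1, of a] by (simp add: D algebra_simps)
      then have "card (Z (Suc i)) * (2 * a * N + a) \<le> card (Z (Suc i)) * (N * (Dl i + 1))" by (rule mult_le_mono2)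
      then show ?thesis by (simp only: mult.left_commute[of N])
    qed
    ultimately have "a * (card (Z (Suc i)) * (2 * N + 1)) \<le> a * (2 * N * card (Z i))" by (simp add: algebra_simps)
    then have "card (Z (Suc i)) * (2 * N + 1) \<le> 2 * N * card (Z i)" using a1 by simp
    then have "real (card (Z (Suc i)) * (2 * N + 1)) \<le> real (2 * N * card (Z i))" by (simp only: of_nat_le_iff)
    then show ?thesis using N1 by (simp add: field_simps)
  qed
  have it: "real (card (Z (R * j + m))) * (1 + 1 / real (2 * N)) ^ m \<le> real n" if "m \<le> R" for m
    using that
  proof (induction m)
    case 0
    have "card (Z (R * j)) \<le> card {..<n}" by (intro card_mono) (auto simp: Z_def)
    then show ?case by simp
  next
    case (Suc m)
    have "(R * j + m) div R = j" using Suc(2) by simp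
    from step[OF this] have "real (card (Z (R * j + Suc m))) * (1 + 1 / real (2 * N)) * (1 + 1 / real (2 * N)) ^ m
       \<le> real (card (Z (R * j + m))) * (1 + 1 / real (2 * N)) ^ m" by (intro mult_right_mono) auto
    then show ?case using Suc by (simp add: mult.assoc)
  qed
  have "v \<in> Z (R * j + R)" using v by (simp add: Z_def algebra_simps)
  then have "1 \<le> real (card (Z (R * j + R)))" using finZ by (metis Suc_leI One_nat_def card_gt_0_iff empty_iff of_nat_1 of_nat_le_iff)
  moreover have "(2::real) ^ K \<le> (1 + 1 / real (2 * N)) ^ R" using bern2[of "2 * N" K] N1 by (simp add: R_def)
  ultimately have "1 * (2::real) ^ K \<le> real (card (Z (R * j + R))) * (1 + 1 / real (2 * N)) ^ R" by (intro mult_mono) auto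
  also have "\<dots> \<le> real n" by (rule it) simp
  finally have "real M \<le> real n" by (simp add: M_def)
  then show False using B_bounds n2 by simp
qed

text \<open>In the first group the threshold is 5, so the subtraction of 1 is what makes it fit
  arboricity 1. In a later group the preceding parameter is less than the arboricity. With
  \<open>q = 1 / N\<close>, growth and rounding cost a factor
  \<open>(1 + q)\<^sup>2 \<le> 1 + 3 * q\<close>, and \<open>4 * 3\<close> gives the 12.\<close>

lemma Ul_arboricity:
  assumes wf: "wfE E" and st: "\<And>v. v < n \<Longrightarrow> stable E lv v" and v: "v < n" "l \<le> lv v" and E: "E \<noteq> {}" and N: "2 \<le> N"
  shows "real (Ul l) - 1 \<le> (4 + 12 / real N) * real (arboricity n E)"
proof (cases "l div R")
  case 0
  obtain e where "e \<in> E" using E by blast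
  then obtain x y where xy: "{x, y} \<in> E" "x \<noteq> y" "x < n" "y < n" using wf unfolding wfE_def by metis
  have "card {{x, y}} \<le> card (induced_edges E {x, y})"
  proof (rule card_mono)
    show "finite (induced_edges E {x, y})" unfolding induced_edges_def by (rule finite_subset[of _ "Pow {x, y}"]) auto
  qed (use xy in \<open>auto simp: induced_edges_def\<close>)
  moreover have "card (induced_edges E {x, y}) \<le> arboricity n E * (card {x, y} - 1)"
    by (rule arboricity_bound[OF wf]) (use xy in auto)
  ultimately have "1 \<le> arboricity n E" using xy by simp
  then have f1: "1 \<le> real (arboricity n E)" by simp
  have "Ul l = 5" using 0 N by (simp add: Ul_def Av_0)
  then have f2: "real (Ul l) - 1 = 4" by simp
  have "4 * real (arboricity n E) \<le> (4 + 12 / real N) * real (arboricity n E)" by (intro mult_right_mono) auto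
  then show ?thesis using f1 f2 by linarith
next
  case (Suc j)
  have "R * Suc j \<le> l" using Suc by (metis times_div_less_eq_dividend)
  then have al: "Av j < arboricity n E" using v by (intro level_arboricity[OF wf st v(1)]) auto
  have A: "Av (Suc j) \<le> Av j + 1 + Av j div N" by (simp add: Av_Suc)
  define x where "x = real (Av j) + 1"
  define q where "q = 1 / real N"
  have q: "0 \<le> q" "q \<le> 1 / 2" using N by (auto simp: q_def field_simps)
  have rd: "real (m div N) \<le> real m * q" for m
  proof -
    have "N * (m div N) \<le> m" by simp
    then have "real N * real (m div N) \<le> real m" by (metis of_nat_le_iff of_nat_mult)
    then show ?thesis using N1 unfolding q_def by (simp add: field_simps)
  qed
  have x0: "0 \<le> x" by (simp add: x_def)
  have "real (Av j div N) \<le> x * q" using rd[of "Av j"] q unfolding x_def by (simp add: algebra_simps)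
  then have "real (Av (Suc j)) \<le> x * (1 + q)" using A unfolding x_def by (simp add: algebra_simps)
  moreover from this have "real (Av (Suc j)) * q \<le> x * (1 + q) * q" using q by (intro mult_right_mono)
  ultimately have "real (Ul l) - 1 \<le> 4 * (x * (1 + q)) + 4 * (x * (1 + q) * q)"
    using rd[of "Av (Suc j)"] Suc by (simp add: Ul_def)
  also have "\<dots> = 4 * x * (1 + (2 + q) * q)" by (simp add: algebra_simps)
  also have "\<dots> \<le> 4 * x * (1 + 3 * q)" using q x0 by (intro mult_left_mono add_left_mono mult_right_mono) auto
  also have "\<dots> = (4 + 12 / real N) * x" by (simp add: q_def algebra_simps)
  also have "\<dots> \<le> (4 + 12 / real N) * real (arboricity n E)" using al by (intro mult_left_mono) (auto simp: x_def)
  finally show ?thesis .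
qed

end

section \<open>Moving a node\<close>

definition push :: com where
  "push = (Store ''qa'' (Reg ''t'') (Reg ''x'') ;; Store ''qb'' (Reg ''t'') (Reg ''y'') ;;
     ''t'' ::= Reg ''t'' +. Const 1)"

text \<open>The edge of rank \<open>r\<close>, the number of edges still to be done, is taken each
  time, that is, the edges come by decreasing color. An edge that remains on the level thus does not
  disturb the ranks of the smaller colors.\<close>

definition move :: com where
  "move =
    (''p'' ::= tbase (Reg ''x'') (Reg ''l'') ;; ''r'' ::= Load ''T'' (Reg ''p'' +. Const 1) ;;
     While (Reg ''r'')
      (''p'' ::= tbase (Reg ''x'') (Reg ''l'') ;; select_rank ;;
       ''y'' ::= Load ''at'' (baddr (Reg ''x'') (Reg ''k'')) -. Const 1 ;;
       push ;;
       ''m'' ::= Load ''lev'' (Reg ''y'') ;;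
       Cond (Reg ''g'' <. Reg ''m'') (''m'' ::= Reg ''g'') Skip ;;
       relevel ;;
       ''r'' ::= Reg ''r'' -. Const 1) ;;
     Store ''lev'' (Reg ''x'') (Reg ''g''))"

lemma writes_move [simp]:
  "wr push = {''t''}" "wm push = {''qa'', ''qb''}"
  "wr move = {''p'', ''r'', ''i'', ''z'', ''k'', ''y'', ''t'', ''m''}" "wm move = {''qa'', ''qb'', ''T'', ''lev''}"
  by (auto simp: push_def move_def)

context ctx begin

lemma rep_cong:
  assumes "rep \<mu> c el" "\<And>a b. a < n \<Longrightarrow> b < n \<Longrightarrow> c a b \<noteq> 0 \<Longrightarrow> el a b = el' a b"
  shows "rep \<mu> c el'"
proof -
  have "FF c el x l = FF c el' x l" if "x < n" for x l
    using assms(2)[OF that] by (auto simp: FF_def)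
  then show ?thesis using assms(1) unfolding rep_def by (auto intro: forest_cong)
qed

lemma rep_frame: "rep \<mu> c el \<Longrightarrow> \<mu>' ''color'' = \<mu> ''color'' \<Longrightarrow> \<mu>' ''at'' = \<mu> ''at'' \<Longrightarrow> \<mu>' ''T'' = \<mu> ''T'' \<Longrightarrow> rep \<mu>' c el"
  by (simp add: rep_def)

lemma rank_max:
  fixes S :: "nat set"
  assumes "finite S" "k \<in> S" "k < d" "card {j \<in> S. j < k} = r" "card {j \<in> S. j < d} = Suc r" "j \<in> S" "j < d"
  shows "j \<le> k"
proof -
  have "insert k {j \<in> S. j < k} = {j \<in> S. j < d}"
    by (rule card_subset_eq) (use assms in auto)
  then show ?thesis using assms(6,7) by fastforce
qed

text \<open>While node \<open>x\<close> moves from level \<open>l\<close> to level \<open>g\<close>, its edges on level \<open>l\<close> are treated by decreasing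
  color; those with a color of at least \<open>d\<close> are done.\<close>

definition moved :: "(nat \<Rightarrow> nat \<Rightarrow> nat) \<Rightarrow> (nat \<Rightarrow> nat \<Rightarrow> nat) \<Rightarrow> (nat \<Rightarrow> nat) \<Rightarrow> nat \<Rightarrow> nat \<Rightarrow> nat \<Rightarrow> nat \<Rightarrow> nat \<Rightarrow> nat \<Rightarrow> nat" where
  "moved c el lv x l g d = (\<lambda>a b. if a = x \<and> d < c x b \<and> el x b = l then min g (lv b)
     else if b = x \<and> d < c x a \<and> el x a = l then min g (lv a) else el a b)"

text \<open>Releveling edges with larger colors leaves the colors below \<open>d\<close> on level
  \<open>l\<close> untouched, so ranks there may be computed from the original set.\<close>

lemma FF_rank:
  assumes "k < d" "l \<noteq> L + 1"
  shows "k \<in> FF c (moved c el lv x l g d) x l \<longleftrightarrow> k \<in> FF c el x l"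
proof -
  have "c x z = Suc k \<Longrightarrow> moved c el lv x l g d x z = el x z" for z
    using assms(1) by (auto simp: moved_def)
  then show ?thesis unfolding FF_mem[OF assms(2)] by auto
qed

lemma moved_step:
  assumes ok: "okc c" and x: "x < n" "y < n" "x \<noteq> y" "c x y = Suc k" "el x y = l" "k < d"
    and no: "\<And>b. b < n \<Longrightarrow> el x b = l \<Longrightarrow> k < c x b \<Longrightarrow> c x b \<le> d \<Longrightarrow> b = y" and ab: "a < n" "b < n"
  shows "upd2 (moved c el lv x l g d) x y (min g (lv y)) a b = moved c el lv x l g k a b"
proof -
  have a: "(k < c x b \<and> el x b = l) = (b = y \<or> (d < c x b \<and> el x b = l))" if "b < n" for b
    using no[OF that] x by (metis less_Suc_eq not_le_imp_less order_less_trans)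
  show ?thesis
    using a[OF ab(1)] a[OF ab(2)] x(3) by (auto simp: upd2_def moved_def)
qed

lemma FF_finite: "okc c \<Longrightarrow> x < n \<Longrightarrow> finite (FF c el x l)"
  by (rule finite_subset[of _ "{..<M}"]) (auto simp: FF_def cols_def dest: okc_le split: if_splits)

lemma inj_colors: "okc c \<Longrightarrow> x < n \<Longrightarrow> A \<subseteq> {y. y < n \<and> c x y \<noteq> 0} \<Longrightarrow> inj_on (\<lambda>y. c x y - 1) A"
proof (rule inj_onI)
  fix a b assume h: "okc c" "x < n" "A \<subseteq> {y. y < n \<and> c x y \<noteq> 0}" "a \<in> A" "b \<in> A" "c x a - 1 = c x b - 1"
  then have "a < n" "b < n" "c x a \<noteq> 0" "c x b \<noteq> 0" by auto
  then have "c x a = Suc (c x b - 1)" "c x b = Suc (c x b - 1)" using h(6) by linarith+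
  with \<open>a < n\<close> \<open>b < n\<close> show "a = b" using okc_uniq[OF h(1,2)] by blast
qed

lemma FF_card: "okc c \<Longrightarrow> x < n \<Longrightarrow> l \<le> L \<Longrightarrow> card (FF c el x l) = card {y. y < n \<and> c x y \<noteq> 0 \<and> el x y = l}"
proof -
  assume a: "okc c" "x < n" "l \<le> L"
  have inj: "inj_on (\<lambda>y. c x y - 1) {y. y < n \<and> c x y \<noteq> 0 \<and> el x y = l}"
    by (rule inj_colors[OF a(1,2)]) auto
  have img: "(\<lambda>y. c x y - 1) ` {y. y < n \<and> c x y \<noteq> 0 \<and> el x y = l} = FF c el x l"
    using a(3) by (force simp: FF_def image_iff)
  show ?thesis using card_image[OF inj] unfolding img .
qed

lemma cols_card: "okc c \<Longrightarrow> x < n \<Longrightarrow> card (FF c el x (L + 1)) = card {y. y < n \<and> c x y \<noteq> 0}"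
proof -
  assume a: "okc c" "x < n"
  have inj: "inj_on (\<lambda>y. c x y - 1) {y. y < n \<and> c x y \<noteq> 0}"
    by (rule inj_colors[OF a(1,2)]) auto
  have img: "(\<lambda>y. c x y - 1) ` {y. y < n \<and> c x y \<noteq> 0} = FF c el x (L + 1)"
    by (force simp: FF_def cols_def image_iff)
  show ?thesis using card_image[OF inj] unfolding img .
qed

lemma move_wp:
  assumes g: "glob s" and r: "reg s ''x'' = x" "reg s ''l'' = l" "reg s ''g'' = gg" "reg s ''t'' = q"
    "x < n" "l \<le> L" "gg \<le> L"
    and R: "rep (mem s) c el" and ok: "okc c" and el: "\<And>a b. el a b = el b a"
    and lv: "lv = mem s ''lev''" "\<And>v. v < n \<Longrightarrow> lv v \<le> L"
    and qW: "q + card (FF c el x l) < WW"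
    and Q: "\<And>t' s'. t' \<le> t + 300 * K * (card (FF c el x l) + 1) \<Longrightarrow> frame s s' (wr move) (wm move) \<Longrightarrow>
       mem s' ''lev'' = lv(x := gg) \<Longrightarrow> rep (mem s') c (moved c el lv x l gg 0) \<Longrightarrow> reg s' ''t'' = q + card (FF c el x l) \<Longrightarrow>
       (\<forall>j<q. mem s' ''qa'' j = mem s ''qa'' j \<and> mem s' ''qb'' j = mem s ''qb'' j) \<Longrightarrow>
       (\<forall>j. q \<le> j \<and> j < q + card (FF c el x l) \<longrightarrow> mem s' ''qa'' j = x \<and> mem s' ''qb'' j < n) \<Longrightarrow>
       (\<forall>y<n. c x y \<noteq> 0 \<and> el x y = l \<longrightarrow> (\<exists>j. q \<le> j \<and> j < q + card (FF c el x l) \<and> mem s' ''qb'' j = y)) \<Longrightarrow> Q t' s'"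
  shows "wp w move Q t s"
proof -
  define S0 where "S0 = FF c el x l"
  define r0 where "r0 = card S0"
  have lL: "l \<noteq> L + 1" using r(6) by simp
  have finS: "finite S0" unfolding S0_def by (rule FF_finite[OF ok r(5)])
  have S0M: "S0 \<subseteq> {..<M}" using okc_le[OF ok r(5)] lL by (fastforce simp: S0_def FF_mem)
  have root: "mem s ''T'' (tb x l + 1) = r0"
    using forest_root[OF rep_forest[OF R] r(5), of l] r(6) by (simp add: r0_def S0_def)
  have tbW: "tb x l + 1 < WW" using tb_lt[OF r(5), of l 1] r(6) BBn B_bounds by simp
  \<comment> \<open>The number of edges still to be done, which is the content of register
    \<open>r\<close>. In the time bound, \<open>290 * K\<close> covers the search
    (\<open>40 * K\<close>), \<open>relevel\<close> (\<open>200 * K\<close>) and a constant rest, as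
    \<open>2 \<le> K\<close>.\<close>
  define rem where "rem d = card {j \<in> S0. j < d}" for d
  have rem_le: "rem d \<le> r0" for d unfolding rem_def r0_def by (rule card_mono[OF finS]) auto
  define I where "I = (\<lambda>t' (s'::state). \<exists>d\<le>M. t' + rem d * (290 * K) \<le> t + 20 + r0 * (290 * K) \<and> reg s' ''r'' = rem d \<and>
     rep (mem s') c (moved c el lv x l gg d) \<and> reg s' ''t'' + rem d = q + r0 \<and>
     (\<forall>j<q. mem s' ''qa'' j = mem s ''qa'' j \<and> mem s' ''qb'' j = mem s ''qb'' j) \<and>
     (\<forall>j. q \<le> j \<and> j < reg s' ''t'' \<longrightarrow> mem s' ''qa'' j = x \<and> mem s' ''qb'' j < n) \<and>
     (\<forall>y<n. d < c x y \<and> el x y = l \<longrightarrow> (\<exists>j. q \<le> j \<and> j < reg s' ''t'' \<and> mem s' ''qb'' j = y)))"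
  show ?thesis
    unfolding move_def wp_Seq[of w "''p'' ::= _"] wp_Seq[of w "''r'' ::= _"] wp_Seq[of w "While _ _"] wp_Assign
  proof (rule wp_While[where I = I and Bd = "t + 20 + r0 * (290 * K)"], goal_cases)
    case 1
    have "rem M = r0" using S0M unfolding rem_def r0_def by (intro arg_cong[of _ _ card]) auto
    moreover have "rep (mem s) c (moved c el lv x l gg M)"
      by (rule rep_cong[OF R]) (use okc_le[OF ok] r(5) in \<open>auto simp: moved_def not_less[symmetric] leD\<close>)
    moreover have "\<not> M < c x y" if "y < n" for y using okc_le[OF ok r(5) that] by simp
    ultimately show ?case unfolding I_def
      using r g root tbW by (intro exI[of _ M]) (auto simp: globD)
  next
    case (2 t' s')
    then show ?case by (auto simp: I_def)
  next
    case (3 t' s')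
    then obtain d where d: "d \<le> M" "t' + rem d * (290 * K) \<le> t + 20 + r0 * (290 * K)" "reg s' ''r'' = rem d"
      "rep (mem s') c (moved c el lv x l gg d)" "reg s' ''t'' + rem d = q + r0"
      "\<forall>j<q. mem s' ''qa'' j = mem s ''qa'' j \<and> mem s' ''qb'' j = mem s ''qb'' j"
      "\<forall>j. q \<le> j \<and> j < reg s' ''t'' \<longrightarrow> mem s' ''qa'' j = x \<and> mem s' ''qb'' j < n"
      "\<forall>y<n. d < c x y \<and> el x y = l \<longrightarrow> (\<exists>j. q \<le> j \<and> j < reg s' ''t'' \<and> mem s' ''qb'' j = y)"
      unfolding I_def by blast
    have rp: "1 \<le> rem d" using 3(3) d(3) by simp
    have fr: "reg s' ''x'' = x" "reg s' ''l'' = l" "reg s' ''g'' = gg" "mem s' ''lev'' = lv" 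
      using 3(2) r lv(1) by (auto simp: frame_def)
    have g': "glob s'" using 3(2) g by (auto simp: frame_def glob_def)
    let ?el = "moved c el lv x l gg d"
    let ?S = "FF c ?el x l"
    let ?s1 = "s'\<lparr>reg := (reg s')(''p'' := tb x l)\<rparr>"
    have Sd: "{j \<in> ?S. j < d} = {j \<in> S0. j < d}" using FF_rank[OF _ lL, of _ d c el lv x gg] unfolding S0_def by auto
    have finS': "finite ?S" by (rule FF_finite[OF ok r(5)])
    have "rem d \<le> card ?S" unfolding rem_def Sd[symmetric] by (rule card_mono[OF finS']) auto
    have "wp w select_rank (wp w (''y'' ::= Load ''at'' (baddr (Reg ''x'') (Reg ''k'')) -. Const 1 ;;
       push ;; ''m'' ::= Load ''lev'' (Reg ''y'') ;;
       Cond (Reg ''g'' <. Reg ''m'') (''m'' ::= Reg ''g'') Skip ;;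
       relevel ;; ''r'' ::= Reg ''r'' -. Const 1) I) (t' + 10) ?s1"
    proof (rule select_rank_wp[where x = x and l = l and F = "FF c ?el" and rk = "rem d"], goal_cases)
      case (9 t2 s2 k)
      have kd: "k < d"
      proof (rule ccontr)
        assume "\<not> k < d"
        then have "card {j \<in> ?S. j < d} \<le> card {j \<in> ?S. j < k}" using finS' by (intro card_mono) auto
        then show False using 9(6) rp unfolding Sd rem_def by simp
      qed
      have kS: "k \<in> S0" using FF_rank[OF kd lL, of c el lv x gg] 9(5) by (simp add: S0_def)
      have "{j \<in> ?S. j < k} = {j \<in> S0. j < k}" using FF_rank[OF _ lL, of _ d c el lv x gg] kd unfolding S0_def by auto
      then have remk: "Suc (rem k) = rem d" using 9(6) rp unfolding rem_def by simp
      obtain y where y: "y < n" "c x y = Suc k" "el x y = l" using kS lL by (auto simp: S0_def FF_mem)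
      have xy: "x \<noteq> y" using okc_irrefl[OF ok r(5)] y by auto
      \<comment> \<open>\<open>rem k\<close> and \<open>rem d\<close> are consecutive, so
        \<open>k\<close> is the largest color below \<open>d\<close> on the level, and only the edge
        to \<open>y\<close> is added to those that are done.\<close>
      have no: "b = y" if b: "b < n" "el x b = l" "k < c x b" "c x b \<le> d" for b
      proof -
        obtain j where j: "c x b = Suc j" using b(3) by (cases "c x b") auto
        have "j \<in> S0" using b j lL by (auto simp: S0_def FF_mem)
        then have "j \<le> k" using rank_max[OF finS kS kd refl, of j] remk b(4) j unfolding rem_def by simp
        then have "c x b = Suc k" using b(3) j by simp
        then show ?thesis using okc_uniq[OF ok r(5) b(1) y(1) _ y(2)] by simp
      qed
      have elxy: "?el x y = l" "?el y x = l" using y kd xy el by (auto simp: moved_def)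
      have regs: "reg s2 ''x'' = x" "reg s2 ''l'' = l" "reg s2 ''g'' = gg" "reg s2 ''t'' = reg s' ''t''" "reg s2 ''r'' = rem d" "mem s2 = mem s'"
        using 9(2) fr d(3) by (auto simp: frame_def)
      have g2: "glob s2" using 9(2) g' by (auto simp: frame_def glob_def)
      have at: "mem s' ''at'' (x * B + k) = Suc y" using rep_at[OF d(4) r(5) 9(4) y(1)] y(2) by simp
      have kB: "k < B" using 9(4) B_bounds by linarith
      have W: "Suc y < WW" "reg s' ''t'' + 1 < WW" "rem d < WW" 
        using y(1) L_WW d(5) qW rp unfolding r0_def S0_def by linarith+
      let ?q = "reg s' ''t''"
      define s3 where "s3 = s2\<lparr>reg := (reg s2)(''y'' := y, ''t'' := ?q + 1, ''m'' := min gg (lv y)),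
         mem := (mem s2)(''qa'' := (mem s2 ''qa'')(?q := x), ''qb'' := (mem s2 ''qb'')(?q := y))\<rparr>"
      have st: "wp w (''y'' ::= Load ''at'' (baddr (Reg ''x'') (Reg ''k'')) -. Const 1 ;;
         push ;; ''m'' ::= Load ''lev'' (Reg ''y'') ;;
         Cond (Reg ''g'' <. Reg ''m'') (''m'' ::= Reg ''g'') Skip ;; c') P t2 s2" if "\<And>t3 s3'. t3 \<le> t2 + 40 \<Longrightarrow> s3' = s3 \<Longrightarrow> wp w c' P t3 s3'" for c' P
        using W g2 9(3) kB r(5) at
        by (simp add: push_def regs fr) (intro conjI impI; rule that; simp add: s3_def min_def regs)
      have g3: "glob s3" using g2 by (simp add: s3_def)
      show ?case
      proof (rule st, hypsubst, unfold wp_Seq, rule relevel_wp[where x = x and y = y and k = k and l = l and m = "min gg (lv y)" and c = c and el = ?el], goal_cases)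
        case (16 t3 s3' t4 s4)
        have r4: "reg s4 ''r'' = rem d" "reg s4 ''t'' = ?q + 1" "mem s4 ''qa'' = (mem s' ''qa'')(?q := x)" "mem s4 ''qb'' = (mem s' ''qb'')(?q := y)"
          using 16(3) regs by (auto simp: frame_def s3_def)
        have "rep (mem s4) c (moved c el lv x l gg k)"
          by (rule rep_cong[OF 16(4)]) (rule moved_step[where c = c and el = el and d = d, OF ok r(5) y(1) xy y(2,3) kd no])
        moreover have "\<exists>j. q \<le> j \<and> j < ?q + 1 \<and> ((mem s' ''qb'')(?q := y)) j = y'"
          if y': "y' < n" "k < c x y'" "el x y' = l" for y'
        proof (cases "d < c x y'")
          case True
          then obtain j where "q \<le> j" "j < ?q" "mem s' ''qb'' j = y'" using d(8) y' by blast
          then show ?thesis by (intro exI[of _ j]) auto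
        next
          case False
          then have "y' = y" using no y' by simp
          moreover have "q \<le> ?q" using d(5) rem_le[of d] by linarith
          ultimately show ?thesis by (intro exI[of _ ?q]) auto
        qed
        moreover have "q \<le> ?q" using d(5) rem_le[of d] by linarith
        moreover have "t4 + 4 + rem k * (290 * K) \<le> t + 20 + r0 * (290 * K)"
        proof -
          have "t4 \<le> t' + 10 + 40 * K + 40 + 200 * K" using 16(1,2) 9(1) by linarith
          moreover have "rem d * (290 * K) = rem k * (290 * K) + 290 * K" by (simp add: remk[symmetric])
          ultimately show ?thesis using d(2) K_ge2 by linarith
        qed
        moreover have "rem d - 1 = rem k" using remk by simp
        ultimately have "I (t4 + 4) (s4\<lparr>reg := (reg s4)(''r'' := rem k)\<rparr>)"
          unfolding I_def using d kd y(1) remk r4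
          by (intro exI[of _ k] conjI) (auto simp: less_Suc_eq)
        then show ?case using r4 W rp \<open>rem d - 1 = rem k\<close> by (simp add: numeral_eq_Suc)
      qed (use g3 regs r y d(4) ok elxy lv(2)[OF y(1)] 9(3) in \<open>auto simp: s3_def intro: rep_frame\<close>)
    qed (use g' d(3,4) rp \<open>rem d \<le> card ?S\<close> r in \<open>auto simp: globD rep_forest\<close>)
    then show ?case using fr g' r by (simp add: numeral_eq_Suc)
  next
    case (4 t' s')
    then obtain d where d: "d \<le> M" "t' + rem d * (290 * K) \<le> t + 20 + r0 * (290 * K)" "reg s' ''r'' = rem d"
      "rep (mem s') c (moved c el lv x l gg d)" "reg s' ''t'' + rem d = q + r0"
      "\<forall>j<q. mem s' ''qa'' j = mem s ''qa'' j \<and> mem s' ''qb'' j = mem s ''qb'' j"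
      "\<forall>j. q \<le> j \<and> j < reg s' ''t'' \<longrightarrow> mem s' ''qa'' j = x \<and> mem s' ''qb'' j < n"
      "\<forall>y<n. d < c x y \<and> el x y = l \<longrightarrow> (\<exists>j. q \<le> j \<and> j < reg s' ''t'' \<and> mem s' ''qb'' j = y)"
      unfolding I_def by blast
    have r0: "rem d = 0" using 4(3) d(3) by simp
    then have none: "{j \<in> S0. j < d} = {}" using finS unfolding rem_def by simp
    have all: "d < c x y" if yy: "y < n" "c x y \<noteq> 0" "el x y = l" for y
    proof -
      obtain k where k: "c x y = Suc k" using yy(2) by (cases "c x y") auto
      then have "k \<in> S0" using yy lL by (auto simp: S0_def FF_mem)
      then show ?thesis using none k by (auto simp: not_less)
    qed
    have fr: "reg s' ''x'' = x" "reg s' ''g'' = gg" "mem s' ''lev'' = lv" 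
      using 4(2) r lv(1) by (auto simp: frame_def)
    have el0: "rep (mem s') c (moved c el lv x l gg 0)"
    proof (rule rep_cong[OF d(4)])
      fix a b assume ab: "a < n" "b < n" "c a b \<noteq> 0"
      have "(d < c x z \<and> el x z = l) = (0 < c x z \<and> el x z = l)" if "z < n" for z using all[OF that] by auto
      from this[OF ab(1)] this[OF ab(2)] show "moved c el lv x l gg d a b = moved c el lv x l gg 0 a b"
        unfolding moved_def by presburger
    qed
    have tt: "t' + 2 + 3 \<le> t + 300 * K * (card (FF c el x l) + 1)"
    proof -
      have "300 * K * (r0 + 1) = r0 * (290 * K) + 10 * K * r0 + 300 * K" by (simp add: algebra_simps)
      then show ?thesis using d(2) K_ge2 r0 unfolding r0_def S0_def by linarith
    qed
    let ?sf = "s'\<lparr>mem := (mem s')(''lev'' := lv(x := gg))\<rparr>"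
    have tq: "reg s' ''t'' = q + r0" using d(5) r0 by simp
    have "Q (t' + 2 + 3) ?sf"
    proof (rule Q[OF tt])
      show "frame s ?sf (wr move) (wm move)" using 4(2) by (simp add: frame_def)
      show "rep (mem ?sf) c (moved c el lv x l gg 0)" by (rule rep_frame[OF el0]) simp_all
      show "reg ?sf ''t'' = q + card (FF c el x l)" using tq by (simp add: r0_def S0_def)
      show "\<forall>j<q. mem ?sf ''qa'' j = mem s ''qa'' j \<and> mem ?sf ''qb'' j = mem s ''qb'' j" using d(6) by simp
      show "\<forall>j. q \<le> j \<and> j < q + card (FF c el x l) \<longrightarrow> mem ?sf ''qa'' j = x \<and> mem ?sf ''qb'' j < n"
        using d(7) unfolding tq by (simp add: r0_def S0_def)
      show "\<forall>y<n. c x y \<noteq> 0 \<and> el x y = l \<longrightarrow> (\<exists>j. q \<le> j \<and> j < q + card (FF c el x l) \<and> mem ?sf ''qb'' j = y)"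
      proof (intro allI impI, elim conjE)
        fix y assume y: "y < n" "c x y \<noteq> 0" "el x y = l"
        then have "d < c x y" by (rule all)
        then show "\<exists>j. q \<le> j \<and> j < q + card (FF c el x l) \<and> mem ?sf ''qb'' j = y"
          using d(8) y unfolding tq by (simp add: r0_def S0_def)
      qed
    qed simp
    then show ?case by (simp add: fr numeral_eq_Suc)
  qed
qed

end

section \<open>Restoring the levels\<close>

definition up_e :: "nat \<Rightarrow> expr \<Rightarrow> expr" where
  "up_e N e = Const 4 *. e +. Const 1 +. Const 4 *. (e /. Const N)"

definition low_e :: "nat \<Rightarrow> expr \<Rightarrow> expr" where
  "low_e N e = Const 2 *. e +. e /. Const N"

definition root_e :: "expr \<Rightarrow> expr \<Rightarrow> expr" where
  "root_e x l = Load ''T'' (tbase x l +. Const 1)"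

definition check :: "nat \<Rightarrow> com" where
  "check N =
    (''l'' ::= Load ''lev'' (Reg ''x'') ;; ''a'' ::= Load ''tab'' (Reg ''l'' /. Reg ''R'') ;;
     ''d'' ::= root_e (Reg ''x'') (Reg ''l'') ;; ''f'' ::= Const 0 ;;
     Cond (up_e N (Reg ''a'') <. Reg ''d'')
       (''f'' ::= Const 1 ;; ''g'' ::= Reg ''l'' +. Const 1)
       (Cond (Reg ''l'')
         (''g'' ::= Reg ''l'' -. Const 1 ;; ''a'' ::= Load ''tab'' (Reg ''g'' /. Reg ''R'') ;;
          ''d'' ::= Reg ''d'' +. root_e (Reg ''x'') (Reg ''g'') ;;
          Cond (low_e N (Reg ''a'') <. Reg ''d'') Skip (''f'' ::= Const 1))
         Skip))"

text \<open>The head passes an entry only if both endpoints are stable; after a move the same entry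
  is examined again. Entries are not removed, because the color phase needs all of them.\<close>

definition phase1 :: "nat \<Rightarrow> com" where
  "phase1 N =
    (''h'' ::= Const 0 ;;
     While (Reg ''h'' <. Reg ''t'')
      (''x'' ::= Load ''qa'' (Reg ''h'') ;; check N ;;
       Cond (Reg ''f'') Skip (''x'' ::= Load ''qb'' (Reg ''h'') ;; check N) ;;
       Cond (Reg ''f'') move (''h'' ::= Reg ''h'' +. Const 1)))"

lemma writes_phase1 [simp]:
  "wr (check N) = {''l'', ''a'', ''d'', ''f'', ''g''}" "wm (check N) = {}"
  "wr (phase1 N) = {''h'', ''x'', ''l'', ''a'', ''d'', ''f'', ''g''} \<union> wr move" "wm (phase1 N) = wm move"
  by (auto simp: check_def phase1_def)

lemma time_thr [simp]: "expr_time (up_e N e) = 9 + 2 * expr_time e" "expr_time (low_e N e) = 5 + 2 * expr_time e"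
  by (simp_all add: up_e_def low_e_def)

context ctx begin

lemma ev_up [simp]: "expr_val w e s \<le> 2 * M \<Longrightarrow> expr_val w (up_e N e) s = 4 * expr_val w e s + 1 + 4 * (expr_val w e s div N)"
proof -
  assume a: "expr_val w e s \<le> 2 * M"
  define v where "v = expr_val w e s"
  define q where "q = v div N"
  have "q \<le> v" by (simp add: q_def)
  moreover have "100 * M < WW" "N < WW" using B_bounds WW_B(1,2) N1 by linarith+
  ultimately have le: "q \<le> v" "100 * M < WW" "N < WW" "v \<le> 2 * M" "4 \<le> M" using a B_bounds by (auto simp: v_def)
  have 1: "expr_val w (Const 4 *. e) s = 4 * v" using le by (simp add: v_def[symmetric])
  then have 2: "expr_val w (Const 4 *. e +. Const 1) s = 4 * v + 1" using le by (subst ev_Add) simp_all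
  have "expr_val w (e /. Const N) s = q" using le by (simp add: ev_Const v_def[symmetric] q_def[symmetric])
  then have "expr_val w (Const 4 *. (e /. Const N)) s = 4 * q" using le by (subst ev_Mul) simp_all
  then have "expr_val w (up_e N e) s = 4 * v + 1 + 4 * q" using 2 le unfolding up_e_def by (subst ev_Add) simp_all
  then show ?thesis by (simp add: v_def q_def)
qed

lemma ev_low [simp]: "expr_val w e s \<le> 2 * M \<Longrightarrow> expr_val w (low_e N e) s = 2 * expr_val w e s + expr_val w e s div N"
proof -
  assume a: "expr_val w e s \<le> 2 * M"
  define v where "v = expr_val w e s"
  define q where "q = v div N"
  have "q \<le> v" by (simp add: q_def)
  moreover have "100 * M < WW" "N < WW" using B_bounds WW_B(1,2) N1 by linarith+
  ultimately show ?thesis using a unfolding low_e_def v_def[symmetric]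
    by (simp add: ev_Const v_def[symmetric] q_def[symmetric])
qed

definition elm :: "(nat \<Rightarrow> nat) \<Rightarrow> nat \<Rightarrow> nat \<Rightarrow> nat" where
  "elm lv a b = min (lv a) (lv b)"

definition cedge :: "edge set \<Rightarrow> (nat \<Rightarrow> nat \<Rightarrow> nat) \<Rightarrow> bool" where
  "cedge E c \<longleftrightarrow> (\<forall>a<n. \<forall>b<n. c a b \<noteq> 0 \<longleftrightarrow> b \<in> adj E a)"

text \<open>In contrast to the final invariant \<open>full\<close>, levels and colors may violate their bounds.\<close>

definition base :: "edge set \<Rightarrow> (nat \<Rightarrow> nat \<Rightarrow> nat) \<Rightarrow> state \<Rightarrow> bool" where
  "base E c s \<longleftrightarrow> glob s \<and> wfE E \<and> okc c \<and> cedge E c \<and> (\<forall>v<n. mem s ''lev'' v \<le> L) \<and>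
     rep (mem s) c (elm (mem s ''lev''))"

text \<open>The tree of \<open>x\<close> for its own level counts the neighbors on that level or
  above, and its trees for smaller levels, by \<open>card_below\<close>, count the neighbors exactly
  there. So \<open>check\<close> obtains both degrees from two roots.\<close>

lemma card_up:
  assumes "wfE E" "okc c" "cedge E c" "x < n" "lv x \<le> L"
  shows "card (FF c (elm lv) x (lv x)) = dg E lv (lv x) x"
proof -
  have "{y. y < n \<and> c x y \<noteq> 0 \<and> elm lv x y = lv x} = {y \<in> adj E x. lv x \<le> lv y}"
    using assms(3,4) adj_lt[OF assms(1)] by (auto simp: cedge_def elm_def min_def)
  then show ?thesis using FF_card[OF assms(2,4,5), of "elm lv"] by (simp add: dg_def)
qed

lemma card_below:
  assumes "wfE E" "okc c" "cedge E c" "x < n" "lv x \<le> L" "g < lv x"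
  shows "card (FF c (elm lv) x g) + dg E lv (Suc g) x = dg E lv g x"
proof -
  have "{y. y < n \<and> c x y \<noteq> 0 \<and> elm lv x y = g} = {y \<in> adj E x. lv y = g}"
    using assms(3,4,6) adj_lt[OF assms(1)] by (auto simp: cedge_def elm_def min_def)
  then have 1: "card (FF c (elm lv) x g) = card {y \<in> adj E x. lv y = g}"
    using FF_card[OF assms(2,4), of g "elm lv"] assms(5,6) by simp
  have "{y \<in> adj E x. g \<le> lv y} = {y \<in> adj E x. lv y = g} \<union> {y \<in> adj E x. Suc g \<le> lv y}" by auto
  then show ?thesis unfolding 1 dg_def by (subst card_Un_disjoint[symmetric]) (use dg_fin[OF assms(1)] in auto)
qed

lemma card_all:
  assumes "wfE E" "okc c" "cedge E c" "x < n"
  shows "card (FF c el x (L + 1)) = card (adj E x)"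
proof -
  have "{y. y < n \<and> c x y \<noteq> 0} = adj E x"
    using assms(3,4) adj_lt[OF assms(1)] by (auto simp: cedge_def)
  then show ?thesis using cols_card[OF assms(2,4)] by simp
qed

lemma glob_tab: "glob s \<Longrightarrow> l \<le> L \<Longrightarrow> mem s ''tab'' (l div R) = Av (l div R)"
  using lev_div by (simp add: glob_def)

lemma ev_root [simp]:
  assumes "glob s" "expr_val w X s < n" "expr_val w l s \<le> L + 1"
  shows "expr_val w (root_e X l) s = mem s ''T'' (tb (expr_val w X s) (expr_val w l s) + 1)"
proof -
  have "tb (expr_val w X s) (expr_val w l s) + 1 < WW" using tb_lt[OF assms(2,3), of 1] BBn B_bounds by simp
  then show ?thesis using assms by (simp add: root_e_def)
qed

lemma time_root [simp]: "expr_time (root_e X l) = expr_time X + expr_time l + 8"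
  by (simp add: root_e_def)

lemma check_wp:
  assumes b: "base E c s" and x: "reg s ''x'' = x" "x < n" and lv: "lv = mem s ''lev''"
    and Q: "\<And>t' s'. t' \<le> t + 80 \<Longrightarrow> frame s s' {''l'', ''a'', ''d'', ''f'', ''g''} {} \<Longrightarrow> reg s' ''l'' = lv x \<Longrightarrow>
      (reg s' ''f'' = 0 \<and> stable E lv x \<or>
       reg s' ''f'' \<noteq> 0 \<and> (Ul (lv x) < dg E lv (lv x) x \<and> reg s' ''g'' = Suc (lv x) \<or>
         lv x = Suc (reg s' ''g'') \<and> dg E lv (reg s' ''g'') x \<le> Dl (reg s' ''g''))) \<Longrightarrow> Q t' s'"
  shows "wp w (check N) Q t s"
proof -
  have B: "glob s" "wfE E" "okc c" "cedge E c" "\<forall>v<n. lv v \<le> L" "rep (mem s) c (elm lv)"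
    using b unfolding base_def lv by auto
  define l where "l = lv x"
  have lL: "l \<le> L" using B(5) x l_def by simp
  have F: "forest (mem s ''T'') (FF c (elm lv))" using B(6) by (rule rep_forest)
  have T1: "mem s ''T'' (tb x l + 1) = dg E lv l x"
    using forest_root[OF F x(2), of l] lL card_up[OF B(2,3,4) x(2)] by (simp add: l_def)
  have d: "dg E lv j x < n" for j by (rule dg_lt[OF B(2)])
  have W: "l + 1 < WW" "n + n < WW" using lL L_WW B_bounds by linarith+
  have Avl: "Av j \<le> 2 * M" for j by (rule Av_le)
  have tab: "mem s ''tab'' (j div R) = Av (j div R)" if "j \<le> L" for j using glob_tab[OF B(1) that] .
  have r: "mem s ''lev'' x = l" by (simp add: l_def lv)
  have NW: "N < WW" using WW_B(2) N1 by linarith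
  have U: "Ul j = 4 * Av (j div R) + 1 + 4 * (Av (j div R) div N)" and D: "Dl j = 2 * Av (j div R) + Av (j div R) div N" for j
    by (simp_all add: Ul_def Dl_def)
  note g = globD[OF B(1)] B(1)
  show ?thesis
  proof (cases "Ul l < dg E lv l x")
    case True
    then show ?thesis
      using W lL x(2) Avl
      by (simp add: check_def x g r T1[simplified] tab U) (rule Q; simp add: frame_def l_def[symmetric] U)
  next
    case False
    show ?thesis
    proof (cases l)
      case 0
      show ?thesis
        using W(2) x(2) Avl False[unfolded 0] B_bounds
        by (simp add: check_def x g r[unfolded 0] T1[unfolded 0, simplified] tab[of 0, simplified] U)
          (rule Q; simp add: frame_def l_def[symmetric] U stable_def 0)
    next
      case (Suc j)
      have jL: "j \<le> L" "j < lv x" using lL Suc by (auto simp: l_def)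
      have l0: "0 < l" "l - Suc 0 = j" using Suc by auto
      have T2: "mem s ''T'' (tb x j + 1) = card (FF c (elm lv) x j)"
        using forest_root[OF F x(2), of j] jL by simp
      have d2: "dg E lv l x + card (FF c (elm lv) x j) = dg E lv j x"
        using card_below[OF B(2,3,4) x(2), of lv j] jL B(5) x(2) Suc by simp
      have W2: "dg E lv l x + card (FF c (elm lv) x j) < WW" using d2 d[of j] W by linarith
      show ?thesis
      proof (cases "Dl j < dg E lv j x")
        case True
        then show ?thesis
          using W lL x(2) Avl False jL l0 W2
          by (simp add: check_def x g r T1[simplified] T2[simplified] tab U D d2) (rule Q; simp add: frame_def l_def[symmetric] U D stable_def l0)
      next
        case f: False
        then show ?thesis
          using W lL x(2) Avl False jL l0 W2
          by (simp add: check_def x g r T1[simplified] T2[simplified] tab U D d2) (rule Q; simp add: frame_def l_def[symmetric] U D Suc)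
      qed
    qed
  qed
qed

lemma base_frame:
  assumes "frame s s' X A" "base E c s" "{''n'', ''M'', ''B'', ''L'', ''R'', ''J'', ''1''} \<inter> X = {}"
    "{''tab'', ''lev'', ''color'', ''at'', ''T''} \<inter> A = {}"
  shows "base E c s'"
proof -
  have "mem s' a = mem s a" if "a \<in> {''tab'', ''lev'', ''color'', ''at'', ''T''}" for a
    using assms(1,4) that by (auto simp: frame_def)
  then show ?thesis using assms(2) glob_frame[OF assms(1) _ assms(3)] assms(4) by (auto simp: base_def rep_def)
qed

section \<open>Potential and stability under a single move\<close>

definition step_viol :: "edge set \<Rightarrow> (nat \<Rightarrow> nat) \<Rightarrow> nat \<Rightarrow> nat \<Rightarrow> bool" where
  "step_viol E lv x g \<longleftrightarrow> Ul (lv x) < dg E lv (lv x) x \<and> g = Suc (lv x) \<or> lv x = Suc g \<and> dg E lv g x \<le> Dl g"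

text \<open>By \<open>Ul_L\<close> a node that must move up is below level \<open>L\<close>.\<close>

lemma step_viol_level: "step_viol E lv x g \<Longrightarrow> wfE E \<Longrightarrow> lv x \<le> L \<Longrightarrow> g \<le> L"
proof -
  assume a: "step_viol E lv x g" "wfE E" "lv x \<le> L"
  have "lv x \<noteq> L" if "Ul (lv x) < dg E lv (lv x) x"
    using that Ul_L dg_lt[OF a(2), of lv "lv x" x] by auto
  then show ?thesis using a(1,3) unfolding step_viol_def by auto
qed

text \<open>\<open>move\<close> appends one queue entry for each edge of \<open>x\<close> on level
  \<open>lv x\<close>. The potential pays one unit for each of them and one for the move.\<close>

lemma step_viol_pot:
  assumes "wfE E" "okc c" "cedge E c" "x < n" "lv x \<le> L" "step_viol E lv x g"
  shows "pot E (lv(x := g)) + card (FF c (elm lv) x (lv x)) + 1 \<le> pot E lv"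
  using assms(6) unfolding step_viol_def
proof (elim disjE conjE)
  assume a: "Ul (lv x) < dg E lv (lv x) x" "g = Suc (lv x)"
  have "lv x < L" using step_viol_level[OF assms(6,1,5)] a by simp
  then show ?thesis using pot_up[where lv = lv, OF assms(1,4) refl _ a(1)] card_up[where lv = lv, OF assms(1-5)] a(2) by simp
next
  assume a: "lv x = Suc g" "dg E lv g x \<le> Dl g"
  show ?thesis
    using pot_down[where lv = lv, OF assms(1,4) a] card_up[where lv = lv, OF assms(1-5)] dg_antimono[OF assms(1), of g "lv x" lv x] a(1) by simp
qed

lemma step_viol_cases: "step_viol E lv x g \<Longrightarrow> lv x \<le> Suc g"
  by (auto simp: step_viol_def)

text \<open>An edge of \<open>x\<close> on a smaller level than \<open>lv x\<close> ends in a node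
  on level at most \<open>g\<close>, since \<open>lv x \<le> Suc g\<close>; its minimum does not
  notice the move. So it is enough to treat the edges on level \<open>lv x\<close>.\<close>

lemma moved_elm:
  assumes "okc c" "lv x \<le> Suc g" "a < n" "b < n" "x < n" "c a b \<noteq> 0"
  shows "moved c (elm lv) lv x (lv x) g 0 a b = elm (lv(x := g)) a b"
proof -
  have ab: "a \<noteq> b" using okc_irrefl[OF assms(1)] assms(3,6) by metis
  have c: "c b a \<noteq> 0" using okc_sym[OF assms(1,3,4)] assms(6) by simp
  show ?thesis using assms(2,6) ab c by (auto simp: moved_def elm_def min_def)
qed

text \<open>Stability of \<open>v\<close> depends only on the neighbors on levels
  \<open>j \<le> lv v\<close> or above. If \<open>v\<close> is a neighbor of \<open>x\<close> below
  \<open>lv x\<close>, then \<open>lv v \<le> g\<close>, and \<open>x\<close> is counted for all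
  these \<open>j\<close> before and after the move.\<close>

lemma stable_other:
  assumes "wfE E" "v \<noteq> x" "\<not> (v \<in> adj E x \<and> lv x \<le> lv v)" "lv x \<le> Suc g"
  shows "stable E (lv(x := g)) v = stable E lv v"
proof -
  have "dg E (lv(x := g)) j v = dg E lv j v" if "j \<le> lv v" for j
    unfolding dg_def by (rule arg_cong[of _ _ card]) (use assms that adj_sym[of x E v] in auto)
  then show ?thesis using assms(2) by (simp add: stable_def)
qed

text \<open>Stored colors start at 1, and good ones are at most the larger degree plus the upper
  threshold minus 1. The 1 is available because a newly colored edge counts in both degrees that
  bound its color.\<close>

definition bad :: "edge set \<Rightarrow> (nat \<Rightarrow> nat) \<Rightarrow> (nat \<Rightarrow> nat \<Rightarrow> nat) \<Rightarrow> nat \<Rightarrow> nat \<Rightarrow> bool" where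
  "bad E lv c a b \<longleftrightarrow> max (card (adj E a)) (card (adj E b)) + Ul (min (lv a) (lv b)) < c a b + 1"

text \<open>The color phase reads the queue from its start, so during the level phase this is kept
  with \<open>h = 0\<close> for the whole queue, while \<open>unstq\<close> concerns only the
  entries from the head on.\<close>

definition badq :: "edge set \<Rightarrow> (nat \<Rightarrow> nat \<Rightarrow> nat) \<Rightarrow> nat \<Rightarrow> state \<Rightarrow> bool" where
  "badq E c h s \<longleftrightarrow> (\<forall>a<n. \<forall>b\<in>adj E a. bad E (mem s ''lev'') c a b \<longrightarrow>
     (\<exists>j. h \<le> j \<and> j < reg s ''t'' \<and> {mem s ''qa'' j, mem s ''qb'' j} = {a, b}))"

definition validq :: "state \<Rightarrow> bool" where
  "validq s \<longleftrightarrow> (\<forall>j<reg s ''t''. mem s ''qa'' j < n \<and> mem s ''qb'' j < n)"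

definition unstq :: "edge set \<Rightarrow> nat \<Rightarrow> state \<Rightarrow> bool" where
  "unstq E h s \<longleftrightarrow> (\<forall>v<n. \<not> stable E (mem s ''lev'') v \<longrightarrow>
     (\<exists>j. h \<le> j \<and> j < reg s ''t'' \<and> (mem s ''qa'' j = v \<or> mem s ''qb'' j = v)))"

lemma phase1_wp:
  assumes b: "base E c s" and v: "validq s" and u: "unstq E 0 s" and bq: "badq E c 0 s"
    and W: "reg s ''t'' + pot E (mem s ''lev'') < WW"
    and Q: "\<And>t' s'. base E c s' \<Longrightarrow> validq s' \<Longrightarrow> badq E c 0 s' \<Longrightarrow> (\<forall>v<n. stable E (mem s' ''lev'') v) \<Longrightarrow>
      frame s s' (wr (phase1 N)) (wm (phase1 N)) \<Longrightarrow>
      reg s' ''t'' + pot E (mem s' ''lev'') \<le> reg s ''t'' + pot E (mem s ''lev'') \<Longrightarrow>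
      t' + 600 * K * pot E (mem s' ''lev'') \<le> t + 10 + 600 * K * (pot E (mem s ''lev'') + reg s' ''t'') \<Longrightarrow> Q t' s'"
  shows "wp w (phase1 N) Q t s"
proof -
  define q0 where "q0 = reg s ''t''"
  define p0 where "p0 = pot E (mem s ''lev'')"
  \<comment> \<open>A move that appends \<open>k\<close> entries lowers the potential by at least
    \<open>k + 1\<close>, so queue length plus potential does not grow. Time \<open>600 * K\<close>
    is charged to every unit of lost potential and to every advance of the head.\<close>
  define I where "I = (\<lambda>t' (s'::state). base E c s' \<and> validq s' \<and> badq E c 0 s' \<and> unstq E (reg s' ''h'') s' \<and>
     reg s' ''h'' \<le> reg s' ''t'' \<and> reg s' ''t'' + pot E (mem s' ''lev'') \<le> q0 + p0 \<and>
     t' + 600 * K * pot E (mem s' ''lev'') \<le> t + 2 + 600 * K * (p0 + reg s' ''h''))"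
  show ?thesis
  proof (rule wp_frame, unfold phase1_def wp_Seq[of w "''h'' ::= _"] wp_Assign,
      rule wp_While[where I = I and Bd = "t + 2 + 600 * K * (p0 + (q0 + p0))"], goal_cases)
    case 1
    have "base E c (s\<lparr>reg := (reg s)(''h'' := 0)\<rparr>)" by (rule base_frame[OF _ b, of _ "{''h''}" "{}"]) (auto simp: frame_def)
    then show ?case using v u bq by (simp add: I_def validq_def unstq_def badq_def q0_def p0_def)
  next
    case (2 t' s')
    then have "t' \<le> t + 2 + 600 * K * (p0 + reg s' ''h'')" "reg s' ''h'' \<le> q0 + p0" by (auto simp: I_def)
    moreover from this have "600 * K * (p0 + reg s' ''h'') \<le> 600 * K * (p0 + (q0 + p0))" by (intro mult_le_mono2) simp
    ultimately show ?case by linarith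
  next
    case (3 t' s')
    define h where "h = reg s' ''h''"
    define lv where "lv = mem s' ''lev''"
    have I: "base E c s'" "validq s'" "badq E c 0 s'" "unstq E h s'" "h \<le> reg s' ''t''"
      "reg s' ''t'' + pot E lv \<le> q0 + p0" "t' + 600 * K * pot E lv \<le> t + 2 + 600 * K * (p0 + h)"
      using 3(1) unfolding I_def h_def lv_def by auto
    have ht: "h < reg s' ''t''" using 3(3) by (simp add: h_def)
    define qa where "qa = mem s' ''qa'' h"
    define qb where "qb = mem s' ''qb'' h"
    have qn: "qa < n" "qb < n" using I(2) ht by (auto simp: validq_def qa_def qb_def)
    have B: "wfE E" "okc c" "cedge E c" "\<forall>v<n. lv v \<le> L" "rep (mem s') c (elm lv)"
      using I(1) by (auto simp: base_def lv_def)
    have WB: "q0 + p0 < WW" using W by (simp add: q0_def p0_def)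
    have mv: "wp w move I t2 s2"
      if h2: "t2 \<le> t' + 190" "frame s' s2 {''x'', ''l'', ''a'', ''d'', ''f'', ''g''} {}" "reg s2 ''x'' = x" "x = qa \<or> x = qb"
         "reg s2 ''l'' = lv x" "step_viol E lv x (reg s2 ''g'')" for t2 s2 x
    proof -
      define g where "g = reg s2 ''g''"
      define k where "k = card (FF c (elm lv) x (lv x))"
      have x: "x < n" using h2(4) qn by auto
      have m2: "mem s2 = mem s'" using h2(2) by (auto simp: frame_def fun_eq_iff)
      have r2: "reg s2 ''t'' = reg s' ''t''" "reg s2 ''h'' = h" using h2(2) by (auto simp: frame_def h_def)
      have g2: "glob s2" using base_frame[OF h2(2) I(1)] by (auto simp: base_def)
      have viol: "step_viol E lv x g" using h2(6) by (simp add: g_def)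
      have gL: "g \<le> L" using step_viol_level[OF viol B(1)] B(4) x by simp
      have pd: "pot E (lv(x := g)) + k + 1 \<le> pot E lv"
        unfolding k_def by (rule step_viol_pot[OF B(1-3) x _ viol]) (use B(4) x in simp)
      have lg: "lv x \<le> Suc g" by (rule step_viol_cases[OF viol])
      show ?thesis
      proof (rule move_wp[where x = x and l = "lv x" and gg = g and q = "reg s' ''t''" and c = c and el = "elm lv" and lv = lv], goal_cases)
        case (15 t3 s3)
        note A = 15
        have t3: "reg s3 ''t'' = reg s' ''t'' + k" using A(5) by (simp add: k_def)
        have h3: "reg s3 ''h'' = h" using A(2) r2 by (simp add: frame_def)
        have "rep (mem s3) c (elm (lv(x := g)))"
          by (rule rep_cong[OF A(4)], rule moved_elm[where lv = lv and x = x and g = g, OF B(2) lg _ _ x]) auto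
        moreover have "glob s3" by (rule glob_frame[OF A(2) g2]) auto
        ultimately have b3: "base E c s3" using B gL A(3) by (auto simp: base_def)
        have old: "mem s3 ''qa'' j = mem s' ''qa'' j" "mem s3 ''qb'' j = mem s' ''qb'' j" if "j < reg s' ''t''" for j
          using A(6) that m2 by auto
        have v3: "validq s3" unfolding validq_def t3
        proof (intro allI impI)
          fix j assume j: "j < reg s' ''t'' + k"
          show "mem s3 ''qa'' j < n \<and> mem s3 ''qb'' j < n"
          proof (cases "j < reg s' ''t''")
            case True
            then show ?thesis using old I(2) by (simp add: validq_def)
          next
            case False
            then show ?thesis using A(7) j x by (simp add: k_def)
          qed
        qed
        have new: "\<exists>j. reg s' ''t'' \<le> j \<and> j < reg s' ''t'' + k \<and> mem s3 ''qa'' j = x \<and> mem s3 ''qb'' j = y"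
          if y: "y \<in> adj E x" "lv x \<le> lv y" for y
        proof -
          have "y < n" using adj_lt[OF B(1) y(1)] by simp
          moreover have "c x y \<noteq> 0 \<and> elm lv x y = lv x" using B(3) y x \<open>y < n\<close> by (auto simp: cedge_def elm_def)
          ultimately obtain j where "reg s' ''t'' \<le> j" "j < reg s' ''t'' + k" "mem s3 ''qb'' j = y" using A(8) by (auto simp: k_def)
          moreover from this have "mem s3 ''qa'' j = x" using A(7) by (simp add: k_def)
          ultimately show ?thesis by blast
        qed
        \<comment> \<open>Only \<open>x\<close> and its neighbors on level \<open>lv x\<close> or
          above can become unstable. \<open>x\<close> is an endpoint of the entry at the head, which
          has not advanced; the neighbors are endpoints of the appended entries.\<close>
        have u3: "unstq E h s3" unfolding unstq_def t3 A(3)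
        proof (intro allI impI)
          fix v assume vv: "v < n" "\<not> stable E (lv(x := g)) v"
          consider "v = x" | "v \<in> adj E x \<and> lv x \<le> lv v" | "v \<noteq> x" "\<not> (v \<in> adj E x \<and> lv x \<le> lv v)" by blast
          then show "\<exists>j. h \<le> j \<and> j < reg s' ''t'' + k \<and> (mem s3 ''qa'' j = v \<or> mem s3 ''qb'' j = v)"
          proof cases
            case 1
            then show ?thesis using h2(4) ht old[OF ht] by (intro exI[of _ h]) (auto simp: qa_def qb_def)
          next
            case 2
            then obtain j where "reg s' ''t'' \<le> j" "j < reg s' ''t'' + k" "mem s3 ''qb'' j = v" using new[of v] by auto
            then show ?thesis using I(5) by (intro exI[of _ j]) auto
          next
            case 3
            then have "\<not> stable E lv v" using stable_other[where lv = lv and x = x and g = g, OF B(1) 3 lg] vv by simp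
            then obtain j where "h \<le> j" "j < reg s' ''t''" "mem s' ''qa'' j = v \<or> mem s' ''qb'' j = v"
              using I(4) vv(1) unfolding unstq_def lv_def by blast
            then show ?thesis using old by (intro exI[of _ j]) auto
          qed
        qed
        \<comment> \<open>A move changes no degree and no color, so an edge can become bad only if
          its level changes, and then it has been appended.\<close>
        have bq3: "badq E c 0 s3" unfolding badq_def t3 A(3)
        proof (intro allI impI ballI)
          fix a d assume ad: "a < n" "d \<in> adj E a" "bad E (lv(x := g)) c a d"
          consider "a = x" "lv x \<le> lv d" | "d = x" "lv x \<le> lv a" | "\<not> (a = x \<and> lv x \<le> lv d)" "\<not> (d = x \<and> lv x \<le> lv a)" by blast
          then show "\<exists>j. 0 \<le> j \<and> j < reg s' ''t'' + k \<and> {mem s3 ''qa'' j, mem s3 ''qb'' j} = {a, d}"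
          proof cases
            case 1
            then show ?thesis using new[of d] ad by auto
          next
            case 2
            then show ?thesis using new[of a] ad adj_sym[of d E a] by (auto simp: insert_commute)
          next
            case 3
            have "a \<noteq> d" using adj_lt[OF B(1) ad(2)] by simp
            then have "min ((lv(x := g)) a) ((lv(x := g)) d) = min (lv a) (lv d)" using 3 lg by (auto simp: min_def)
            then have "bad E lv c a d" using ad(3) by (simp add: bad_def)
            then obtain j where "j < reg s' ''t''" "{mem s' ''qa'' j, mem s' ''qb'' j} = {a, d}"
              using I(3) ad unfolding badq_def lv_def by blast
            then show ?thesis using old by (intro exI[of _ j]) auto
          qed
        qed
        have "t3 + 600 * K * pot E (lv(x := g)) \<le> t + 2 + 600 * K * (p0 + h)"
        proof -
          have "600 * K * (pot E (lv(x := g)) + (k + 1)) \<le> 600 * K * pot E lv" using pd by (intro mult_le_mono2) simp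
          moreover have "600 * K * (pot E (lv(x := g)) + (k + 1)) = 600 * K * pot E (lv(x := g)) + 300 * K * (k + 1) + 300 * (K * (k + 1))"
            by (simp add: algebra_simps)
          moreover have "K * 1 \<le> K * (k + 1)" by (rule mult_le_mono2) simp
          moreover have "t3 \<le> t2 + 300 * K * (k + 1)" using A(1) by (simp add: k_def)
          ultimately show ?thesis using I(7) h2(1) K_ge2 by linarith
        qed
        then show ?case unfolding I_def
          using b3 v3 u3 bq3 t3 h3 A(3) I(5,6) pd by simp
      qed (use g2 h2(3,5) r2 x B gL pd I(6) WB in \<open>auto simp: g_def m2 elm_def min.commute lv_def k_def\<close>)
    qed
    have nomv: "I (t2 + 4) (s2\<lparr>reg := (reg s2)(''h'' := Suc h)\<rparr>)"
      if h2: "t2 \<le> t' + 190" "frame s' s2 {''x'', ''l'', ''a'', ''d'', ''f'', ''g''} {}"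
         "stable E lv qa" "stable E lv qb" for t2 s2
    proof -
      have m2: "mem s2 = mem s'" using h2(2) by (auto simp: frame_def fun_eq_iff)
      have r2: "reg s2 ''t'' = reg s' ''t''" using h2(2) by (auto simp: frame_def)
      let ?s = "s2\<lparr>reg := (reg s2)(''h'' := Suc h)\<rparr>"
      have "base E c s2" by (rule base_frame[OF h2(2) I(1)]) auto
      then have "base E c ?s" by (rule base_frame[rotated, of _ _ _ "{''h''}" "{}"]) (auto simp: frame_def)
      moreover have "unstq E (Suc h) ?s" unfolding unstq_def
      proof (intro allI impI)
        fix v assume vv: "v < n" "\<not> stable E (mem ?s ''lev'') v"
        then have ns: "\<not> stable E lv v" by (simp add: m2 lv_def)
        then obtain j where j: "h \<le> j" "j < reg s' ''t''" "mem s' ''qa'' j = v \<or> mem s' ''qb'' j = v"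
          using I(4) vv(1) unfolding unstq_def lv_def by blast
        have "j \<noteq> h" using j(3) h2(3,4) ns unfolding qa_def qb_def by auto
        then show "\<exists>j. Suc h \<le> j \<and> j < reg ?s ''t'' \<and> (mem ?s ''qa'' j = v \<or> mem ?s ''qb'' j = v)"
          using j by (intro exI[of _ j]) (auto simp: m2 r2)
      qed
      moreover have "t2 + 4 + 600 * K * pot E lv \<le> t + 2 + 600 * K * (p0 + Suc h)"
      proof -
        have "600 * K * (p0 + Suc h) = 600 * K * (p0 + h) + 600 * K" by (simp add: algebra_simps)
        then show ?thesis using I(7) h2(1) K_ge2 by linarith
      qed
      ultimately show ?thesis unfolding I_def
        using I ht by (simp add: m2 r2 validq_def badq_def lv_def[symmetric])
    qed
    have hW: "Suc h < WW" using ht I(6) WB by linarith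
    have fin: "wp w (Cond (Reg ''f'') move (''h'' ::= Reg ''h'' +. Const 1)) I t2 s2"
      if h2: "t2 \<le> t' + 185" "frame s' s2 {''x'', ''l'', ''a'', ''d'', ''f'', ''g''} {}" "reg s2 ''x'' = x" "x = qa \<or> x = qb"
         "reg s2 ''l'' = lv x" "reg s2 ''f'' \<noteq> 0 \<and> step_viol E lv x (reg s2 ''g'') \<or> reg s2 ''f'' = 0 \<and> stable E lv qa \<and> stable E lv qb" for t2 s2 x
    proof -
      have "reg s2 ''h'' = h" using h2(2) by (simp add: frame_def h_def)
      then show ?thesis
        using h2(6) mv[of "t2 + 2" s2 x] nomv[of "t2 + 2" s2] h2(1-5) hW by (auto simp: numeral_eq_Suc)
    qed
    let ?s1 = "s'\<lparr>reg := (reg s')(''x'' := qa)\<rparr>"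
    have b1: "base E c ?s1" by (rule base_frame[OF _ I(1), of _ "{''x''}" "{}"]) (auto simp: frame_def)
    have "wp w (check N) (wp w (Cond (Reg ''f'') Skip (''x'' ::= Load ''qb'' (Reg ''h'') ;; check N) ;;
       Cond (Reg ''f'') move (''h'' ::= Reg ''h'' +. Const 1)) I) (t' + 7) ?s1"
    proof (rule check_wp[OF b1, where x = qa and lv = lv], goal_cases)
      case (4 t2 s2)
      have f2: "frame s' s2 {''x'', ''l'', ''a'', ''d'', ''f'', ''g''} {}" using 4(2) by (auto simp: frame_def)
      have x2: "reg s2 ''x'' = qa" using 4(2) by (simp add: frame_def)
      show ?case
      proof (cases "reg s2 ''f'' = 0")
        case False
        then have f: "expr_val w (Reg ''f'') s2 \<noteq> 0" by simp
        show ?thesis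
          unfolding wp_Seq wp_Cond[of w "Reg ''f''" Skip] if_P[OF f] wp_Skip
          by (rule fin[where x = qa]) (use 4 f2 x2 False in \<open>auto simp: step_viol_def\<close>)
      next
        case True
        then have st: "stable E lv qa" using 4(4) by simp
        let ?s3 = "s2\<lparr>reg := (reg s2)(''x'' := qb)\<rparr>"
        have b3: "base E c ?s3" by (rule base_frame[OF _ I(1), of _ "{''x'', ''l'', ''a'', ''d'', ''f'', ''g''}" "{}"]) (use f2 in \<open>auto simp: frame_def\<close>)
        have "wp w (check N) (wp w (Cond (Reg ''f'') move (''h'' ::= Reg ''h'' +. Const 1)) I) (t2 + 5) ?s3"
        proof (rule check_wp[OF b3, where x = qb and lv = lv], goal_cases)
          case (4 t4 s4)
          have f4: "frame s' s4 {''x'', ''l'', ''a'', ''d'', ''f'', ''g''} {}" using 4(2) f2 by (auto simp: frame_def)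
          have x4: "reg s4 ''x'' = qb" using 4(2) by (simp add: frame_def)
          show ?case
            by (rule fin[where x = qb]) (use 4 f4 x4 st \<open>t2 \<le> t' + 7 + 80\<close> in \<open>auto simp: step_viol_def\<close>)
        qed (use f2 qn in \<open>auto simp: lv_def frame_def\<close>)
        moreover have "mem s2 ''qb'' (reg s2 ''h'') = qb" using f2 by (simp add: frame_def qb_def h_def)
        ultimately show ?thesis using True
          by (simp del: wp_Cond add: wp_Cond[of w "Reg ''f''" Skip] numeral_eq_Suc)
      qed
    qed (use qn in \<open>auto simp: lv_def\<close>)
    then show ?case by (simp add: qa_def h_def numeral_eq_Suc)
  next
    case (4 t' s')
    have I: "base E c s'" "validq s'" "badq E c 0 s'" "unstq E (reg s' ''h'') s'" "reg s' ''h'' \<le> reg s' ''t''"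
      "reg s' ''t'' + pot E (mem s' ''lev'') \<le> q0 + p0" "t' + 600 * K * pot E (mem s' ''lev'') \<le> t + 2 + 600 * K * (p0 + reg s' ''h'')"
      using 4(1) unfolding I_def by auto
    have h: "reg s' ''h'' = reg s' ''t''" using 4(3) I(5) by auto
    have "\<forall>v<n. stable E (mem s' ''lev'') v" using I(4) unfolding unstq_def h by auto
    then show ?case using I h by (intro impI Q) (auto simp: q0_def p0_def phase1_def)
  qed
qed

end

section \<open>Restoring the colors\<close>

text \<open>The edges from \<open>x\<close> to nodes on its level or above are exactly those in its
  tree for its own level, so one tree at \<open>x\<close> and the full tree at \<open>y\<close>
  describe what is to be avoided. The possible conflict with a lower node is then found by a single
  access to \<open>at\<close>.\<close>

definition chain :: com where
  "chain =
    (''f'' ::= Const 1 ;;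
     While (Reg ''f'')
      (''l'' ::= Load ''lev'' (Reg ''x'') ;;
       ''p'' ::= tbase (Reg ''x'') (Reg ''l'') ;; ''q'' ::= tbase (Reg ''y'') all_e ;; find_free ;;
       ''e'' ::= Load ''at'' (baddr (Reg ''x'') (Reg ''k'')) ;;
       Cond (Reg ''e'')
        (''o'' ::= Reg ''y'' ;; ''y'' ::= Reg ''e'' -. Const 1 ;; ''l'' ::= Load ''lev'' (Reg ''y'') ;; unset_color ;;
         ''e'' ::= Reg ''y'' ;; ''y'' ::= Reg ''o'' ;; ''l'' ::= Load ''lev'' (Reg ''x'') ;; set_color ;;
         ''y'' ::= Reg ''x'' ;; ''x'' ::= Reg ''e'')
        (set_color ;; ''f'' ::= Const 0)))"

text \<open>A queue entry is only a suspicion: the pair may have been deleted, which leaves color 0,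
  or its color may satisfy the bound. The endpoints are exchanged if necessary, because
  \<open>chain\<close> expects the lower one in \<open>x\<close>.\<close>

definition fix_color :: "nat \<Rightarrow> com" where
  "fix_color N =
    (''k'' ::= Load ''color'' (caddr (Reg ''x'') (Reg ''y'')) ;;
     Cond (Reg ''k'')
      (''l'' ::= Load ''lev'' (Reg ''x'') ;; ''m'' ::= Load ''lev'' (Reg ''y'') ;;
       Cond (Reg ''m'' <. Reg ''l'')
        (''l'' ::= Reg ''m'' ;; ''e'' ::= Reg ''x'' ;; ''x'' ::= Reg ''y'' ;; ''y'' ::= Reg ''e'') Skip ;;
       ''d'' ::= root_e (Reg ''x'') all_e ;; ''e'' ::= root_e (Reg ''y'') all_e ;;
       Cond (Reg ''d'' <. Reg ''e'') (''d'' ::= Reg ''e'') Skip ;;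
       ''a'' ::= Load ''tab'' (Reg ''l'' /. Reg ''R'') ;;
       Cond (Reg ''d'' +. up_e N (Reg ''a'') <. Reg ''k'' +. Const 1)
        (''k'' ::= Reg ''k'' -. Const 1 ;; unset_color ;; chain) Skip)
      Skip)"

definition phase2 :: "nat \<Rightarrow> com" where
  "phase2 N =
    (''h'' ::= Const 0 ;;
     While (Reg ''h'' <. Reg ''t'')
      (''x'' ::= Load ''qa'' (Reg ''h'') ;; ''y'' ::= Load ''qb'' (Reg ''h'') ;; fix_color N ;;
       ''h'' ::= Reg ''h'' +. Const 1))"

lemma writes_chain [simp]:
  "wr chain = {''f'', ''l'', ''p'', ''q'', ''i'', ''z'', ''k'', ''e'', ''o'', ''y'', ''x''}"
  "wm chain = {''color'', ''at'', ''T''}"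
  "wr (fix_color N) = {''f'', ''l'', ''p'', ''q'', ''i'', ''z'', ''k'', ''e'', ''o'', ''y'', ''x'', ''m'', ''d'', ''a''}"
  "wm (fix_color N) = {''color'', ''at'', ''T''}"
  "wr (phase2 N) = {''f'', ''l'', ''p'', ''q'', ''i'', ''z'', ''k'', ''e'', ''o'', ''y'', ''x'', ''m'', ''d'', ''a'', ''h''}"
  "wm (phase2 N) = {''color'', ''at'', ''T''}"
  by (auto simp: chain_def fix_color_def phase2_def)

context ctx begin

section \<open>Changed edges and the chain of recolorings\<close>

definition Dset :: "(nat \<Rightarrow> nat \<Rightarrow> nat) \<Rightarrow> (nat \<Rightarrow> nat \<Rightarrow> nat) \<Rightarrow> nat set set" where
  "Dset c c' = {e. \<exists>a<n. \<exists>b<n. e = {a, b} \<and> c a b \<noteq> c' a b}"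

lemma Dset_finite: "finite (Dset c c')"
  by (rule finite_subset[of _ "Pow {..<n}"]) (auto simp: Dset_def)

lemma Dset_upd2: "card (Dset c0 (upd2 c x y v)) \<le> card (Dset c0 c) + 1"
proof -
  have "Dset c0 (upd2 c x y v) \<subseteq> insert {x, y} (Dset c0 c)"
  proof
    fix e assume "e \<in> Dset c0 (upd2 c x y v)"
    then obtain a b where ab: "a < n" "b < n" "e = {a, b}" "c0 a b \<noteq> upd2 c x y v a b" by (auto simp: Dset_def)
    show "e \<in> insert {x, y} (Dset c0 c)"
    proof (cases "upd2 c x y v a b = c a b")
      case True
      then show ?thesis using ab by (auto simp: Dset_def)
    next
      case False
      then have "{a, b} = {x, y}" by (auto simp: upd2_def split: if_splits)
      then show ?thesis using ab by simp
    qed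
  qed
  then have "card (Dset c0 (upd2 c x y v)) \<le> card (insert {x, y} (Dset c0 c))" by (intro card_mono) (simp_all add: Dset_finite)
  also have "\<dots> \<le> card (Dset c0 c) + 1" by (simp add: card_insert_if Dset_finite)
  finally show ?thesis .
qed

lemma Dset_self: "Dset c c = {}" by (simp add: Dset_def)

text \<open>The state inside a chain of recolorings: the edge from \<open>x\<close> up to \<open>y\<close> is the only uncolored one.\<close>

definition hbase :: "edge set \<Rightarrow> (nat \<Rightarrow> nat \<Rightarrow> nat) \<Rightarrow> (nat \<Rightarrow> nat) \<Rightarrow> nat \<Rightarrow> nat \<Rightarrow> state \<Rightarrow> bool" where
  "hbase E c lv x y s \<longleftrightarrow> glob s \<and> okc c \<and>
     (\<forall>a<n. \<forall>b<n. c a b \<noteq> 0 \<longleftrightarrow> b \<in> adj E a \<and> {a, b} \<noteq> {x, y}) \<and>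
     rep (mem s) c (elm lv) \<and> y \<in> adj E x \<and> lv x \<le> lv y \<and> mem s ''lev'' = lv"

text \<open>The uncolored edge counts in the degrees but contributes no color, hence the strict
  inequalities.\<close>

lemma hole_count:
  assumes wf: "wfE E" and ok: "okc c" and lv: "lv x \<le> L"
    and hc: "\<forall>a<n. \<forall>b<n. c a b \<noteq> 0 \<longleftrightarrow> b \<in> adj E a \<and> {a, b} \<noteq> {x, y}" and y: "y \<in> adj E x" "lv x \<le> lv y"
  shows "card (FF c (elm lv) x (lv x)) < dg E lv (lv x) x" "card (FF c (elm lv) y (L + 1)) < card (adj E y)"
proof -
  have xy: "x < n" "y < n" "x \<noteq> y" using adj_lt[OF wf y(1)] by auto
  have "{b. b < n \<and> c x b \<noteq> 0 \<and> elm lv x b = lv x} \<subseteq> {b \<in> adj E x. lv x \<le> lv b}"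
    "y \<in> {b \<in> adj E x. lv x \<le> lv b}" "y \<notin> {b. b < n \<and> c x b \<noteq> 0 \<and> elm lv x b = lv x}"
    using hc y xy by (auto simp: elm_def min_def split: if_splits)
  then have "{b. b < n \<and> c x b \<noteq> 0 \<and> elm lv x b = lv x} \<subset> {b \<in> adj E x. lv x \<le> lv b}" by blast
  then show "card (FF c (elm lv) x (lv x)) < dg E lv (lv x) x"
    unfolding FF_card[OF ok xy(1) lv] dg_def by (intro psubset_card_mono dg_fin wf)
  have "{b. b < n \<and> c y b \<noteq> 0} \<subseteq> adj E y" "x \<in> adj E y" "x \<notin> {b. b < n \<and> c y b \<noteq> 0}"
    using hc y xy adj_sym by (auto simp: insert_commute)
  then have "{b. b < n \<and> c y b \<noteq> 0} \<subset> adj E y" by blast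
  then show "card (FF c (elm lv) y (L + 1)) < card (adj E y)"
    unfolding cols_card[OF ok xy(2)] by (intro psubset_card_mono adj_finite wf)
qed

lemma bad_sym: "okc c \<Longrightarrow> a < n \<Longrightarrow> b < n \<Longrightarrow> bad E lv c a b = bad E lv c b a"
  by (simp add: bad_def max.commute min.commute okc_sym[of c a b])

text \<open>The two strict inequalities and the upper half of stability give
  \<open>k + 2 \<le> card (adj E y) + Ul (lv x)\<close>, exactly what the stored color
  \<open>k + 1\<close> needs.\<close>

lemma not_bad_new:
  assumes "k \<le> p + q" "p < dg E lv (lv x) x" "q < card (adj E y)" "stable E lv x" "lv x \<le> lv y" "c x y = Suc k"
  shows "\<not> bad E lv c x y"
  using assms by (auto simp: bad_def stable_def min_def)

text \<open>Bad edges are tolerated at the hole \<open>h\<close>, which is about to be colored, and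
  where \<open>P\<close> holds, which stands for the unread part of the queue. With
  \<open>h = {}\<close> no edge is exempt as a hole.\<close>

definition goodx :: "edge set \<Rightarrow> (nat \<Rightarrow> nat) \<Rightarrow> (nat \<Rightarrow> nat \<Rightarrow> nat) \<Rightarrow> nat set \<Rightarrow> (nat \<Rightarrow> nat \<Rightarrow> bool) \<Rightarrow> bool" where
  "goodx E lv c h P \<longleftrightarrow> (\<forall>a<n. \<forall>b\<in>adj E a. bad E lv c a b \<longrightarrow> {a, b} = h \<or> P a b)"

lemma goodx_set:
  assumes wf: "wfE E" and g: "goodx E lv c {x, y} P" and c: "\<And>a b. a < n \<Longrightarrow> b < n \<Longrightarrow> {a, b} \<noteq> h \<Longrightarrow> {a, b} \<noteq> {x, y} \<Longrightarrow> c' a b = c a b"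
    and nb: "\<not> bad E lv c' x y" and ok: "okc c'" and xy: "x < n" "y < n"
  shows "goodx E lv c' h P"
  unfolding goodx_def
proof (intro allI impI ballI)
  fix a b assume ab: "a < n" "b \<in> adj E a" "bad E lv c' a b"
  have bn: "b < n" using adj_lt[OF wf ab(2)] by simp
  show "{a, b} = h \<or> P a b"
  proof (cases "{a, b} = h")
    case False
    have "{a, b} \<noteq> {x, y}"
    proof
      assume "{a, b} = {x, y}"
      then have "a = x \<and> b = y \<or> a = y \<and> b = x" by (auto simp: doubleton_eq_iff)
      then show False using nb ab(3) bad_sym[OF ok xy] by auto
    qed
    moreover from this have "bad E lv c a b" using ab(3) c[OF ab(1) bn False] by (simp add: bad_def)
    ultimately show ?thesis using g ab unfolding goodx_def by blast
  qed simp
qed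

lemma chain_wp:
  assumes wf: "wfE E" and st: "\<forall>v<n. stable E lv v" and lvL: "\<forall>v<n. lv v \<le> L"
    and h: "hbase E c lv x y s" and x: "reg s ''x'' = x" "reg s ''y'' = y"
    and gd: "goodx E lv c {x, y} P"
    and Q: "\<And>t' s' c'. t' \<le> t + 550 * K * (L + 1) + 10 \<Longrightarrow> frame s s' (wr chain) (wm chain) \<Longrightarrow> base E c' s' \<Longrightarrow>
      goodx E lv c' {} P \<Longrightarrow> card (Dset c0 c') \<le> card (Dset c0 c) + 2 * (L + 1) \<Longrightarrow> Q t' s'"
  shows "wp w chain Q t s"
proof -
  \<comment> \<open>The hole descends strictly, so \<open>lv x' + 1\<close> bounds the number of
    remaining rounds. A round uncolors one edge and colors another, which accounts for the factor
    2.\<close>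
  define I where "I = (\<lambda>t' (s'::state). (reg s' ''f'' \<noteq> 0 \<and> (\<exists>c' x' y'. hbase E c' lv x' y' s' \<and> reg s' ''x'' = x' \<and> reg s' ''y'' = y' \<and>
       goodx E lv c' {x', y'} P \<and> t' + 550 * K * (lv x' + 1) \<le> t + 2 + 550 * K * (L + 1) \<and>
       card (Dset c0 c') + 2 * (lv x' + 1) \<le> card (Dset c0 c) + 2 * (L + 1))) \<or>
     (reg s' ''f'' = 0 \<and> (\<exists>c'. base E c' s' \<and> goodx E lv c' {} P \<and> t' \<le> t + 2 + 550 * K * (L + 1) \<and>
       card (Dset c0 c') \<le> card (Dset c0 c) + 2 * (L + 1))))"
  show ?thesis
  proof (rule wp_frame, unfold chain_def wp_Seq[of w "''f'' ::= _"] wp_Assign,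
      rule wp_While[where I = I and Bd = "t + 2 + 550 * K * (L + 1)"], goal_cases)
    case 1
    have "hbase E c lv x y (s\<lparr>reg := (reg s)(''f'' := 1)\<rparr>)" using h by (simp add: hbase_def)
    moreover have lx: "lv x \<le> L" using h adj_lt[OF wf] lvL by (auto simp: hbase_def)
    moreover have "550 * K * (lv x + 1) \<le> 550 * K * (L + 1)" using lx by (intro mult_le_mono2) simp
    ultimately show ?case using x gd unfolding I_def by (intro disjI1 conjI exI[of _ c] exI[of _ x] exI[of _ y]) simp_all
  next
    case (2 t' s')
    then show ?case by (auto simp: I_def)
  next
    case (3 t' s')
    then have f: "reg s' ''f'' \<noteq> 0" by simp
    obtain c' x' y' where H: "hbase E c' lv x' y' s'" "reg s' ''x'' = x'" "reg s' ''y'' = y'"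
       "goodx E lv c' {x', y'} P" "t' + 550 * K * (lv x' + 1) \<le> t + 2 + 550 * K * (L + 1)"
       "card (Dset c0 c') + 2 * (lv x' + 1) \<le> card (Dset c0 c) + 2 * (L + 1)"
      using 3(1) f unfolding I_def by (elim disjE conjE exE) (rule that, assumption+, simp)
    have hb: "glob s'" "okc c'" "\<forall>a<n. \<forall>b<n. c' a b \<noteq> 0 \<longleftrightarrow> b \<in> adj E a \<and> {a, b} \<noteq> {x', y'}"
      "rep (mem s') c' (elm lv)" "y' \<in> adj E x'" "lv x' \<le> lv y'" "mem s' ''lev'' = lv"
      using H(1) unfolding hbase_def by auto
    have xy: "x' < n" "y' < n" "x' \<noteq> y'" using adj_lt[OF wf hb(5)] by auto
    have lx: "lv x' \<le> L" "lv y' \<le> L" using lvL xy by auto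
    note cnt = hole_count[OF wf hb(2) lx(1) hb(3,5,6)]
    \<comment> \<open>Both counts are below \<open>n\<close> and \<open>2 * n \<le> M\<close>, so
      the search cannot run out of colors.\<close>
    have cM: "card (FF c' (elm lv) x' (lv x')) + card (FF c' (elm lv) y' (L + 1)) < M"
      using cnt dg_lt[OF wf, of lv "lv x'" x'] adj_card[OF wf, of y'] B_bounds(1) by linarith
    let ?s1 = "s'\<lparr>reg := (reg s')(''l'' := lv x', ''p'' := tb x' (lv x'), ''q'' := tb y' (L + 1))\<rparr>"
    have c0xy: "c' x' y' = 0" using hb(3) xy by auto
    let ?rest = "(''e'' ::= Load ''at'' (baddr (Reg ''x'') (Reg ''k'')) ;;
       Cond (Reg ''e'')
        (''o'' ::= Reg ''y'' ;; ''y'' ::= Reg ''e'' -. Const 1 ;; ''l'' ::= Load ''lev'' (Reg ''y'') ;; unset_color ;;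
         ''e'' ::= Reg ''y'' ;; ''y'' ::= Reg ''o'' ;; ''l'' ::= Load ''lev'' (Reg ''x'') ;; set_color ;;
         ''y'' ::= Reg ''x'' ;; ''x'' ::= Reg ''e'')
        (set_color ;; ''f'' ::= Const 0))"
    have "wp w find_free (wp w ?rest I) (t' + 23) ?s1"
    proof (rule find_free_wp[where x = x' and l = "lv x'" and y = y' and m = "L + 1" and F = "FF c' (elm lv)"], goal_cases)
      case (10 t2 s2 k)
      have m2: "mem s2 = mem s'" using 10(2) by (auto simp: frame_def fun_eq_iff)
      have r2: "reg s2 ''x'' = x'" "reg s2 ''y'' = y'" "reg s2 ''l'' = lv x'" "reg s2 ''f'' = reg s' ''f''" using 10(2) H(2,3) by (auto simp: frame_def)
      have g2: "glob s2" using hb(1) by (intro glob_frame[OF 10(2)]) auto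
      have kB: "k < B" using 10(4) B_bounds by linarith
      have kc: "k \<notin> cols c' y'" using 10(6) by (simp add: FF_def)
      define e where "e = mem s' ''at'' (x' * B + k)"
      have eR: "expr_val w (Load ''at'' (baddr (Reg ''x'') (Reg ''k''))) s2 = e"
        using g2 r2 10(3) kB xy m2 by (simp add: e_def)
      have elxy: "elm lv x' y' = lv x'" "elm lv y' x' = lv x'" using hb(6) by (auto simp: elm_def min_def)
      have lm: "550 * K * (lv x' + 1) = 550 * K * lv x' + 550 * K" by (simp add: algebra_simps)
      show ?case
      proof (cases e)
        case 0
        have kx: "k \<notin> cols c' x'"
          using rep_at[OF hb(4) xy(1) 10(4)] 0 by (auto simp: cols_def e_def)
        let ?s3 = "s2\<lparr>reg := (reg s2)(''e'' := 0)\<rparr>"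
        have "wp w set_color (wp w (''f'' ::= Const 0) I) (t2 + 9) ?s3"
        proof (rule set_color_wp[where x = x' and y = y' and k = k and l = "lv x'" and c = c' and el = "elm lv"], goal_cases)
          case (18 t4 s4)
          let ?c = "upd2 c' x' y' (Suc k)"
          have g4: "glob s4" by (rule glob_frame[OF 18(2)]) (use g2 in auto)
          have "cedge E ?c" unfolding cedge_def
          proof (intro allI impI)
            fix a b assume ab: "a < n" "b < n"
            show "(?c a b \<noteq> 0) = (b \<in> adj E a)"
              using hb(3,5) ab adj_sym[of y' E x'] by (auto simp: upd2_def doubleton_eq_iff)
          qed
          then have b4: "base E ?c (s4\<lparr>reg := (reg s4)(''f'' := 0)\<rparr>)"
            using g4 wf 18(2,3,4) lvL hb(7) m2 by (simp add: base_def frame_def)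
          have "goodx E lv ?c {} P"
          proof (rule goodx_set[OF wf H(4) _ _ 18(4) xy(1,2)])
            show "?c a b = c' a b" if "a < n" "b < n" "{a, b} \<noteq> {}" "{a, b} \<noteq> {x', y'}" for a b
              using that by (auto simp: upd2_def)
            show "\<not> bad E lv ?c x' y'"
              by (rule not_bad_new[OF 10(7) cnt]) (use st xy hb(6) in \<open>auto simp: upd2_def\<close>)
          qed
          moreover have "card (Dset c0 ?c) \<le> card (Dset c0 c) + 2 * (L + 1)" using Dset_upd2[of c0 c' x' y' "Suc k"] H(6) by simp
          moreover have "t4 + 2 \<le> t + 2 + 550 * K * (L + 1)" using 18(1) 10(1) H(5) lm K_ge2 by linarith
          ultimately have "I (t4 + 2) (s4\<lparr>reg := (reg s4)(''f'' := 0)\<rparr>)" using b4 unfolding I_def by auto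
          then show ?case by (simp add: numeral_eq_Suc)
        qed (use g2 r2 10(3,4) xy lx hb(2,4) c0xy kc kx elxy m2 in auto)
        then show ?thesis unfolding wp_Seq wp_Assign wp_Cond eR using 0 by (simp add: numeral_eq_Suc)
      next
        case (Suc z)
        have zn: "z < n" using rep_at_le[OF hb(4) xy(1) 10(4)] Suc by (simp add: e_def)
        have cz: "c' x' z = Suc k" using rep_at[OF hb(4) xy(1) 10(4) zn] Suc by (simp add: e_def)
        have zadj: "z \<in> adj E x'" using hb(3)[rule_format, OF xy(1) zn] cz by simp
        have zy: "z \<noteq> y'" using cz c0xy by auto
        have xz: "x' \<noteq> z" using adj_lt[OF wf zadj] by simp
        \<comment> \<open>The search has avoided all colors of edges from \<open>x'\<close> to nodes
          on its level or above. The conflicting edge therefore goes to a strictly lower node, and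
          the hole descends.\<close>
        have "elm lv x' z \<noteq> lv x'"
        proof
          assume "elm lv x' z = lv x'"
          then have "k \<in> FF c' (elm lv) x' (lv x')" using zn cz lx by (auto simp: FF_mem)
          then show False using 10(5) by simp
        qed
        then have lz: "lv z < lv x'" by (auto simp: elm_def min_def split: if_splits)
        have elz: "elm lv x' z = lv z" "elm lv z x' = lv z" using lz by (auto simp: elm_def)
        have zL: "lv z \<le> L" using lvL zn by simp
        have zW: "Suc z < WW" using zn L_WW by linarith
        let ?c1 = "upd2 c' x' z 0"
        let ?c2 = "upd2 ?c1 x' y' (Suc k)"
        let ?s3 = "s2\<lparr>reg := (reg s2)(''e'' := Suc z, ''o'' := y', ''y'' := z, ''l'' := lv z)\<rparr>"
        let ?r2 = "(''e'' ::= Reg ''y'' ;; ''y'' ::= Reg ''o'' ;; ''l'' ::= Load ''lev'' (Reg ''x'') ;; set_color ;;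
         ''y'' ::= Reg ''x'' ;; ''x'' ::= Reg ''e'')"
        have "wp w unset_color (wp w ?r2 I) (t2 + 18) ?s3"
        proof (rule unset_color_wp[where x = x' and y = z and k = k and l = "lv z" and c = c' and el = "elm lv"], goal_cases)
          case (14 t4 s4)
          note A = 14
          have r4: "reg s4 ''x'' = x'" "reg s4 ''y'' = z" "reg s4 ''o'' = y'" "reg s4 ''k'' = k" "reg s4 ''f'' = reg s' ''f''" "mem s4 ''lev'' = lv"
            using A(2) r2 10(3) hb(7) m2 by (auto simp: frame_def)
          have g4: "glob s4" by (rule glob_frame[OF A(2)]) (use g2 in auto)
          let ?s5 = "s4\<lparr>reg := (reg s4)(''e'' := z, ''y'' := y', ''l'' := lv x')\<rparr>"
          have kx: "k \<notin> cols ?c1 x'"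
          proof
            assume "k \<in> cols ?c1 x'"
            then obtain b where b: "b < n" "?c1 x' b = Suc k" by (auto simp: cols_def)
            then have "b \<noteq> z" "c' x' b = Suc k" by (auto simp: upd2_def split: if_splits)
            then show False using okc_uniq[OF hb(2) xy(1) b(1) zn _ cz] by simp
          qed
          have ky: "k \<notin> cols ?c1 y'" using kc by (auto simp: cols_def upd2_def split: if_splits)
          have "wp w set_color (wp w (''y'' ::= Reg ''x'' ;; ''x'' ::= Reg ''e'') I) (t4 + 7) ?s5"
          proof (rule set_color_wp[where x = x' and y = y' and k = k and l = "lv x'" and c = ?c1 and el = "elm lv"], goal_cases)
            case (18 t6 s6)
            have g6: "glob s6" by (rule glob_frame[OF 18(2)]) (use g4 in auto)
            let ?s7 = "s6\<lparr>reg := (reg s6)(''y'' := x', ''x'' := z)\<rparr>"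
            have r6: "reg s6 ''x'' = x'" "reg s6 ''e'' = z" "reg s6 ''f'' = reg s' ''f''" "mem s6 ''lev'' = lv"
              using 18(2) r4 by (auto simp: frame_def)
            have "\<forall>a<n. \<forall>b<n. ?c2 a b \<noteq> 0 \<longleftrightarrow> b \<in> adj E a \<and> {a, b} \<noteq> {z, x'}"
            proof (intro allI impI)
              fix a b assume ab: "a < n" "b < n"
              show "(?c2 a b \<noteq> 0) = (b \<in> adj E a \<and> {a, b} \<noteq> {z, x'})"
                using hb(3,5) ab adj_sym[of y' E x'] zy xz xy by (auto simp: upd2_def doubleton_eq_iff)
            qed
            then have h7: "hbase E ?c2 lv z x' ?s7"
              using g6 18(3,4) r6 zadj adj_sym[of x' E z] lz by (simp add: hbase_def)
            have "goodx E lv ?c2 {z, x'} P"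
            proof (rule goodx_set[OF wf H(4) _ _ 18(4) xy(1,2)])
              show "?c2 a b = c' a b" if "a < n" "b < n" "{a, b} \<noteq> {z, x'}" "{a, b} \<noteq> {x', y'}" for a b
                using that by (auto simp: upd2_def)
              show "\<not> bad E lv ?c2 x' y'"
                by (rule not_bad_new[OF 10(7) cnt]) (use st xy hb(6) in \<open>auto simp: upd2_def\<close>)
            qed
            moreover have "card (Dset c0 ?c2) + 2 * (lv z + 1) \<le> card (Dset c0 c) + 2 * (L + 1)"
              using Dset_upd2[of c0 c' x' z 0] Dset_upd2[of c0 ?c1 x' y' "Suc k"] H(6) lz by simp
            moreover have "t6 + 4 + 550 * K * (lv z + 1) \<le> t + 2 + 550 * K * (L + 1)"
            proof -
              have "550 * K * (lv z + 1) \<le> 550 * K * lv x'" using lz by (intro mult_le_mono2) simp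
              then show ?thesis using 18(1) A(1) 10(1) H(5) lm K_ge2 by linarith
            qed
            ultimately have "I (t6 + 4) ?s7" unfolding I_def
              using h7 f r6 by (intro disjI1 conjI exI[of _ ?c2] exI[of _ z] exI[of _ x']) simp_all
            then show ?case using r6 by (simp add: numeral_eq_Suc)
          qed (use g4 r4 10(4) xy lx A(3,4) c0xy kx ky elxy zy in \<open>auto simp: upd2_def\<close>)
          then show ?case using r4 by (simp add: numeral_eq_Suc)
        qed (use g2 r2 10(3) xy zn zL hb(2,4) cz elz m2 in auto)
        then show ?thesis unfolding wp_Seq wp_Assign wp_Cond eR using Suc r2 zW m2 hb(7)
          by (simp add: numeral_eq_Suc)
      qed
    qed (use hb(1,4) H(2,3) xy lx cM in \<open>simp_all add: globD rep_forest\<close>)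
    then show ?case using hb(1,7) H(2,3) xy lx by (simp add: numeral_eq_Suc)
  next
    case (4 t' s')
    then have "reg s' ''f'' = 0" by simp
    then obtain c' where "base E c' s'" "goodx E lv c' {} P" "t' \<le> t + 2 + 550 * K * (L + 1)"
       "card (Dset c0 c') \<le> card (Dset c0 c) + 2 * (L + 1)"
      using 4(1) unfolding I_def by blast
    then show ?case by (intro impI Q[of _ _ c']) (auto simp: chain_def)
  qed
qed

lemma cedgeD: "cedge E c \<Longrightarrow> a < n \<Longrightarrow> b < n \<Longrightarrow> c a b \<noteq> 0 \<longleftrightarrow> b \<in> adj E a"
  by (simp add: cedge_def)

text \<open>The additional change beyond those of the chain is the uncoloring of the bad edge that
  starts it.\<close>

lemma fix_color_wp:
  assumes b: "base E c s" and lv: "lv = mem s ''lev''" and st: "\<forall>v<n. stable E lv v"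
    and x: "reg s ''x'' = x" "reg s ''y'' = y" "x < n" "y < n"
    and gd: "goodx E lv c {x, y} P"
    and Q: "\<And>t' s' c'. t' \<le> t + 550 * K * (L + 1) + 300 * K \<Longrightarrow> frame s s' (wr (fix_color N)) (wm (fix_color N)) \<Longrightarrow> base E c' s' \<Longrightarrow>
      goodx E lv c' {} P \<Longrightarrow> card (Dset c0 c') \<le> card (Dset c0 c) + 2 * (L + 1) + 1 \<Longrightarrow> Q t' s'"
  shows "wp w (fix_color N) Q t s"
proof (rule wp_frame)
  let ?Q = "\<lambda>t' s'. t \<le> t' \<longrightarrow> frame s s' (wr (fix_color N)) (wm (fix_color N)) \<longrightarrow> Q t' s'"
  have B: "glob s" "wfE E" "okc c" "cedge E c" "\<forall>v<n. lv v \<le> L" "rep (mem s) c (elm lv)"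
    using b unfolding base_def lv by auto
  have col: "mem s ''color'' (x * n + y) = c x y" by (rule rep_color[OF B(6) x(3,4)])
  have baseR: "base E c s'" if "frame s s' X {}" "{''n'', ''M'', ''B'', ''L'', ''R'', ''J'', ''1''} \<inter> X = {}" for s' X
    by (rule base_frame[OF that(1) b that(2)]) auto
  show "wp w (fix_color N) ?Q t s"
  proof (cases "c x y = 0")
    case True
    then have na: "y \<notin> adj E x" "x \<notin> adj E y" using cedgeD[OF B(4) x(3,4)] adj_sym[of y E x] by auto
    have "goodx E lv c {} P" unfolding goodx_def
    proof (intro allI impI ballI)
      fix a d assume ad: "a < n" "d \<in> adj E a" "bad E lv c a d"
      have "{a, d} \<noteq> {x, y}" using na ad(2) by (auto simp: doubleton_eq_iff)
      then show "{a, d} = {} \<or> P a d" using gd ad unfolding goodx_def by blast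
    qed
    moreover have "base E c (s\<lparr>reg := (reg s)(''k'' := 0)\<rparr>)" by (rule baseR[of _ "{''k''}"]) (auto simp: frame_def)
    ultimately have q1: "?Q (t + 10) (s\<lparr>reg := (reg s)(''k'' := 0)\<rparr>)"
      using K_ge2 by (intro impI Q[of _ _ c]) simp_all
    have q2: "wp w (fix_color N) F t s" if "F (t + 10) (s\<lparr>reg := (reg s)(''k'' := 0)\<rparr>)" for F
      using x B(1) col True that by (simp add: fix_color_def numeral_eq_Suc)
    show ?thesis by (rule q2[where F = ?Q, OF q1])
  next
    case False
    then have ya: "y \<in> adj E x" using cedgeD[OF B(4) x(3,4)] by auto
    have W: "100 * M < WW" "4 \<le> M" "n \<le> M" using B_bounds WW_B(1) by linarith+
    let ?tl = "(''d'' ::= root_e (Reg ''x'') all_e ;; ''e'' ::= root_e (Reg ''y'') all_e ;;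
       Cond (Reg ''d'' <. Reg ''e'') (''d'' ::= Reg ''e'') Skip ;;
       ''a'' ::= Load ''tab'' (Reg ''l'' /. Reg ''R'') ;;
       Cond (Reg ''d'' +. up_e N (Reg ''a'') <. Reg ''k'' +. Const 1)
        (''k'' ::= Reg ''k'' -. Const 1 ;; unset_color ;; chain) Skip)"
    have tail: "wp w ?tl ?Q t2 s2"
      if h2: "t2 \<le> t + 40" "frame s s2 {''k'', ''l'', ''m'', ''e'', ''x'', ''y''} {}" "reg s2 ''x'' = x'" "reg s2 ''y'' = y'"
        "reg s2 ''l'' = lv x'" "reg s2 ''k'' = c x' y'" "lv x' \<le> lv y'" "x' = x \<and> y' = y \<or> x' = y \<and> y' = x" for t2 s2 x' y'
    proof -
      have xy': "x' < n" "y' < n" using h2(8) x by auto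
      have m2: "mem s2 = mem s" using h2(2) by (auto simp: frame_def fun_eq_iff)
      have b2: "base E c s2" by (rule baseR[OF h2(2)]) auto
      have g2: "glob s2" using b2 by (simp add: base_def)
      have ya': "y' \<in> adj E x'" using ya h2(8) adj_sym[of y E x] by auto
      have gd': "goodx E lv c {x', y'} P" using gd h2(8) by (auto simp: insert_commute)
      have T: "mem s2 ''T'' (tb v (L + 1) + 1) = card (adj E v)" if "v < n" for v
        using forest_root[OF rep_forest[OF B(6)] that, of "L + 1"] card_all[OF B(2,3,4) that] by (simp add: m2)
      define dm where "dm = max (card (adj E x')) (card (adj E y'))"
      have dmn: "dm < n" using adj_card[OF B(2)] by (simp add: dm_def)
      have lx: "lv x' \<le> L" using B(5) xy' by simp
      have tab: "mem s2 ''tab'' (lv x' div R) = Av (lv x' div R)" by (rule glob_tab[OF g2 lx])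
      have cM: "c x' y' \<le> M" by (rule okc_le[OF B(3) xy'])
      have c0: "c x' y' \<noteq> 0" using cedgeD[OF B(4) xy'] ya' by auto
      have Ule: "dm + Ul (lv x') < WW" "c x' y' + 1 < WW" using Ul_le[of "lv x'"] dmn cM W by linarith+
      have bd: "bad E lv c x' y' \<longleftrightarrow> dm + Ul (lv x') < c x' y' + 1" using h2(7) by (simp add: bad_def dm_def min_def)
      define s3 where "s3 = s2\<lparr>reg := (reg s2)(''d'' := dm, ''e'' := card (adj E y'), ''a'' := Av (lv x' div R))\<rparr>"
      have st3: "wp w (''d'' ::= root_e (Reg ''x'') all_e ;; ''e'' ::= root_e (Reg ''y'') all_e ;;
         Cond (Reg ''d'' <. Reg ''e'') (''d'' ::= Reg ''e'') Skip ;;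
         ''a'' ::= Load ''tab'' (Reg ''l'' /. Reg ''R'') ;; d) F t2 s2"
        if "\<And>t3 s3'. t3 \<le> t2 + 50 \<Longrightarrow> s3' = s3 \<Longrightarrow> wp w d F t3 s3'" for d F
        using g2 h2(3,4,5) xy' T[of x'] T[of y'] tab globD(5)[OF g2]
        by (simp add: max_def) (intro conjI impI; rule that; simp add: s3_def dm_def max_def fun_upd_twist)
      have U: "4 * Av (lv x' div R) + 1 + 4 * (Av (lv x' div R) div N) = Ul (lv x')" by (simp add: Ul_def)
      have evc: "expr_val w (Reg ''d'' +. up_e N (Reg ''a'') <. Reg ''k'' +. Const 1) s3 = of_bool (bad E lv c x' y')"
      proof -
        have "expr_val w (up_e N (Reg ''a'')) s3 = Ul (lv x')" using Av_le[of "lv x' div R"] U by (simp add: s3_def)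
        then have "expr_val w (Reg ''d'' +. up_e N (Reg ''a'')) s3 = dm + Ul (lv x')" using Ule by (subst ev_Add) (simp_all add: s3_def)
        moreover have "expr_val w (Reg ''k'' +. Const 1) s3 = c x' y' + 1" using Ule h2(6) by (subst ev_Add) (simp_all add: s3_def)
        ultimately show ?thesis unfolding ev_Less bd by simp
      qed
      have f3: "frame s s3 {''k'', ''l'', ''m'', ''e'', ''x'', ''y'', ''d'', ''a''} {}" using h2(2) by (auto simp: frame_def s3_def)
      have b3: "base E c s3" by (rule baseR[OF f3]) auto
      show ?thesis
      proof (rule st3, hypsubst, unfold wp_Cond[of w "_ <. _"] evc, goal_cases)
        case (1 t3 s3')
        show ?case
        proof (cases "bad E lv c x' y'")
          case False
          have "goodx E lv c {} P" unfolding goodx_def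
          proof (intro allI impI ballI)
            fix a d assume ad: "a < n" "d \<in> adj E a" "bad E lv c a d"
            have "{a, d} \<noteq> {x', y'}" using False ad(3) bad_sym[OF B(3) xy'] by (auto simp: doubleton_eq_iff)
            then show "{a, d} = {} \<or> P a d" using gd' ad unfolding goodx_def by blast
          qed
          then show ?thesis using False b3 1 h2(1) K_ge2 by simp (intro impI, rule Q[of _ _ c]; simp)
        next
          case True
          obtain k where k: "c x' y' = Suc k" using c0 by (cases "c x' y'") auto
          let ?s4 = "s3\<lparr>reg := (reg s3)(''k'' := k)\<rparr>"
          let ?c1 = "upd2 c x' y' 0"
          have el: "elm lv x' y' = lv x'" "elm lv y' x' = lv x'" using h2(7) by (auto simp: elm_def min_def)
          have g3: "glob s3" using b3 by (simp add: base_def)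
          have "wp w unset_color (wp w chain ?Q) (t3 + 22) ?s4"
          proof (rule unset_color_wp[where x = x' and y = y' and k = k and l = "lv x'" and c = c and el = "elm lv"], goal_cases)
            case (14 t5 s5)
            note A = 14
            have g5: "glob s5" by (rule glob_frame[OF A(2)]) (use g3 in auto)
            have hc: "\<forall>a<n. \<forall>b<n. ?c1 a b \<noteq> 0 \<longleftrightarrow> b \<in> adj E a \<and> {a, b} \<noteq> {x', y'}"
              using B(4) by (auto simp: cedge_def upd2_def doubleton_eq_iff)
            have l5: "mem s5 ''lev'' = lv" using A(2) m2 by (simp add: frame_def s3_def lv)
            have hb: "hbase E ?c1 lv x' y' s5"
              unfolding hbase_def using g5 A(3,4) hc ya' h2(7) l5 by auto
            have g1: "goodx E lv ?c1 {x', y'} P" unfolding goodx_def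
            proof (intro allI impI ballI)
              fix a d assume ad: "a < n" "d \<in> adj E a" "bad E lv ?c1 a d"
              show "{a, d} = {x', y'} \<or> P a d"
              proof (cases "{a, d} = {x', y'}")
                case False
                then have "?c1 a d = c a d" by (auto simp: upd2_def)
                then show ?thesis using gd' ad unfolding goodx_def bad_def by auto
              qed simp
            qed
            show ?case
            proof (rule chain_wp[OF B(2) st B(5) hb _ _ g1, where ?c0.0 = c0], goal_cases)
              case (3 t6 s6 c')
              have "card (Dset c0 c') \<le> card (Dset c0 c) + 2 * (L + 1) + 1" using 3(5) Dset_upd2[of c0 c x' y' 0] by simp
              moreover have "t6 \<le> t + 550 * K * (L + 1) + 300 * K" using 3(1) A(1) 1 h2(1) K_ge2 by linarith
              ultimately show ?case using 3(3,4) by (intro impI Q[of _ _ c']) auto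
            qed (use A(2) h2(3,4) in \<open>auto simp: frame_def s3_def\<close>)
          qed (use g3 xy' h2(3,4,5) lx B(3,6) k el m2 in \<open>auto simp: s3_def\<close>)
          moreover have "reg s3 ''k'' = Suc k" using h2(6) k by (simp add: s3_def)
          ultimately show ?thesis using True cM W k by (simp add: numeral_eq_Suc)
        qed
      qed
    qed
    let ?s1 = "s\<lparr>reg := (reg s)(''k'' := c x y, ''l'' := lv x, ''m'' := lv y)\<rparr>"
    have pre: "wp w (fix_color N) F t s \<longleftrightarrow> wp w (Cond (Reg ''m'' <. Reg ''l'')
        (''l'' ::= Reg ''m'' ;; ''e'' ::= Reg ''x'' ;; ''x'' ::= Reg ''y'' ;; ''y'' ::= Reg ''e'') Skip) (wp w ?tl F) (t + 15) ?s1" for F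
      unfolding fix_color_def wp_Seq[of w "''k'' ::= _"] wp_Seq[of w "''l'' ::= _"] wp_Seq[of w "''m'' ::= _"] wp_Seq[of w "Cond _ _ _"] wp_Assign wp_Cond[of w "Reg ''k''"]
      using x B(1) col False lv by (simp del: wp_Cond wp_Seq wp_Assign add: numeral_eq_Suc)
    show ?thesis unfolding pre
    proof (cases "lv y < lv x")
      case True
      have "wp w ?tl ?Q (t + 15 + (4 + 8)) (?s1\<lparr>reg := (reg ?s1)(''l'' := lv y, ''e'' := x, ''x'' := y, ''y'' := x)\<rparr>)"
        by (rule tail[where x' = y and y' = x]) (use True x okc_sym[OF B(3) x(3,4)] in \<open>auto simp: frame_def\<close>)
      then show "wp w (Cond (Reg ''m'' <. Reg ''l'')
        (''l'' ::= Reg ''m'' ;; ''e'' ::= Reg ''x'' ;; ''x'' ::= Reg ''y'' ;; ''y'' ::= Reg ''e'') Skip) (wp w ?tl ?Q) (t + 15) ?s1"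
        unfolding wp_Cond[of w "Reg ''m'' <. Reg ''l''"] using True x by (simp del: wp_Cond add: numeral_eq_Suc)
    next
      case False
      have "wp w ?tl ?Q (t + 15 + (4 + 1)) ?s1"
        by (rule tail[where x' = x and y' = y]) (use False x in \<open>auto simp: frame_def\<close>)
      then show "wp w (Cond (Reg ''m'' <. Reg ''l'')
        (''l'' ::= Reg ''m'' ;; ''e'' ::= Reg ''x'' ;; ''x'' ::= Reg ''y'' ;; ''y'' ::= Reg ''e'') Skip) (wp w ?tl ?Q) (t + 15) ?s1"
        unfolding wp_Cond[of w "Reg ''m'' <. Reg ''l''"] using False x by (simp del: wp_Cond add: numeral_eq_Suc)
    qed
  qed
qed

lemma phase2_wp:
  assumes b: "base E c s" and lv: "lv = mem s ''lev''" and st: "\<forall>v<n. stable E lv v"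
    and v: "validq s" and bq: "badq E c 0 s" and W: "reg s ''t'' < WW"
    and Q: "\<And>t' s' c'. t' \<le> t + 550 * K * (L + 2) * reg s ''t'' + 10 \<Longrightarrow> frame s s' (wr (phase2 N)) (wm (phase2 N)) \<Longrightarrow> base E c' s' \<Longrightarrow>
      (\<forall>a<n. \<forall>b\<in>adj E a. \<not> bad E lv c' a b) \<Longrightarrow> card (Dset c c') \<le> 2 * (L + 2) * reg s ''t'' \<Longrightarrow> Q t' s'"
  shows "wp w (phase2 N) Q t s"
proof -
  define q where "q = reg s ''t''"
  define P where "P h = (\<lambda>a b. \<exists>j. h \<le> j \<and> j < q \<and> {mem s ''qa'' j, mem s ''qb'' j} = {a, b})" for h
  define I where "I = (\<lambda>t' (s'::state). \<exists>c'. base E c' s' \<and> reg s' ''h'' \<le> q \<and> t' \<le> t + 2 + 550 * K * (L + 2) * reg s' ''h'' \<and>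
     goodx E lv c' {} (P (reg s' ''h'')) \<and> card (Dset c c') \<le> 2 * (L + 2) * reg s' ''h'')"
  show ?thesis
  proof (rule wp_frame, unfold phase2_def wp_Seq[of w "''h'' ::= _"] wp_Assign,
      rule wp_While[where I = I and Bd = "t + 2 + 550 * K * (L + 2) * q"], goal_cases)
    case 1
    have "base E c (s\<lparr>reg := (reg s)(''h'' := 0)\<rparr>)" by (rule base_frame[OF _ b, of _ "{''h''}" "{}"]) (auto simp: frame_def)
    moreover have "goodx E lv c {} (P 0)" using bq unfolding goodx_def badq_def P_def q_def lv by simp
    ultimately show ?case unfolding I_def by (intro exI[of _ c]) (simp add: Dset_self)
  next
    case (2 t' s')
    then obtain h where "t' \<le> t + 2 + 550 * K * (L + 2) * h" "h \<le> q" by (auto simp: I_def)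
    moreover from this have "550 * K * (L + 2) * h \<le> 550 * K * (L + 2) * q" by (intro mult_le_mono2)
    ultimately show ?case by linarith
  next
    case (3 t' s')
    define h where "h = reg s' ''h''"
    obtain c' where I: "base E c' s'" "h \<le> q" "t' \<le> t + 2 + 550 * K * (L + 2) * h"
      "goodx E lv c' {} (P h)" "card (Dset c c') \<le> 2 * (L + 2) * h"
      using 3(1) unfolding I_def h_def by blast
    have fr: "reg s' ''t'' = q" "mem s' ''qa'' = mem s ''qa''" "mem s' ''qb'' = mem s ''qb''" "mem s' ''lev'' = lv"
      using 3(2) by (simp_all add: frame_def q_def lv)
    have hq: "h < q" using 3(3) fr by (simp add: h_def)
    define x where "x = mem s ''qa'' h"
    define y where "y = mem s ''qb'' h"
    have xy: "x < n" "y < n" using v hq by (auto simp: validq_def x_def y_def q_def)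
    let ?s1 = "s'\<lparr>reg := (reg s')(''x'' := x, ''y'' := y)\<rparr>"
    have b1: "base E c' ?s1" by (rule base_frame[OF _ I(1), of _ "{''x'', ''y''}" "{}"]) (auto simp: frame_def)
    have g1: "goodx E lv c' {x, y} (P (Suc h))" unfolding goodx_def
    proof (intro allI impI ballI)
      fix a d assume ad: "a < n" "d \<in> adj E a" "bad E lv c' a d"
      then have "P h a d" using I(4) unfolding goodx_def by simp
      then obtain j where j: "h \<le> j" "j < q" "{mem s ''qa'' j, mem s ''qb'' j} = {a, d}"
        unfolding P_def by blast
      show "{a, d} = {x, y} \<or> P (Suc h) a d"
      proof (cases "j = h")
        case False
        then have "Suc h \<le> j" using j(1) by simp
        then show ?thesis using j(2,3) unfolding P_def by blast
      qed (use j in \<open>auto simp: x_def y_def\<close>)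
    qed
    have hW: "Suc h < WW" using hq W by (simp add: q_def)
    have "wp w (fix_color N) (wp w (''h'' ::= Reg ''h'' +. Const 1) I) (t' + 10) ?s1"
    proof (rule fix_color_wp[OF b1 _ st _ _ xy g1, where ?c0.0 = c], goal_cases)
      case (4 t2 s2 c2)
      have h2: "reg s2 ''h'' = h" using 4(2) by (simp add: frame_def h_def)
      have "base E c2 (s2\<lparr>reg := (reg s2)(''h'' := Suc h)\<rparr>)" by (rule base_frame[OF _ 4(3), of _ "{''h''}" "{}"]) (auto simp: frame_def)
      moreover have "t2 + 4 \<le> t + 2 + 550 * K * (L + 2) * Suc h"
      proof -
        have "550 * K * (L + 2) * Suc h = 550 * K * (L + 2) * h + 550 * K * (L + 1) + 550 * K" by (simp add: algebra_simps)
        then show ?thesis using 4(1) I(3) K_ge2 by linarith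
      qed
      moreover have "card (Dset c c2) \<le> 2 * (L + 2) * Suc h"
      proof -
        have "2 * (L + 2) * Suc h = 2 * (L + 2) * h + 2 * (L + 1) + 2" by (simp add: algebra_simps)
        then show ?thesis using 4(5) I(5) by linarith
      qed
      ultimately have "I (t2 + 4) (s2\<lparr>reg := (reg s2)(''h'' := Suc h)\<rparr>)"
        unfolding I_def using 4(4) hq by (intro exI[of _ c2]) simp
      then show ?case using h2 hW by (simp add: numeral_eq_Suc)
    qed (use fr in auto)
    then show ?case using fr by (simp add: h_def x_def y_def numeral_eq_Suc)
  next
    case (4 t' s')
    obtain c' where I: "base E c' s'" "reg s' ''h'' \<le> q" "t' \<le> t + 2 + 550 * K * (L + 2) * reg s' ''h''"
      "goodx E lv c' {} (P (reg s' ''h''))" "card (Dset c c') \<le> 2 * (L + 2) * reg s' ''h''"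
      using 4(1) unfolding I_def by blast
    have "reg s' ''t'' = q" using 4(2) by (simp add: frame_def q_def)
    then have hq: "reg s' ''h'' = q" using 4(3) I(2) by auto
    have "\<forall>a<n. \<forall>b\<in>adj E a. \<not> bad E lv c' a b" 
    proof (intro allI impI ballI notI)
      fix a d assume "a < n" "d \<in> adj E a" "bad E lv c' a d"
      then have "P q a d" using I(4) unfolding goodx_def hq by simp
      then show False unfolding P_def by auto
    qed
    then show ?case using I hq by (intro impI Q[of _ _ c']) (auto simp: q_def phase2_def)
  qed
qed

end

section \<open>Insertion, deletion and initialization\<close>

text \<open>Both searches use the trees of all edges, so the color is free at both endpoints and no
  chain starts here. The color may violate its bound; the new edge is the first queue entry and is
  repaired in the color phase.\<close>

definition insert_edge :: com where
  "insert_edge =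
    (''x'' ::= Reg ''u'' ;; ''y'' ::= Reg ''v'' ;;
     ''p'' ::= tbase (Reg ''x'') all_e ;; ''q'' ::= tbase (Reg ''y'') all_e ;; find_free ;;
     ''l'' ::= Load ''lev'' (Reg ''x'') ;; ''m'' ::= Load ''lev'' (Reg ''y'') ;;
     Cond (Reg ''m'' <. Reg ''l'') (''l'' ::= Reg ''m'') Skip ;; set_color)"

text \<open>An edge was within its bound before the degree of \<open>x\<close> dropped by one. For a
  given threshold it can violate the bound now only if its stored color equals the new degree plus
  that threshold; \<open>k\<close> is this color counted from zero, and \<open>at\<close> tells
  whether \<open>x\<close> has such an edge.\<close>

definition probe :: "nat \<Rightarrow> com" where
  "probe N =
    (''k'' ::= root_e (Reg ''x'') all_e +. up_e N (Reg ''a'') -. Const 1 ;;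
     Cond (Reg ''k'' <. Reg ''M'')
      (''e'' ::= Load ''at'' (baddr (Reg ''x'') (Reg ''k'')) ;;
       Cond (Reg ''e'') (''y'' ::= Reg ''e'' -. Const 1 ;; push) Skip)
      Skip)"

text \<open>The threshold depends only on the group of the level, so one probe for each of the
  \<open>J + 1\<close> parameters and each endpoint is enough, instead of one for each
  level.\<close>

definition delete_edge :: "nat \<Rightarrow> com" where
  "delete_edge N =
    (''x'' ::= Reg ''u'' ;; ''y'' ::= Reg ''v'' ;;
     ''k'' ::= Load ''color'' (caddr (Reg ''x'') (Reg ''y'')) -. Const 1 ;;
     ''l'' ::= Load ''lev'' (Reg ''x'') ;; ''m'' ::= Load ''lev'' (Reg ''y'') ;;
     Cond (Reg ''m'' <. Reg ''l'') (''l'' ::= Reg ''m'') Skip ;; unset_color ;;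
     ''j'' ::= Const 0 ;;
     While (Reg ''j'' <. Reg ''J'' +. Const 1)
      (''a'' ::= Load ''tab'' (Reg ''j'') ;;
       ''x'' ::= Reg ''u'' ;; probe N ;; ''x'' ::= Reg ''v'' ;; probe N ;;
       ''j'' ::= Reg ''j'' +. Const 1))"

definition init :: "nat \<Rightarrow> com" where
  "init N =
    (''M'' ::= Const 1 ;; ''K'' ::= Const 0 ;;
     While (Reg ''M'' <. Const 2 *. Reg ''n'')
      (''M'' ::= Reg ''M'' *. Const 2 ;; ''K'' ::= Reg ''K'' +. Const 1) ;;
     ''R'' ::= Const 2 *. Const N *. Reg ''K'' ;; ''J'' ::= Const N *. Reg ''K'' ;;
     ''L'' ::= Reg ''R'' *. Reg ''J'' ;; ''B'' ::= Reg ''L'' +. Const 2 +. Const 2 *. Reg ''M'' ;;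
     ''1'' ::= Const 1 ;;
     Store ''tab'' (Const 0) (Const 1) ;; ''j'' ::= Const 0 ;;
     While (Reg ''j'' <. Reg ''J'')
      (''a'' ::= Load ''tab'' (Reg ''j'') ;; ''j'' ::= Reg ''j'' +. Const 1 ;;
       Cond (Reg ''a'' <. Reg ''M'')
        (Store ''tab'' (Reg ''j'') (Reg ''a'' +. Const 1 +. Reg ''a'' /. Const N))
        (Store ''tab'' (Reg ''j'') (Reg ''a''))))"

lemma writes_ops [simp]:
  "wr insert_edge = {''x'', ''y'', ''p'', ''q'', ''i'', ''z'', ''k'', ''l'', ''m''}"
  "wm insert_edge = {''color'', ''at'', ''T''}"
  "wr (probe N) = {''k'', ''e'', ''y'', ''t''}" "wm (probe N) = {''qa'', ''qb''}"
  "wr (delete_edge N) = {''x'', ''y'', ''k'', ''l'', ''m'', ''i'', ''p'', ''j'', ''a'', ''e'', ''t''}"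
  "wm (delete_edge N) = {''color'', ''at'', ''T'', ''qa'', ''qb''}"
  "wr (init N) = {''M'', ''K'', ''R'', ''J'', ''L'', ''B'', ''1'', ''j'', ''a''}" "wm (init N) = {''tab''}"
  by (auto simp: insert_edge_def probe_def delete_edge_def init_def)

context ctx begin

lemma elm_sym: "elm lv a b = elm lv b a" by (simp add: elm_def min.commute)

lemma insert_edge_wp:
  assumes b: "base E c s" and x: "reg s ''u'' = x" "reg s ''v'' = y" "x < n" "y < n" "x \<noteq> y" "{x, y} \<notin> E"
    and Q: "\<And>t' s' k. t' \<le> t + 320 * K \<Longrightarrow> frame s s' (wr insert_edge) (wm insert_edge) \<Longrightarrow>
      base (insert {x, y} E) (upd2 c x y (Suc k)) s' \<Longrightarrow> Q t' s'"
  shows "wp w insert_edge Q t s"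
proof (rule wp_frame)
  let ?Q = "\<lambda>t' s'. t \<le> t' \<longrightarrow> frame s s' (wr insert_edge) (wm insert_edge) \<longrightarrow> Q t' s'"
  define lv where "lv = mem s ''lev''"
  have B: "glob s" "wfE E" "okc c" "cedge E c" "\<forall>v<n. lv v \<le> L" "rep (mem s) c (elm lv)"
    using b unfolding base_def lv_def by auto
  have ny: "y \<notin> adj E x" using x(6) by (simp add: adj_def)
  have c0: "c x y = 0" using cedgeD[OF B(4) x(3,4)] ny by simp
  have cM: "card (FF c (elm lv) x (L + 1)) + card (FF c (elm lv) y (L + 1)) < M"
    using card_all[OF B(2,3,4) x(3), of "elm lv"] card_all[OF B(2,3,4) x(4), of "elm lv"] adj_card[OF B(2), of x] adj_card[OF B(2), of y] B_bounds(1) by linarith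
  let ?s1 = "s\<lparr>reg := (reg s)(''x'' := x, ''y'' := y, ''p'' := tb x (L + 1), ''q'' := tb y (L + 1))\<rparr>"
  let ?r = "(''l'' ::= Load ''lev'' (Reg ''x'') ;; ''m'' ::= Load ''lev'' (Reg ''y'') ;;
     Cond (Reg ''m'' <. Reg ''l'') (''l'' ::= Reg ''m'') Skip ;; set_color)"
  have main: "wp w find_free (wp w ?r ?Q) (t + 24) ?s1"
  proof (rule find_free_wp[where x = x and l = "L + 1" and y = y and m = "L + 1" and F = "FF c (elm lv)"], goal_cases)
    case (10 t2 s2 k)
    have m2: "mem s2 = mem s" using 10(2) by (auto simp: frame_def fun_eq_iff)
    have r2: "reg s2 ''x'' = x" "reg s2 ''y'' = y" using 10(2) by (auto simp: frame_def)
    have g2: "glob s2" using B(1) by (intro glob_frame[OF 10(2)]) auto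
    define s3 where "s3 = s2\<lparr>reg := (reg s2)(''l'' := elm lv x y, ''m'' := lv y)\<rparr>"
    have pre: "wp w (''l'' ::= Load ''lev'' (Reg ''x'') ;; ''m'' ::= Load ''lev'' (Reg ''y'') ;;
       Cond (Reg ''m'' <. Reg ''l'') (''l'' ::= Reg ''m'') Skip ;; d) F t2 s2"
      if "\<And>t3 s3'. t3 \<le> t2 + 20 \<Longrightarrow> s3' = s3 \<Longrightarrow> wp w d F t3 s3'" for d F
      using r2 m2 by (simp add: lv_def[symmetric]) (intro conjI impI; rule that; simp add: s3_def elm_def min_def fun_upd_twist)
    have g3: "glob s3" using g2 by (simp add: s3_def)
    show ?case
    proof (rule pre, hypsubst, rule set_color_wp[where x = x and y = y and k = k and l = "elm lv x y" and c = c and el = "elm lv"], goal_cases)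
      case (18 t3 s3' t4 s4)
      let ?c = "upd2 c x y (Suc k)"
      have g4: "glob s4" by (rule glob_frame[OF 18(3) g3]) auto
      have "cedge (insert {x, y} E) ?c" unfolding cedge_def
      proof (intro allI impI)
        fix a d assume ad: "a < n" "d < n"
        show "(?c a d \<noteq> 0) = (d \<in> adj (insert {x, y} E) a)"
          unfolding adj_insert[OF x(5)] using cedgeD[OF B(4) ad] x(5) by (auto simp: upd2_def)
      qed
      moreover have "mem s4 ''lev'' = lv" using 18(3) m2 by (simp add: frame_def s3_def lv_def)
      ultimately have "base (insert {x, y} E) ?c s4"
        using g4 wfE_insert[OF B(2) x(5,3,4)] 18(4,5) B(5) by (simp add: base_def)
      then show ?case using 18(1,2) 10(1) K_ge2 by (intro impI Q[of _ _ k]) auto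
    qed (use g3 r2 x(3,4,5) 10(3,4,5,6) B(3,5,6) c0 m2 in \<open>auto simp: s3_def elm_sym FF_def\<close>, auto simp: elm_def)
  qed (use B(1,6) x cM in \<open>simp_all add: globD rep_forest\<close>)
  have pre: "wp w insert_edge F t s \<longleftrightarrow> wp w find_free (wp w ?r F) (t + 24) ?s1" for F
    unfolding insert_edge_def wp_Seq[of w "_ ::= _"] wp_Seq[of w find_free] wp_Assign
    using B(1) x by (simp del: wp_Seq wp_Assign wp_Cond add: numeral_eq_Suc)
  show "wp w insert_edge ?Q t s" unfolding pre using main .
qed

lemma probe_wp:
  assumes b: "base E c s" and x: "reg s ''x'' = x" "x < n" and a: "reg s ''a'' = a" "a \<le> 2 * M"
    and W: "reg s ''t'' + 1 < WW" and v: "validq s"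
    and Q: "\<And>t' s'. t' \<le> t + 60 \<Longrightarrow> frame s s' (wr (probe N)) (wm (probe N)) \<Longrightarrow> validq s' \<Longrightarrow>
      reg s ''t'' \<le> reg s' ''t'' \<Longrightarrow> reg s' ''t'' \<le> reg s ''t'' + 1 \<Longrightarrow>
      (\<forall>j<reg s ''t''. mem s' ''qa'' j = mem s ''qa'' j \<and> mem s' ''qb'' j = mem s ''qb'' j) \<Longrightarrow>
      (\<forall>y<n. c x y = card (adj E x) + (4 * a + 1 + 4 * (a div N)) \<longrightarrow>
        (\<exists>j<reg s' ''t''. mem s' ''qa'' j = x \<and> mem s' ''qb'' j = y)) \<Longrightarrow> Q t' s'"
  shows "wp w (probe N) Q t s"
proof (rule wp_frame)
  let ?Q = "\<lambda>t' s'. t \<le> t' \<longrightarrow> frame s s' (wr (probe N)) (wm (probe N)) \<longrightarrow> Q t' s'"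
  define lv where "lv = mem s ''lev''"
  have B: "glob s" "wfE E" "okc c" "cedge E c" "rep (mem s) c (elm lv)"
    using b unfolding base_def lv_def by auto
  define k where "k = card (adj E x) + (4 * a + 4 * (a div N))"
  have kc: "card (adj E x) + (4 * a + 1 + 4 * (a div N)) = Suc k" by (simp add: k_def)
  note Q' = Q[unfolded kc]
  have T: "mem s ''T'' (tb x (L + 1) + 1) = card (adj E x)"
    using forest_root[OF rep_forest[OF B(5)] x(2), of "L + 1"] card_all[OF B(2,3,4) x(2)] by simp
  have e1: "expr_val w (root_e (Reg ''x'') all_e) s = card (adj E x)" using B(1) x T by simp
  have e2: "expr_val w (up_e N (Reg ''a'')) s = 4 * a + 1 + 4 * (a div N)" using a by simp
  have dle: "a div N \<le> a" by (rule div_le_dividend)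
  have kW: "Suc k < WW" using a(2) dle adj_card[OF B(2), of x] B_bounds WW_B(1) unfolding k_def by linarith
  have "expr_val w (root_e (Reg ''x'') all_e +. up_e N (Reg ''a'')) s = Suc k"
    using e1 e2 kc kW by (subst ev_Add) simp_all
  then have ek: "expr_val w (root_e (Reg ''x'') all_e +. up_e N (Reg ''a'') -. Const 1) s = k"
    using kW by (subst ev_Sub) simp_all
  define s1 where "s1 = s\<lparr>reg := (reg s)(''k'' := k)\<rparr>"
  have g1: "glob s1" using B(1) by (simp add: s1_def)
  have t1: "1 + expr_time (root_e (Reg ''x'') all_e +. up_e N (Reg ''a'') -. Const 1) = 27" by simp
  have pre: "wp w (probe N) F t s \<longleftrightarrow> wp w (Cond (Reg ''k'' <. Reg ''M'')
      (''e'' ::= Load ''at'' (baddr (Reg ''x'') (Reg ''k'')) ;;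
       Cond (Reg ''e'') (''y'' ::= Reg ''e'' -. Const 1 ;; push) Skip)
      Skip) F (t + 27) s1" for F
    unfolding probe_def wp_Seq[of w "''k'' ::= _"] wp_Assign[of w "''k''"] ek t1 s1_def ..
  show "wp w (probe N) ?Q t s"
  proof (cases "k < M")
    case False
    have n1: "c x y \<noteq> Suc k" if "y < n" for y using okc_le[OF B(3) x(2) that] False by simp
    have "?Q (t + 32) s1"
      by (intro impI Q') (use v n1 in \<open>auto simp: s1_def validq_def\<close>)
    then show ?thesis unfolding pre using False globD(2)[OF B(1)] by (simp add: s1_def numeral_eq_Suc)
  next
    case True
    have kB: "k < B" using True B_bounds by linarith
    define e where "e = mem s ''at'' (x * B + k)"
    have ev: "expr_val w (Load ''at'' (baddr (Reg ''x'') (Reg ''k''))) s1 = e"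
      using g1 x kB by (simp add: s1_def e_def)
    show ?thesis
    proof (cases e)
      case 0
      have n1: "c x y \<noteq> Suc k" if "y < n" for y using rep_at[OF B(5) x(2) True that] 0 by (simp add: e_def)
      have "?Q (t + 41) (s1\<lparr>reg := (reg s1)(''e'' := 0)\<rparr>)"
        by (intro impI Q') (use v n1 in \<open>auto simp: s1_def validq_def\<close>)
      then show ?thesis unfolding pre wp_Cond[of w "Reg ''k'' <. _"] wp_Seq[of w "''e'' ::= _"] wp_Assign[of w "''e''"] ev
        using True globD(2)[OF B(1)] 0 by (simp add: s1_def numeral_eq_Suc)
    next
      case (Suc y)
      have yn: "y < n" using rep_at_le[OF B(5) x(2) True] Suc by (simp add: e_def)
      have cy: "c x y = Suc k" using rep_at[OF B(5) x(2) True yn] Suc by (simp add: e_def)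
      have un: "z = y" if "z < n" "c x z = Suc k" for z using okc_uniq[OF B(3) x(2) that(1) yn that(2) cy] .
      let ?q = "reg s ''t''"
      let ?s5 = "s1\<lparr>mem := (mem s)(''qa'' := (mem s ''qa'')(?q := x), ''qb'' := (mem s ''qb'')(?q := y)), reg := (reg s1)(''e'' := Suc y, ''y'' := y, ''t'' := ?q + 1)\<rparr>"
      have fin: "\<forall>z<n. c x z = Suc k \<longrightarrow> (\<exists>j<reg ?s5 ''t''. mem ?s5 ''qa'' j = x \<and> mem ?s5 ''qb'' j = z)"
      proof (intro allI impI)
        fix z assume "z < n" "c x z = Suc k"
        then have "z = y" by (rule un)
        then show "\<exists>j<reg ?s5 ''t''. mem ?s5 ''qa'' j = x \<and> mem ?s5 ''qb'' j = z" by (intro exI[of _ ?q]) simp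
      qed
      have vq: "validq ?s5" using v x yn by (auto simp: validq_def less_Suc_eq)
      have "?Q (t + 54) ?s5"
        by (intro impI Q') (use vq fin in simp_all)
      moreover have "Suc y < WW" using yn L_WW by linarith
      ultimately show ?thesis unfolding pre wp_Cond[of w "Reg ''k'' <. _"] wp_Seq[of w "''e'' ::= _"] wp_Assign[of w "''e''"] ev
        using True globD(2)[OF B(1)] Suc W x by (simp add: s1_def push_def numeral_eq_Suc)
    qed
  qed
qed

lemma delete_edge_wp:
  assumes b: "base E c s" and x: "reg s ''u'' = x" "reg s ''v'' = y" "x < n" "y < n" "x \<noteq> y" "{x, y} \<in> E"
    and W: "reg s ''t'' + 2 * (J + 1) < WW" and v: "validq s"
    and Q: "\<And>t' s'. t' \<le> t + 280 * K + 200 * (J + 1) \<Longrightarrow> frame s s' (wr (delete_edge N)) (wm (delete_edge N)) \<Longrightarrow>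
      base (E - {{x, y}}) (upd2 c x y 0) s' \<Longrightarrow> validq s' \<Longrightarrow>
      reg s ''t'' \<le> reg s' ''t'' \<Longrightarrow> reg s' ''t'' \<le> reg s ''t'' + 2 * (J + 1) \<Longrightarrow>
      (\<forall>j<reg s ''t''. mem s' ''qa'' j = mem s ''qa'' j \<and> mem s' ''qb'' j = mem s ''qb'' j) \<Longrightarrow>
      (\<forall>i\<le>J. \<forall>z\<in>{x, y}. \<forall>b<n. upd2 c x y 0 z b = card (adj (E - {{x, y}}) z) + (4 * Av i + 1 + 4 * (Av i div N)) \<longrightarrow>
        (\<exists>j<reg s' ''t''. mem s' ''qa'' j = z \<and> mem s' ''qb'' j = b)) \<Longrightarrow> Q t' s'"
  shows "wp w (delete_edge N) Q t s"
proof (rule wp_frame)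
  let ?Q = "\<lambda>t' s'. t \<le> t' \<longrightarrow> frame s s' (wr (delete_edge N)) (wm (delete_edge N)) \<longrightarrow> Q t' s'"
  define lv where "lv = mem s ''lev''"
  define E' where "E' = E - {{x, y}}"
  define c' where "c' = upd2 c x y 0"
  define q where "q = reg s ''t''"
  have B: "glob s" "wfE E" "okc c" "cedge E c" "\<forall>v<n. lv v \<le> L" "rep (mem s) c (elm lv)"
    using b unfolding base_def lv_def by auto
  have "y \<in> adj E x" using x(6) by (simp add: adj_def)
  then have "c x y \<noteq> 0" using cedgeD[OF B(4) x(3,4)] by simp
  then obtain k where k: "c x y = Suc k" by (cases "c x y") auto
  have kW: "Suc k < WW" using okc_le[OF B(3) x(3,4)] k L_WW by linarith
  have col: "mem s ''color'' (x * n + y) = Suc k" using rep_color[OF B(6) x(3,4)] k by simp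
  define s1 where "s1 = s\<lparr>reg := (reg s)(''x'' := x, ''y'' := y, ''k'' := k, ''l'' := elm lv x y, ''m'' := lv y)\<rparr>"
  have g1: "glob s1" using B(1) by (simp add: s1_def)
  have pre: "wp w (''x'' ::= Reg ''u'' ;; ''y'' ::= Reg ''v'' ;;
     ''k'' ::= Load ''color'' (caddr (Reg ''x'') (Reg ''y'')) -. Const 1 ;;
     ''l'' ::= Load ''lev'' (Reg ''x'') ;; ''m'' ::= Load ''lev'' (Reg ''y'') ;;
     Cond (Reg ''m'' <. Reg ''l'') (''l'' ::= Reg ''m'') Skip ;; d) F t s"
    if "\<And>t3 s3'. t3 \<le> t + 40 \<Longrightarrow> s3' = s1 \<Longrightarrow> wp w d F t3 s3'" for d F
    using x B(1) col kW
    by (simp add: lv_def[symmetric]) (intro conjI impI; rule that; simp add: s1_def elm_def min_def fun_upd_twist)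
  show "wp w (delete_edge N) ?Q t s"
    unfolding delete_edge_def
  proof (rule pre, hypsubst, unfold wp_Seq[of w unset_color] wp_Seq[of w "''j'' ::= Const 0"] wp_Assign[of w "''j''" "Const 0"] delete_edge_def[symmetric],
      rule unset_color_wp[where x = x and y = y and k = k and l = "elm lv x y" and c = c and el = "elm lv"], goal_cases)
    case (14 t3 s3' t4 s4)
    note A = 14
    have g4: "glob s4" by (rule glob_frame[OF A(3) g1]) auto
    have "cedge E' c'" unfolding cedge_def
    proof (intro allI impI)
      fix a d assume ad: "a < n" "d < n"
      show "(c' a d \<noteq> 0) = (d \<in> adj E' a)"
        unfolding E'_def c'_def adj_delete[OF x(5)] using cedgeD[OF B(4) ad] x(5) by (auto simp: upd2_def)
    qed
    moreover have "mem s4 ''lev'' = lv" using A(3) by (simp add: frame_def s1_def lv_def)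
    ultimately have b4: "base E' c' s4"
      using g4 wfE_delete[OF B(2)] A(4,5) B(5) by (simp add: base_def E'_def c'_def)
    have r4: "reg s4 ''u'' = x" "reg s4 ''v'' = y" "reg s4 ''t'' = q" "mem s4 ''qa'' = mem s ''qa''" "mem s4 ''qb'' = mem s ''qb''"
      using A(3) x by (simp_all add: frame_def s1_def q_def)
    define H where "H i s' \<longleftrightarrow> (\<forall>z\<in>{x, y}. \<forall>b<n. c' z b = card (adj E' z) + (4 * Av i + 1 + 4 * (Av i div N)) \<longrightarrow>
        (\<exists>j<reg s' ''t''. mem s' ''qa'' j = z \<and> mem s' ''qb'' j = b))" for i and s' :: state
    define I where "I = (\<lambda>t' (s'::state). base E' c' s' \<and> validq s' \<and> reg s' ''j'' \<le> J + 1 \<and> t' \<le> t4 + 2 + 160 * reg s' ''j'' \<and>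
       q \<le> reg s' ''t'' \<and> reg s' ''t'' \<le> q + 2 * reg s' ''j'' \<and>
       (\<forall>j<q. mem s' ''qa'' j = mem s ''qa'' j \<and> mem s' ''qb'' j = mem s ''qb'' j) \<and> (\<forall>i<reg s' ''j''. H i s'))"
    have JW: "J + 2 < WW" using W by simp
    show ?case
    proof (rule wp_While[where I = I and Bd = "t4 + 2 + 160 * (J + 1)"], goal_cases)
      case 1
      have "base E' c' (s4\<lparr>reg := (reg s4)(''j'' := expr_val w (Const 0) s4)\<rparr>)" by (rule base_frame[OF _ b4, of _ "{''j''}" "{}"]) (auto simp: frame_def)
      then show ?case using v r4 by (simp add: I_def validq_def q_def)
    next
      case (2 t' s')
      then show ?case by (auto simp: I_def)
    next
      case (3 t' s')
      define j where "j = reg s' ''j''"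
      have I: "base E' c' s'" "validq s'" "t' \<le> t4 + 2 + 160 * j" "q \<le> reg s' ''t''" "reg s' ''t'' \<le> q + 2 * j"
        "\<forall>j<q. mem s' ''qa'' j = mem s ''qa'' j \<and> mem s' ''qb'' j = mem s ''qb'' j" "\<forall>i<j. H i s'"
        using 3(1) unfolding I_def j_def by auto
      have g': "glob s'" using I(1) by (simp add: base_def)
      have jJ: "j \<le> J" using 3(3) JW globD(6)[OF g'] by (simp add: j_def)
      have r': "reg s' ''u'' = x" "reg s' ''v'' = y" using 3(2) r4 by (simp_all add: frame_def)
      have tab: "mem s' ''tab'' j = Av j" using g' jJ by (simp add: glob_def)
      let ?s1 = "s'\<lparr>reg := (reg s')(''a'' := Av j, ''x'' := x)\<rparr>"
      have b1: "base E' c' ?s1" by (rule base_frame[OF _ I(1), of _ "{''a'', ''x''}" "{}"]) (auto simp: frame_def)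
      have tW: "reg s' ''t'' + 2 < WW" using I(5) jJ W unfolding q_def by simp
      have "wp w (probe N) (wp w (''x'' ::= Reg ''v'' ;; probe N ;; ''j'' ::= Reg ''j'' +. Const 1) I) (t' + 11) ?s1"
      proof (rule probe_wp[OF b1, where x = x and a = "Av j"], goal_cases)
        case (7 t2 s2)
        note P1 = 7
        have r2: "reg s2 ''v'' = y" "reg s2 ''a'' = Av j" "reg s2 ''j'' = j" using P1(2) r' by (auto simp: frame_def j_def)
        let ?s3 = "s2\<lparr>reg := (reg s2)(''x'' := y)\<rparr>"
        have b2: "base E' c' s2" by (rule base_frame[OF P1(2) b1]) auto
        have b3: "base E' c' ?s3" by (rule base_frame[OF _ b2, of _ "{''x''}" "{}"]) (auto simp: frame_def)
        have "wp w (probe N) (wp w (''j'' ::= Reg ''j'' +. Const 1) I) (t2 + 2) ?s3"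
        proof (rule probe_wp[OF b3, where x = y and a = "Av j"], goal_cases)
          case (7 t5 s5)
          note P2 = 7
          have r5: "reg s5 ''j'' = j" using P2(2) r2 by (auto simp: frame_def)
          let ?s6 = "s5\<lparr>reg := (reg s5)(''j'' := Suc j)\<rparr>"
          have b5: "base E' c' s5" by (rule base_frame[OF P2(2) b3]) auto
          have b6: "base E' c' ?s6" by (rule base_frame[OF _ b5, of _ "{''j''}" "{}"]) (auto simp: frame_def)
          have old2: "mem s5 ''qa'' i = mem s2 ''qa'' i" "mem s5 ''qb'' i = mem s2 ''qb'' i" if "i < reg s2 ''t''" for i
            using P2(6) that by auto
          have old1: "mem s2 ''qa'' i = mem s' ''qa'' i" "mem s2 ''qb'' i = mem s' ''qb'' i" if "i < reg s' ''t''" for i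
            using P1(6) that by auto
          have tt: "reg s' ''t'' \<le> reg s2 ''t''" "reg s2 ''t'' \<le> reg s5 ''t''" "reg s5 ''t'' \<le> reg s' ''t'' + 2"
            using P1(4,5) P2(4,5) by auto
          have ex5: "\<exists>i<reg s5 ''t''. mem s5 ''qa'' i = z \<and> mem s5 ''qb'' i = b"
            if ex: "\<exists>i<reg s2 ''t''. mem s2 ''qa'' i = z \<and> mem s2 ''qb'' i = b" for z b
          proof -
            obtain i where i: "i < reg s2 ''t''" "mem s2 ''qa'' i = z" "mem s2 ''qb'' i = b" using ex by blast
            then show ?thesis using tt(2) old2[OF i(1)] by (intro exI[of _ i]) auto
          qed
          have ex2: "\<exists>i<reg s2 ''t''. mem s2 ''qa'' i = z \<and> mem s2 ''qb'' i = b"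
            if ex: "\<exists>i<reg s' ''t''. mem s' ''qa'' i = z \<and> mem s' ''qb'' i = b" for z b
          proof -
            obtain i where i: "i < reg s' ''t''" "mem s' ''qa'' i = z" "mem s' ''qb'' i = b" using ex by blast
            then show ?thesis using tt(1) old1[OF i(1)] by (intro exI[of _ i]) auto
          qed
          have "H i s5" if "i < Suc j" for i
          proof (cases "i = j")
            case False
            then have "H i s'" using that I(7) by simp
            then show ?thesis unfolding H_def using ex2 ex5 by blast
          next
            case True
            have "\<exists>i<reg s5 ''t''. mem s5 ''qa'' i = x \<and> mem s5 ''qb'' i = b"
              if "b < n" "c' x b = card (adj E' x) + (4 * Av j + 1 + 4 * (Av j div N))" for b
              using P1(7) that by (intro ex5) blast
            moreover have "\<exists>i<reg s5 ''t''. mem s5 ''qa'' i = y \<and> mem s5 ''qb'' i = b"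
              if "b < n" "c' y b = card (adj E' y) + (4 * Av j + 1 + 4 * (Av j div N))" for b
              using P2(7) that by blast
            ultimately show ?thesis unfolding H_def True by blast
          qed
          then have Hs: "\<forall>i<Suc j. H i ?s6" by (simp add: H_def)
          have "\<forall>i<q. mem s5 ''qa'' i = mem s ''qa'' i \<and> mem s5 ''qb'' i = mem s ''qb'' i"
            using old2 old1 I(4,6) tt(1) by auto
          then have "I (t5 + 4) ?s6" unfolding I_def
            using b6 P2(3) jJ P1(1) P2(1) I(3,4,5) tt Hs by (simp add: validq_def)
          then show ?case using r5 JW jJ by (simp add: numeral_eq_Suc)
        qed (use r2 x(4) Av_le[of j] P1(3,5) tW in \<open>auto simp: validq_def\<close>)
        then show ?case using r2 by (simp add: numeral_eq_Suc)
      qed (use x(3) Av_le[of j] I(2) tW in \<open>auto simp: validq_def\<close>)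
      then show ?case using r' tab by (simp add: j_def numeral_eq_Suc)
    next
      case (4 t' s')
      have I: "base E' c' s'" "validq s'" "reg s' ''j'' \<le> J + 1" "t' \<le> t4 + 2 + 160 * reg s' ''j''" "q \<le> reg s' ''t''" "reg s' ''t'' \<le> q + 2 * reg s' ''j''"
        "\<forall>j<q. mem s' ''qa'' j = mem s ''qa'' j \<and> mem s' ''qb'' j = mem s ''qb'' j" "\<forall>i<reg s' ''j''. H i s'"
        using 4(1) unfolding I_def by auto
      have g': "glob s'" using I(1) by (simp add: base_def)
      have j: "reg s' ''j'' = J + 1" using 4(3) I(3) JW globD(6)[OF g'] by simp
      have "\<forall>i\<le>J. H i s'" using I(8) unfolding j by auto
      then have "\<forall>i\<le>J. \<forall>z\<in>{x, y}. \<forall>b<n. upd2 c x y 0 z b = card (adj (E - {{x, y}}) z) + (4 * Av i + 1 + 4 * (Av i div N)) \<longrightarrow>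
        (\<exists>j<reg s' ''t''. mem s' ''qa'' j = z \<and> mem s' ''qb'' j = b)" unfolding H_def E'_def c'_def .
      then show ?case using I j A(1,2) K_ge2
        by (intro impI Q) (simp_all add: E'_def c'_def q_def)
    qed
  qed (use g1 x(3,4) B(3,5,6) k in \<open>auto simp: s1_def elm_sym\<close>, auto simp: elm_def)
qed

lemma init_wp:
  assumes n: "reg s ''n'' = n" and m0: "mem s = (\<lambda>_ _. 0)" and Kmin: "\<And>j. j < K \<Longrightarrow> 2 ^ j < 2 * n"
    and Q: "\<And>t' s'. t' \<le> t + 100 * K + 100 * J \<Longrightarrow> frame s s' (wr (init N)) (wm (init N)) \<Longrightarrow> glob s' \<Longrightarrow> Q t' s'"
  shows "wp w (init N) Q t s"
proof (rule wp_frame)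
  let ?Q = "\<lambda>t' s'. t \<le> t' \<longrightarrow> frame s s' (wr (init N)) (wm (init N)) \<longrightarrow> Q t' s'"
  define I where "I = (\<lambda>t' (s'::state). \<exists>j\<le>K. reg s' ''M'' = 2 ^ j \<and> reg s' ''K'' = j \<and> t' \<le> t + 4 + 20 * j)"
  have W: "100 * M < WW" "N < WW" "L + 2 + 2 * M < WW" using B_bounds WW_B(1,2) N1 by (simp_all add: B_def)
  have nW: "2 * n < WW" using B_bounds W by linarith
  have RL: "R \<le> L" "J \<le> L" using RJ_pos by (simp_all add: L_def)
  have KM: "K \<le> M" unfolding M_def by (metis less_exp less_imp_le_nat)
  define I2 where "I2 = (\<lambda>t' (s'::state). \<exists>j\<le>J. reg s' ''j'' = j \<and> (\<forall>i\<le>j. mem s' ''tab'' i = Av i) \<and> t' \<le> t + 60 + 20 * K + 35 * j)"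
  show "wp w (init N) ?Q t s"
    unfolding init_def wp_Seq[of w "''M'' ::= Const 1"] wp_Seq[of w "''K'' ::= Const 0"] wp_Seq[of w "While _ _"] wp_Assign[of w "''M''" "Const 1"] wp_Assign[of w "''K''" "Const 0"]
    unfolding init_def[symmetric]
  proof (rule wp_While[where I = I and Bd = "t + 4 + 20 * K"], goal_cases)
    case 1
    show ?case unfolding I_def by (intro exI[of _ 0]) simp
  next
    case (2 t' s')
    then show ?case by (auto simp: I_def)
  next
    case (3 t' s')
    then obtain j where j: "j \<le> K" "reg s' ''M'' = 2 ^ j" "reg s' ''K'' = j" "t' \<le> t + 4 + 20 * j" by (auto simp: I_def)
    have n': "reg s' ''n'' = n" using 3(2) n by (simp add: frame_def)
    have lt: "(2::nat) ^ j < 2 * n" using 3(3) j n' nW by simp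
    have "j \<noteq> K" using lt K2n by auto
    then have "Suc j \<le> K" using j by simp
    moreover have "(2::nat) ^ j * 2 < WW" "Suc j < WW" using lt nW B_bounds W KM \<open>Suc j \<le> K\<close> by linarith+
    ultimately show ?case using j unfolding I_def by (simp add: mult.commute)
  next
    case (4 t' s')
    then obtain j where j: "j \<le> K" "reg s' ''M'' = 2 ^ j" "reg s' ''K'' = j" "t' \<le> t + 4 + 20 * j" by (auto simp: I_def)
    have n': "reg s' ''n'' = n" using 4(2) n by (simp add: frame_def)
    have ge: "\<not> (2::nat) ^ j < 2 * n" using 4(3) j n' nW by simp
    \<comment> \<open>Minimality of \<open>K\<close> guarantees that the doubling loop does not stop
      earlier.\<close>
    have "j = K" using Kmin[of j] ge j(1) by (cases "j < K") auto
    then have r: "reg s' ''M'' = M" "reg s' ''K'' = K" "t' \<le> t + 4 + 20 * K" using j by (simp_all add: M_def)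
    have m': "mem s' = (\<lambda>_ _. 0)" using 4(2) m0 by (auto simp: frame_def fun_eq_iff)
    define s2 where "s2 = s'\<lparr>reg := (reg s')(''R'' := R, ''J'' := J, ''L'' := L, ''B'' := B, ''1'' := 1, ''j'' := 0), mem := (mem s')(''tab'' := (mem s' ''tab'')(0 := 1))\<rparr>"
    have ev: "2 * N < WW" "2 * N * K < WW" "N * K < WW" "R * J < WW" "L + 2 < WW" "2 * M < WW"
      using W RL WW_B(2) N1 unfolding R_def[symmetric] J_def[symmetric] L_def[symmetric] by linarith+
    have pre: "wp w (''R'' ::= Const 2 *. Const N *. Reg ''K'' ;; ''J'' ::= Const N *. Reg ''K'' ;;
     ''L'' ::= Reg ''R'' *. Reg ''J'' ;; ''B'' ::= Reg ''L'' +. Const 2 +. Const 2 *. Reg ''M'' ;;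
     ''1'' ::= Const 1 ;;
     Store ''tab'' (Const 0) (Const 1) ;; ''j'' ::= Const 0 ;; d) F (t' + 6) s'"
      if "\<And>t3 s3'. t3 \<le> t' + 50 \<Longrightarrow> s3' = s2 \<Longrightarrow> wp w d F t3 s3'" for d F
      using ev W r
      by (simp add: ev_Const R_def[symmetric] J_def[symmetric] L_def[symmetric]) (rule that; simp add: s2_def B_def)
    have e6: "1 + expr_time (Reg ''M'' <. Const 2 *. Reg ''n'') = 6" by simp
    show ?case
      unfolding e6
    proof (rule pre, hypsubst, rule wp_While[where I = I2 and Bd = "t + 60 + 20 * K + 35 * J"], goal_cases)
      case (1 t3 s3')
      then show ?case unfolding I2_def using r by (intro exI[of _ 0]) (simp add: s2_def Av_0)
    next
      case (2 t3 s3' t5 s5)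
      then show ?case by (auto simp: I2_def)
    next
      case (3 t3 s3' t5 s5)
      then obtain j where j: "j \<le> J" "reg s5 ''j'' = j" "\<forall>i\<le>j. mem s5 ''tab'' i = Av i" "t5 \<le> t + 60 + 20 * K + 35 * j"
        by (auto simp: I2_def)
      have r5: "reg s5 ''J'' = J" "reg s5 ''M'' = M" using 3(3) r by (simp_all add: frame_def s2_def)
      have jJ: "Suc j \<le> J" using 3(4) j(2) r5 by simp
      have jW: "Suc j < WW" using jJ RL W by linarith
      have tj: "mem s5 ''tab'' j = Av j" using j(3) by simp
      define dq where "dq = Av j div N"
      have dq: "dq \<le> Av j" by (simp add: dq_def)
      have aW: "Av j + 1 < WW" "Av j + 1 + dq < WW" using Av_le[of j] dq W B_bounds by linarith+
      show ?case
      proof (cases "Av j < M")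
        case True
        let ?s6 = "s5\<lparr>reg := (reg s5)(''a'' := Av j, ''j'' := Suc j), mem := (mem s5)(''tab'' := (mem s5 ''tab'')(Suc j := Av j + 1 + dq))\<rparr>"
        have "I2 t6 ?s6" if "t6 \<le> t5 + 30" for t6
          unfolding I2_def using jJ j True that by (intro exI[of _ "Suc j"]) (auto simp: le_Suc_eq Av_Suc dq_def)
        then show ?thesis using True j tj r5 jW aW W by (simp add: ev_Const dq_def[symmetric])
      next
        case False
        let ?s6 = "s5\<lparr>reg := (reg s5)(''a'' := Av j, ''j'' := Suc j), mem := (mem s5)(''tab'' := (mem s5 ''tab'')(Suc j := Av j))\<rparr>"
        have "I2 t6 ?s6" if "t6 \<le> t5 + 30" for t6
          unfolding I2_def using jJ j False that by (intro exI[of _ "Suc j"]) (auto simp: le_Suc_eq Av_Suc)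
        then show ?thesis using False j tj r5 jW aW W by (simp add: ev_Const)
      qed
    next
      case (4 t3 s3' t5 s5)
      then obtain j where j: "j \<le> J" "reg s5 ''j'' = j" "\<forall>i\<le>j. mem s5 ''tab'' i = Av i" "t5 \<le> t + 60 + 20 * K + 35 * j"
        by (auto simp: I2_def)
      have r5: "reg s5 ''J'' = J" "reg s5 ''M'' = M" "reg s5 ''L'' = L" "reg s5 ''B'' = B" "reg s5 ''R'' = R" "reg s5 ''n'' = n" "reg s5 ''1'' = 1"
        using 4(3) r n' by (simp_all add: frame_def s2_def)
      have jJ: "j = J" using 4(4) j r5 by simp
      have "glob s5" using r5 j(3) unfolding jJ by (simp add: glob_def)
      then show ?case using j(4) K_ge2 RJ_pos unfolding jJ by (intro impI Q) simp_all
    qed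
  qed
qed

end

section \<open>One update\<close>

text \<open>The updated pair is always the first queue entry: only its endpoints change their
  degrees and can lose stability, and after an insertion only this edge can be bad.\<close>

definition update :: "nat \<Rightarrow> com" where
  "update N =
    (''t'' ::= Const 0 ;; ''x'' ::= Reg ''u'' ;; ''y'' ::= Reg ''v'' ;; push ;;
     Cond (Reg ''op'') insert_edge (delete_edge N) ;; phase1 N ;; phase2 N)"

definition program :: "nat \<Rightarrow> com" where
  "program N = (Cond (Reg ''1'') Skip (init N) ;; update N)"

context ctx begin

definition full :: "edge set \<Rightarrow> (nat \<Rightarrow> nat \<Rightarrow> nat) \<Rightarrow> state \<Rightarrow> bool" where
  "full E c s \<longleftrightarrow> base E c s \<and> (\<forall>v<n. stable E (mem s ''lev'') v) \<and>
     (\<forall>a<n. \<forall>b\<in>adj E a. \<not> bad E (mem s ''lev'') c a b)"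

text \<open>Covers, for both kinds of updates at once, the rise of the potential and the queue
  entries made before the phases, at most \<open>2 * J + 3\<close> for a deletion, with some slack
  for the update itself.\<close>

definition "charge = 2 * (4 * L + 2) + 2 * (16 * N * L) + 2 * J + 8"

lemma Dset_trans: "card (Dset c c'') \<le> card (Dset c c') + card (Dset c' c'')"
proof -
  have "Dset c c'' \<subseteq> Dset c c' \<union> Dset c' c''" by (force simp: Dset_def)
  then have "card (Dset c c'') \<le> card (Dset c c' \<union> Dset c' c'')" by (intro card_mono) (simp_all add: Dset_finite)
  also have "\<dots> \<le> card (Dset c c') + card (Dset c' c'')" by (rule card_Un_le)
  finally show ?thesis .
qed

lemma phases_wp:
  assumes b: "base E c s" and v: "validq s" and u: "unstq E 0 s" and bq: "badq E c 0 s"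
    and q: "reg s ''t'' \<le> 2 * J + 3"
    and Q: "\<And>t' s' c' d. full E c' s' \<Longrightarrow> pot E (mem s' ''lev'') + d \<le> pot E (mem s ''lev'') + 2 * J + 3 \<Longrightarrow>
      card (Dset c c') \<le> 2 * (L + 2) * d \<Longrightarrow> t' \<le> t + 20 + 1750 * (K * (L + 2) * d) \<Longrightarrow> Q t' s'"
  shows "wp w (phase1 N ;; phase2 N) Q t s"
proof -
  have wf: "wfE E" and lvL: "\<And>v. v < n \<Longrightarrow> mem s ''lev'' v \<le> L" using b by (auto simp: base_def)
  have pb: "pot E (mem s ''lev'') \<le> 400 * (N * B ^ 3)" using pot_bound[OF wf lvL] by (simp add: mult.assoc)
  have BN: "B \<le> N * B ^ 3"
  proof -
    have "1 * B ^ 1 \<le> N * B ^ 3" using N1 B_bounds by (intro mult_mono power_increasing) auto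
    then show ?thesis by simp
  qed
  have "J \<le> L" using RJ_pos by (simp add: L_def)
  then have JB: "2 * J + 3 \<le> 3 * B" using B_bounds by linarith
  have "1000 * (N * B ^ 3) \<le> WW" using WW_big by (simp add: mult.assoc)
  then have W: "reg s ''t'' + pot E (mem s ''lev'') < WW" using pb BN JB q B_bounds(5) by linarith
  show ?thesis unfolding wp_Seq
  proof (rule phase1_wp[OF b v u bq W], goal_cases)
    case (1 t4 s4)
    note A = 1
    define p where "p = pot E (mem s ''lev'')"
    define p4 where "p4 = pot E (mem s4 ''lev'')"
    define q4 where "q4 = reg s4 ''t''"
    \<comment> \<open>The initial queue length plus the potential that the level phase consumes. It
      bounds the final queue length as well, so both phases are charged to it: 1200 in the level
      phase, 600 each for potential and queue, and 550 in the color phase.\<close>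
    define d where "d = reg s ''t'' + p - p4"
    have d: "d + p4 = reg s ''t'' + p" "q4 \<le> d" "p \<le> d + p4" using A(6) unfolding d_def p_def p4_def q4_def by linarith+
    show ?case
    proof (rule phase2_wp[OF A(1) refl A(4) A(2,3)], goal_cases)
      case 1
      then show ?case using A(6) W by linarith
    next
      case (2 t5 s5 c5)
      have l5: "mem s5 ''lev'' = mem s4 ''lev''" using 2(2) by (simp add: frame_def)
      have f: "full E c5 s5" unfolding full_def l5 using 2(3,4) A(4) by blast
      have m1: "2 * (L + 2) * q4 \<le> 2 * (L + 2) * d" using d by (intro mult_le_mono2)
      have "550 * K * (L + 2) * q4 \<le> 550 * K * (L + 2) * d" using d by (intro mult_le_mono2)
      then have m2: "550 * K * (L + 2) * q4 \<le> 550 * (K * (L + 2) * d)" by (simp only: mult.assoc)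
      have "600 * K * (p + q4) \<le> 600 * K * (p4 + 2 * d)" using d by (intro mult_le_mono2) linarith
      moreover have "600 * K * (p4 + 2 * d) = 600 * K * p4 + 1200 * (K * d)" by (simp add: algebra_simps)
      ultimately have m3: "600 * K * (p + q4) \<le> 600 * K * p4 + 1200 * (K * d)" by linarith
      have "K * 1 * d \<le> K * (L + 2) * d" by (intro mult_le_mono1 mult_le_mono2) simp
      then have m4: "K * d \<le> K * (L + 2) * d" by simp
      have "t5 \<le> t + 20 + 1750 * (K * (L + 2) * d)"
        using 2(1) A(7) m2 m3 m4 unfolding p_def[symmetric] p4_def[symmetric] q4_def[symmetric] by linarith
      moreover have "card (Dset c c5) \<le> 2 * (L + 2) * d" using 2(5) m1 unfolding q4_def[symmetric] by (rule order_trans)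
      moreover have "pot E (mem s5 ''lev'') + d \<le> pot E (mem s ''lev'') + 2 * J + 3"
        using d(1) q unfolding l5 p_def p4_def by linarith
      ultimately show ?case using f by (intro Q[of c5 s5 d])
    qed
  qed
qed

lemma stable_cong: "adj E' v = adj E v \<Longrightarrow> stable E' lv v = stable E lv v"
  by (simp add: stable_def dg_def)

lemma update_wp:
  assumes f: "full E c s" and up: "valid_update n E up"
    and op: "case up of Insert x y \<Rightarrow> reg s ''op'' = 1 \<and> reg s ''u'' = x \<and> reg s ''v'' = y | Delete x y \<Rightarrow> reg s ''op'' = 0 \<and> reg s ''u'' = x \<and> reg s ''v'' = y"
    and Q: "\<And>t' s' c' m. full (apply_update up E) c' s' \<Longrightarrow> pot (apply_update up E) (mem s' ''lev'') + m \<le> pot E (mem s ''lev'') + charge \<Longrightarrow>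
      card (Dset c c') \<le> 2 * (L + 2) * m \<Longrightarrow> t' \<le> t + 2500 * (K * (L + 2) * m) \<Longrightarrow> 1 \<le> m \<Longrightarrow> Q t' s'"
  shows "wp w (update N) Q t s"
proof -
  define lv where "lv = mem s ''lev''"
  obtain x y where xy: "up = Insert x y \<or> up = Delete x y" by (cases up) auto
  have v: "x < n" "y < n" "x \<noteq> y" using up xy by auto
  have r: "reg s ''u'' = x" "reg s ''v'' = y" using op xy by auto
  have b: "base E c s" and st: "\<forall>v<n. stable E lv v" and nb: "\<forall>a<n. \<forall>b\<in>adj E a. \<not> bad E lv c a b"
    using f by (auto simp: full_def lv_def)
  have B: "glob s" "wfE E" "okc c" "cedge E c" "\<forall>v<n. lv v \<le> L"
    using b unfolding base_def lv_def by auto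
  define E' where "E' = apply_update up E"
  have JL: "J \<le> L" using RJ_pos by (simp add: L_def)
  define s1 where "s1 = s\<lparr>mem := (mem s)(''qa'' := (mem s ''qa'')(0 := x), ''qb'' := (mem s ''qb'')(0 := y)), reg := (reg s)(''x'' := x, ''y'' := y, ''t'' := 1)\<rparr>"
  have f1: "frame s s1 {''x'', ''y'', ''t''} {''qa'', ''qb''}" by (simp add: frame_def s1_def)
  have b1: "base E c s1" by (rule base_frame[OF f1 b]) auto
  have v1: "validq s1" using v by (simp add: validq_def s1_def)
  have JW: "1 + 2 * (J + 1) < WW" using JL B_bounds WW_B(1) by simp
  have tail: "wp w (phase1 N ;; phase2 N) Q t3 s3"
    if h: "base E' c1 s3" "validq s3" "badq E' c1 0 s3" "1 \<le> reg s3 ''t''" "reg s3 ''t'' \<le> 2 * J + 3" "mem s3 ''qa'' 0 = x" "mem s3 ''qb'' 0 = y"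
      "mem s3 ''lev'' = lv" "t3 \<le> t + 40 + 320 * K + 200 * (J + 1)" "pot E' lv + 5 \<le> pot E lv + charge - 2 * J + 1" "2 * J + 5 \<le> charge" "card (Dset c c1) \<le> 1"
      "\<And>z. z \<noteq> x \<Longrightarrow> z \<noteq> y \<Longrightarrow> adj E' z = adj E z" for t3 s3 c1
  proof (rule phases_wp[OF h(1,2) _ h(3,5)], goal_cases)
    case 1
    show ?case unfolding unstq_def h(8)
    proof (intro allI impI)
      fix z assume z: "z < n" "\<not> stable E' lv z"
      then have "z = x \<or> z = y" using stable_cong[OF h(13), of z lv] st by blast
      then show "\<exists>j. 0 \<le> j \<and> j < reg s3 ''t'' \<and> (mem s3 ''qa'' j = z \<or> mem s3 ''qb'' j = z)"
        using h(4,6,7) by (intro exI[of _ 0]) auto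
    qed
  next
    case (2 t5 s5 c5 d)
    \<comment> \<open>The unit added to \<open>d\<close> pays for the insertion or deletion itself:
      its one color change and the time before the phases.\<close>
    have k1: "K * (L + 2) * (d + 1) = K * (L + 2) * d + K * (L + 2)" by (simp add: algebra_simps)
    have k2: "K * 1 \<le> K * (L + 2)" by (intro mult_le_mono2) simp
    have k3: "2 * (L + 2) \<le> K * (L + 2)" using K_ge2 by (intro mult_le_mono1)
    have aux: "t5 \<le> t + 2500 * Z" if "t5 \<le> t3 + 20 + 1750 * Y" "Z = Y + X" "K * 1 \<le> X" "2 * (L + 2) \<le> X" for X Y Z
      using that h(9) JL K_ge2 by simp
    have "t5 \<le> t + 2500 * (K * (L + 2) * (d + 1))" by (rule aux[OF 2(4) k1 k2 k3])
    moreover have "card (Dset c c5) \<le> 2 * (L + 2) * (d + 1)"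
    proof -
      have "2 * (L + 2) * (d + 1) = 2 * (L + 2) * d + 2 * (L + 2)" by (simp add: algebra_simps)
      moreover have "1 \<le> 2 * (L + 2)" by simp
      ultimately show ?thesis using Dset_trans[of c c5 c1] 2(3) h(12) by linarith
    qed
    moreover have "pot E' (mem s5 ''lev'') + (d + 1) \<le> pot E lv + charge"
      using 2(2) h(10,11) unfolding h(8) by linarith
    ultimately show ?case using 2(1) by (intro Q[of c5 s5 "d + 1"]) (simp_all add: E'_def lv_def)
  qed
  have pre: "wp w (''t'' ::= Const 0 ;; ''x'' ::= Reg ''u'' ;; ''y'' ::= Reg ''v'' ;; push ;; d) F t s"
    if "\<And>t3 s3'. t3 = t + 16 \<Longrightarrow> s3' = s1 \<Longrightarrow> wp w d F t3 s3'" for d F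
    using r WW1000 by (simp add: push_def) (rule that; simp add: s1_def fun_upd_twist)
  have r1: "reg s1 ''u'' = x" "reg s1 ''v'' = y" "reg s1 ''t'' = 1" "reg s1 ''op'' = reg s ''op''"
    "mem s1 ''lev'' = lv" "mem s1 ''qa'' 0 = x" "mem s1 ''qb'' 0 = y"
    using r by (simp_all add: s1_def lv_def)
  have D1: "card (Dset c (upd2 c x y k)) \<le> 1" for k using Dset_upd2[of c c x y k] by (simp add: Dset_self)
  show ?thesis
    using xy
  proof
    assume ins: "up = Insert x y"
    then have nE: "{x, y} \<notin> E" and o: "reg s ''op'' \<noteq> 0" using up op by auto
    have E': "E' = insert {x, y} E" using ins by (simp add: E'_def)
    have "wp w insert_edge (wp w (phase1 N ;; phase2 N) Q) (t + 18) s1"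
    proof (rule insert_edge_wp[OF b1 r1(1,2) v nE], goal_cases)
      case (1 t3 s3 k)
      have r3: "reg s3 ''t'' = 1" "mem s3 ''lev'' = lv" "mem s3 ''qa'' 0 = x" "mem s3 ''qb'' 0 = y"
        using 1(2) r1 by (simp_all add: frame_def)
      show ?case
      proof (rule tail[where ?c1.0 = "upd2 c x y (Suc k)"], goal_cases)
        case 2
        then show ?case using r3 v by (simp add: validq_def)
      next
        case 3
        show ?case unfolding badq_def r3
        proof (intro allI impI ballI)
          fix a d assume ad: "a < n" "d \<in> adj E' a" "bad E' lv (upd2 c x y (Suc k)) a d"
          \<comment> \<open>An insertion only raises degrees and leaves levels and the other colors
            alone, so an old edge cannot become bad.\<close>
          have "{a, d} = {x, y}"
          proof (rule ccontr)
            assume ne: "{a, d} \<noteq> {x, y}"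
            then have dE: "d \<in> adj E a" using ad(2) by (simp add: E' adj_def)
            have c: "upd2 c x y (Suc k) a d = c a d" using ne by (auto simp: upd2_def)
            have le: "card (adj E z) \<le> card (adj E' z)" for z
              by (rule card_mono[OF adj_finite]) (use wfE_insert[OF B(2) v(3,1,2)] in \<open>auto simp: E' adj_def\<close>)
            have "bad E lv c a d" using ad(3) le[of a] le[of d] unfolding bad_def c by linarith
            then show False using nb ad(1) dE by blast
          qed
          then show "\<exists>j. 0 \<le> j \<and> j < 1 \<and> {mem s3 ''qa'' j, mem s3 ''qb'' j} = {a, d}" using r3 by (intro exI[of _ 0]) simp
        qed
      next
        case 10
        have "pot E' lv \<le> pot E lv + 2 * (4 * L + 2)" unfolding E' by (rule pot_insert[OF B(2) v nE])
        then show ?case unfolding charge_def by simp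
      next
        case (13 z)
        then show ?case by (simp add: E' adj_insert[OF v(3)])
      qed (use 1 r3 D1 in \<open>simp_all add: E' charge_def\<close>)
    qed
    then have *: "wp w (Cond (Reg ''op'') insert_edge (delete_edge N)) (wp w (phase1 N ;; phase2 N) Q) (t + 16) s1"
      unfolding wp_Cond[of w "Reg ''op''"] using o r1 by (simp add: numeral_eq_Suc del: wp_Seq)
    show ?thesis unfolding update_def by (rule pre, hypsubst, subst wp_Seq, rule *)
  next
    assume del: "up = Delete x y"
    then have nE: "{x, y} \<in> E" and o: "reg s ''op'' = 0" using up op by auto
    have E': "E' = E - {{x, y}}" using del by (simp add: E'_def)
    have W1: "reg s1 ''t'' + 2 * (J + 1) < WW" using JW r1 by simp
    have "wp w (delete_edge N) (wp w (phase1 N ;; phase2 N) Q) (t + 18) s1"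
    proof (rule delete_edge_wp[OF b1 r1(1,2) v nE W1 v1], goal_cases)
      case (1 t3 s3)
      note A = 1
      have r3: "mem s3 ''lev'' = lv" "mem s3 ''qa'' 0 = x" "mem s3 ''qb'' 0 = y"
        using A(2,7) r1 by (simp_all add: frame_def)
      let ?c = "upd2 c x y 0"
      have wf': "wfE E'" using A(3) by (simp add: base_def E')
      show ?case
      proof (rule tail[where ?c1.0 = ?c], goal_cases)
        case 3
        show ?case unfolding badq_def r3
        proof (intro allI impI ballI)
          fix a d assume ad: "a < n" "d \<in> adj E' a" "bad E' lv ?c a d"
          have dn: "d < n" using adj_lt[OF wf' ad(2)] by simp
          have ne: "{a, d} \<noteq> {x, y}" and dE: "d \<in> adj E a" using ad(2) by (auto simp: E' adj_def)
          have c: "?c a d = c a d" "?c d a = c d a" using ne by (auto simp: upd2_def)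
          have cs: "c a d = c d a" by (rule okc_sym[OF B(3) ad(1) dn])
          define l where "l = min (lv a) (lv d)"
          have lL: "l div R \<le> J" using B(5) ad(1) by (intro lev_div) (auto simp: l_def)
          have deg: "card (adj E z) \<le> card (adj E' z) + (if z = x \<or> z = y then 1 else 0)" for z
          proof -
            have "card (adj E z) \<le> card (adj E' z) + 1"
              unfolding E' adj_delete[OF v(3)] using adj_finite[OF B(2), of z] by (auto simp: card_Diff_singleton_if)
            moreover have "z \<noteq> x \<Longrightarrow> z \<noteq> y \<Longrightarrow> adj E' z = adj E z" by (simp add: E' adj_delete[OF v(3)])
            ultimately show ?thesis by auto
          qed
          have old: "c a d + 1 \<le> max (card (adj E a)) (card (adj E d)) + Ul l"
            using nb ad(1) dE by (auto simp: bad_def l_def not_less)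
          have new: "max (card (adj E' a)) (card (adj E' d)) + Ul l < c a d + 1"
            using ad(3) c by (simp add: bad_def l_def)
          \<comment> \<open>The bound held before and has dropped by at most one, so the color now
            equals degree plus threshold, and this at an endpoint that has lost an edge. This is the
            color for which \<open>delete_edge\<close> has probed.\<close>
          have hit: "(a = x \<or> a = y) \<and> c a d = card (adj E' a) + Ul l \<or> (d = x \<or> d = y) \<and> c a d = card (adj E' d) + Ul l"
            using old new deg[of a] deg[of d] by (simp add: max_def split: if_splits)
          have U: "Ul l = 4 * Av (l div R) + 1 + 4 * (Av (l div R) div N)" by (simp add: Ul_def)
          have find: "\<exists>j<reg s3 ''t''. mem s3 ''qa'' j = z \<and> mem s3 ''qb'' j = z'"
            if "z = x \<or> z = y" "z' < n" "?c z z' = card (adj E' z) + Ul l" for z z'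
            using A(8) lL that unfolding E'[symmetric] U by blast
          from hit show "\<exists>j. 0 \<le> j \<and> j < reg s3 ''t'' \<and> {mem s3 ''qa'' j, mem s3 ''qb'' j} = {a, d}"
          proof
            assume "(a = x \<or> a = y) \<and> c a d = card (adj E' a) + Ul l"
            then obtain j where "j < reg s3 ''t''" "mem s3 ''qa'' j = a" "mem s3 ''qb'' j = d" using find[of a d] dn c by auto
            then show ?thesis by (intro exI[of _ j]) auto
          next
            assume "(d = x \<or> d = y) \<and> c a d = card (adj E' d) + Ul l"
            then obtain j where "j < reg s3 ''t''" "mem s3 ''qa'' j = d" "mem s3 ''qb'' j = a" using find[of d a] ad(1) c cs by auto
            then show ?thesis by (intro exI[of _ j]) auto
          qed
        qed
      next
        case 10
        have "pot E' lv \<le> pot E lv + 2 * (16 * N * L)" unfolding E' by (rule pot_delete[OF B(2) v]) (use B(5) v in auto)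
        then show ?case unfolding charge_def by simp
      next
        case (13 z)
        then show ?case by (simp add: E' adj_delete[OF v(3)])
      qed (use A r1 r3 D1 K_ge2 in \<open>simp_all add: E' charge_def\<close>)
    qed
    then have *: "wp w (Cond (Reg ''op'') insert_edge (delete_edge N)) (wp w (phase1 N ;; phase2 N) Q) (t + 16) s1"
      unfolding wp_Cond[of w "Reg ''op''"] using o r1 by (simp add: numeral_eq_Suc del: wp_Seq)
    show ?thesis unfolding update_def by (rule pre, hypsubst, subst wp_Seq, rule *)
  qed
qed

lemma receive_frame: "frame s (receive up s) {''op'', ''u'', ''v''} {}"
  by (cases up) (auto simp: frame_def)

lemma full_frame:
  assumes "frame s s' X {}" "{''n'', ''M'', ''B'', ''L'', ''R'', ''J'', ''1''} \<inter> X = {}" "full E c s"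
  shows "full E c s'"
proof -
  have "mem s' ''lev'' = mem s ''lev''" using assms(1) by (simp add: frame_def)
  then show ?thesis using base_frame[OF assms(1) _ assms(2)] assms(3) unfolding full_def by auto
qed

text \<open>Memory that is zero represents the empty graph with all nodes on level 0. So
  initialization only computes the constants and the table of parameters, and no array has to be
  cleared.\<close>

lemma full_initial:
  assumes g: "glob s" and m: "\<And>a. a \<noteq> ''tab'' \<Longrightarrow> mem s a = (\<lambda>_. 0)"
  shows "full {} (\<lambda>_ _. 0) s"
proof -
  have "FF (\<lambda>_ _. 0) el x l = {}" for el x l by (simp add: FF_def cols_def)
  then have "rep (mem s) (\<lambda>_ _. 0) el" for el by (simp add: rep_def m forest_def treeset_def)
  then have "base {} (\<lambda>_ _. 0) s"
    using g by (simp add: base_def wfE_def okc_def cedge_def adj_def m)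
  then show ?thesis by (simp add: full_def stable_def dg_def adj_def m)
qed

text \<open>The second alternative is the state before the first update. Its initialization takes
  time at most \<open>100 * K + 100 * J\<close>, which is absorbed because every update has
  \<open>1 \<le> m\<close>.\<close>

lemma program_step:
  assumes Kmin: "\<And>j. j < K \<Longrightarrow> 2 ^ j < 2 * n"
    and inv: "full E c s \<or> s = initial_state n \<and> E = {} \<and> c = (\<lambda>_ _. 0)" and up: "valid_update n E up"
  shows "\<exists>t' s' c' m. exec w (program N) (receive up s) t' s' \<and> full (apply_update up E) c' s' \<and>
    pot (apply_update up E) (mem s' ''lev'') + m \<le> pot E (mem s ''lev'') + charge \<and>
    card (Dset c c') \<le> 2 * (L + 2) * m \<and> t' \<le> 3000 * (K * (L + 2) * m)"
proof -
  let ?r = "receive up s"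
  let ?Q = "\<lambda>t' s'. \<exists>c' m. full (apply_update up E) c' s' \<and>
    pot (apply_update up E) (mem s' ''lev'') + m \<le> pot E (mem s ''lev'') + charge \<and>
    card (Dset c c') \<le> 2 * (L + 2) * m \<and> t' \<le> 3000 * (K * (L + 2) * m)"
  have rop: "case up of Insert x y \<Rightarrow> reg ?r ''op'' = 1 \<and> reg ?r ''u'' = x \<and> reg ?r ''v'' = y | Delete x y \<Rightarrow> reg ?r ''op'' = 0 \<and> reg ?r ''u'' = x \<and> reg ?r ''v'' = y"
    by (cases up) auto
  have upd: "wp w (update N) ?Q t1 s1"
    if h: "t1 \<le> 120 * K + 100 * J" "full E c s1" "mem s1 ''lev'' = mem s ''lev''" "\<And>z. z \<in> {''op'', ''u'', ''v''} \<Longrightarrow> reg s1 z = reg ?r z" for t1 s1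
  proof (rule update_wp[OF h(2) up], goal_cases)
    case 1
    show ?case using rop h(4) by (cases up) auto
  next
    case (2 t2 s2 c2 m)
    have "t2 \<le> 3000 * (K * (L + 2) * m)"
    proof -
      have JL: "J \<le> L" using RJ_pos by (simp add: L_def)
      have "2 * (L + 2) * 1 \<le> K * (L + 2) * m" using K_ge2 2(5) by (intro mult_mono) auto
      moreover have "K * 1 * 1 \<le> K * (L + 2) * m" using 2(5) by (intro mult_mono) auto
      moreover have "t1 + 2500 * X \<le> 3000 * X" if "2 * (L + 2) * 1 \<le> X" "K * 1 * 1 \<le> X" for X
        using that h(1) JL by simp
      ultimately show ?thesis using 2(4) by (meson le_trans)
    qed
    then show ?case using 2(1,2,3) h(3) by auto
  qed
  have "wp w (program N) ?Q 0 ?r"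
    using inv
  proof
    assume f: "full E c s"
    have fr: "full E c ?r" by (rule full_frame[OF receive_frame _ f]) auto
    then have "reg ?r ''1'' = 1" by (simp add: full_def base_def glob_def)
    moreover have "mem ?r ''lev'' = mem s ''lev''" using receive_frame[of s up] by (simp add: frame_def)
    moreover have "wp w (program N) F 0 ?r" if "reg ?r ''1'' = 1" "wp w (update N) F 3 ?r" for F
      using that by (simp add: program_def numeral_eq_Suc)
    moreover have "wp w (update N) ?Q 3 ?r"
      by (rule upd[OF _ fr]) (use K_ge2 calculation(2) in simp_all)
    ultimately show ?thesis by blast
  next
    assume i: "s = initial_state n \<and> E = {} \<and> c = (\<lambda>_ _. 0)"
    have r: "reg ?r ''1'' = 0" "reg ?r ''n'' = n" "mem ?r = (\<lambda>_ _. 0)"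
      using i receive_frame[of s up] by (auto simp: frame_def initial_state_def fun_eq_iff)
    have "wp w (init N) (wp w (update N) ?Q) 2 ?r"
    proof (rule init_wp[OF r(2,3) Kmin], assumption, goal_cases)
      case (1 t1 s1)
      have m1: "mem s1 a = (\<lambda>_. 0)" if "a \<noteq> ''tab''" for a using 1(2) r(3) that by (simp add: frame_def)
      show ?case
      proof (rule upd)
        show "full E c s1" using full_initial[OF 1(3) m1] i by simp
        show "mem s1 ''lev'' = mem s ''lev''" using m1 i by (simp add: initial_state_def)
        show "t1 \<le> 120 * K + 100 * J" using 1(1) K_ge2 by linarith
        show "reg s1 z = reg ?r z" if "z \<in> {''op'', ''u'', ''v''}" for z
          using 1(2) that by (elim insertE) (simp_all add: frame_def)
      qed
    qed
    moreover have "wp w (program N) F 0 ?r" if "wp w (init N) (wp w (update N) F) 2 ?r" for F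
      using that r by (simp add: program_def numeral_eq_Suc)
    ultimately show ?thesis by blast
  qed
  then show ?thesis unfolding wp_def by auto
qed

text \<open>The part of the invariant that recourse depends on. Unlike \<open>full\<close> it also
  holds in the initial state, where the registers with the constants are not yet set.\<close>

definition view :: "edge set \<Rightarrow> (nat \<Rightarrow> nat \<Rightarrow> nat) \<Rightarrow> state \<Rightarrow> bool" where
  "view E c s \<longleftrightarrow> wfE E \<and> cedge E c \<and> (\<forall>a<n. \<forall>b\<in>adj E a. mem s ''color'' (a * n + b) = c a b)"

lemma full_view: "full E c s \<Longrightarrow> view E c s"
  unfolding full_def base_def view_def using rep_color adj_lt by blast

lemma stored_view:
  assumes "view E c s" "a < b" "b < n"
  shows "stored_coloring n E s {a, b} = (if {a, b} \<in> E then Some (c a b) else None)" "({a, b} \<in> E) = (c a b \<noteq> 0)"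
proof -
  have "b \<in> adj E a \<longleftrightarrow> {a, b} \<in> E" by (simp add: adj_def)
  then show "({a, b} \<in> E) = (c a b \<noteq> 0)" "stored_coloring n E s {a, b} = (if {a, b} \<in> E then Some (c a b) else None)"
    using assms cedgeD[of E c a b] unfolding view_def stored_coloring_def by (auto simp: restrict_map_def)
qed

lemma edge_ordered:
  assumes "wfE E" "e \<in> E"
  obtains a b where "e = {a, b}" "a < b" "b < n"
proof -
  obtain x y where "e = {x, y}" "x \<noteq> y" "x < n" "y < n" using assms unfolding wfE_def by blast
  then show thesis using that[of x y] that[of y x] by (cases "x < y") (auto simp: insert_commute)
qed

lemma recourse_le:
  assumes "view E c s" "view E' c' s'"
  shows "recourse (stored_coloring n E s) (stored_coloring n E' s') \<le> card (Dset c c')"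
  unfolding recourse_def
proof (rule card_mono[OF Dset_finite], rule subsetI)
  fix e assume "e \<in> {e. stored_coloring n E s e \<noteq> stored_coloring n E' s' e}"
  then have ne: "stored_coloring n E s e \<noteq> stored_coloring n E' s' e" by simp
  then have "e \<in> E \<or> e \<in> E'" by (auto simp: stored_coloring_def restrict_map_def split: if_splits)
  then obtain a b where e: "e = {a, b}" "a < b" "b < n" using edge_ordered assms unfolding view_def by metis
  have "c a b \<noteq> c' a b"
    using ne stored_view[OF assms(1) e(2,3)] stored_view[OF assms(2) e(2,3)] unfolding e(1) by auto
  then show "e \<in> Dset c c'" using e unfolding Dset_def by (auto intro: less_trans)
qed

lemma full_proper:
  assumes f: "full E c s" and N2: "2 \<le> N" and eps: "12 / real N \<le> \<epsilon>"
  shows "proper_edge_coloring E (real (max_degree n E) + (4 + \<epsilon>) * real (arboricity n E)) (stored_coloring n E s)"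
proof -
  have b: "base E c s" and st: "\<And>v. v < n \<Longrightarrow> stable E (mem s ''lev'') v"
    and nb: "\<And>a b. a < n \<Longrightarrow> b \<in> adj E a \<Longrightarrow> \<not> bad E (mem s ''lev'') c a b" using f by (auto simp: full_def)
  have wf: "wfE E" and ok: "okc c" using b by (auto simp: base_def)
  have vw: "view E c s" by (rule full_view[OF f])
  have dom: "dom (stored_coloring n E s) = E" by (auto simp: stored_coloring_def)
  have bound: "1 \<le> k \<and> int k \<le> \<lfloor>real (max_degree n E) + (4 + \<epsilon>) * real (arboricity n E)\<rfloor>" if k: "k \<in> ran (stored_coloring n E s)" for k
  proof -
    obtain e where e: "stored_coloring n E s e = Some k" using k by (auto simp: ran_def)
    then have eE: "e \<in> E" using dom by auto
    obtain a d where ad: "e = {a, d}" "a < d" "d < n" using edge_ordered[OF wf eE] by blast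
    have kc: "k = c a d" "c a d \<noteq> 0" using stored_view[OF vw ad(2,3)] e eE ad(1) by auto
    have an: "a < n" using ad by simp
    define l where "l = min (mem s ''lev'' a) (mem s ''lev'' d)"
    have dm: "card (adj E z) \<le> max_degree n E" if "z < n" for z
      unfolding max_degree_def degree_adj[OF wf, of z, symmetric] using that by (intro Max_ge) auto
    have "d \<in> adj E a" using eE ad by (simp add: adj_def)
    then have "k + 1 \<le> max (card (adj E a)) (card (adj E d)) + Ul l"
      using nb[OF an] kc by (auto simp: bad_def l_def not_less)
    then have "k + 1 \<le> max_degree n E + Ul l" using dm[OF an] dm[OF ad(3)] by linarith
    then have "real k \<le> real (max_degree n E) + (real (Ul l) - 1)" by linarith
    also have "real (Ul l) - 1 \<le> (4 + 12 / real N) * real (arboricity n E)"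
      by (rule Ul_arboricity[OF wf st an _ _ N2]) (use eE in \<open>auto simp: l_def\<close>)
    also have "\<dots> \<le> (4 + \<epsilon>) * real (arboricity n E)" using eps by (intro mult_right_mono) auto
    finally have "real k \<le> real (max_degree n E) + (4 + \<epsilon>) * real (arboricity n E)" by simp
    then have "int k \<le> \<lfloor>real (max_degree n E) + (4 + \<epsilon>) * real (arboricity n E)\<rfloor>"
      unfolding le_floor_iff by (simp only: of_int_of_nat_eq)
    then show ?thesis using kc by simp
  qed
  have diff: "stored_coloring n E s e \<noteq> stored_coloring n E s f"
    if h: "e \<in> E" "f \<in> E" "e \<noteq> f" "e \<inter> f \<noteq> {}" for e f
  proof -
    have val: "stored_coloring n E s {x, y} = Some (c x y)" if "{x, y} \<in> E" for x y
    proof -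
      have xy: "x < n" "y < n" "x \<noteq> y" using adj_lt[OF wf, of y x] that by (auto simp: adj_def)
      show ?thesis
      proof (cases "x < y")
        case True
        then show ?thesis using stored_view(1)[OF vw True xy(2)] that by simp
      next
        case False
        then have "y < x" using xy by simp
        then show ?thesis using stored_view(1)[OF vw _ xy(1), of y] that okc_sym[OF ok xy(1,2)] by (simp add: insert_commute)
      qed
    qed
    obtain x where x: "x \<in> e" "x \<in> f" using h(4) by blast
    have two: "\<exists>y. g = {x, y}" if "g \<in> E" "x \<in> g" for g
      using wf that unfolding wfE_def by fastforce
    obtain y z where yz: "e = {x, y}" "f = {x, z}" using two[OF h(1) x(1)] two[OF h(2) x(2)] by blast
    have y: "y \<in> adj E x" "z \<in> adj E x" using h yz by (auto simp: adj_def)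
    have "c x y \<noteq> 0" using cedgeD[of E c x y] adj_lt[OF wf y(1)] y(1) b by (auto simp: base_def)
    then obtain k where k: "c x y = Suc k" by (cases "c x y") auto
    have "c x z \<noteq> c x y"
      using okc_uniq[OF ok _ _ _ k, of z] adj_lt[OF wf y(1)] adj_lt[OF wf y(2)] k yz h(3) by auto
    then show ?thesis using val h yz by auto
  qed
  show ?thesis unfolding proper_edge_coloring_def using dom bound diff by blast
qed

end

section \<open>The amortized bounds\<close>

lemma graph_after_Suc: "i < length us \<Longrightarrow> graph_after us (Suc i) = apply_update (us ! i) (graph_after us i)"
  by (simp add: graph_after_def take_Suc_conv_app_nth)

context ctx begin

lemma pot_initial: "pot {} (\<lambda>_. 0) = 0"
  by (simp add: pot_def nd_def adj_def)

text \<open>The work of update \<open>i\<close> is proportional to a number \<open>m i\<close> with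
  \<open>m i + pot' \<le> pot + charge\<close>. The potential starts at 0, so the sum of these
  numbers telescopes to at most \<open>charge\<close> per update.\<close>

lemma run_exists:
  assumes Kmin: "\<And>j. j < K \<Longrightarrow> 2 ^ j < 2 * n" and N2: "2 \<le> N" and eps: "12 / real N \<le> \<epsilon>"
    and us: "valid_updates n us"
  shows "\<exists>t s. dynamic_run w (program N) n us t s \<and>
     (\<forall>i \<le> length us. proper_edge_coloring (graph_after us i)
        (real (max_degree n (graph_after us i)) + (4 + \<epsilon>) * real (arboricity n (graph_after us i)))
        (stored_coloring n (graph_after us i) (s i))) \<and>
     (\<Sum>i < length us. recourse (stored_coloring n (graph_after us i) (s i))
        (stored_coloring n (graph_after us (Suc i)) (s (Suc i)))) \<le> 2 * (L + 2) * (length us * charge) \<and>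
     (\<Sum>i < length us. t i) \<le> 3000 * (K * (L + 2) * (length us * charge))"
proof -
  define G where "G = graph_after us"
  define len where "len = length us"
  define Inv where "Inv i p \<longleftrightarrow> full (G i) (snd p) (fst p) \<or> fst p = initial_state n \<and> G i = {} \<and> snd p = (\<lambda>_ _. 0)" for i p
  define step where "step i p p' t m \<longleftrightarrow> exec w (program N) (receive (us ! i) (fst p)) t (fst p') \<and>
     pot (G (Suc i)) (mem (fst p') ''lev'') + m \<le> pot (G i) (mem (fst p) ''lev'') + charge \<and>
     card (Dset (snd p) (snd p')) \<le> 2 * (L + 2) * m \<and> t \<le> 3000 * (K * (L + 2) * m)" for i p p' t m
  have G0: "G 0 = {}" by (simp add: G_def graph_after_def)
  \<comment> \<open>State and ghost coloring are chosen together, as the invariant relates them; the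
    times and the numbers \<open>m\<close> are extracted afterwards.\<close>
  have "\<exists>f. \<forall>i. ((i \<le> len \<longrightarrow> Inv i (f i)) \<and> (i = 0 \<longrightarrow> f i = (initial_state n, \<lambda>_ _. 0))) \<and>
      (i < len \<longrightarrow> (\<exists>t m. step i (f i) (f (Suc i)) t m))"
  proof (rule dependent_nat_choice)
    show "\<exists>x. (0 \<le> len \<longrightarrow> Inv 0 x) \<and> (0 = (0::nat) \<longrightarrow> x = (initial_state n, \<lambda>_ _. 0))"
      by (auto simp: Inv_def G0)
  next
    fix p i assume h: "(i \<le> len \<longrightarrow> Inv i p) \<and> (i = 0 \<longrightarrow> p = (initial_state n, \<lambda>_ _. 0))"
    show "\<exists>p'. ((Suc i \<le> len \<longrightarrow> Inv (Suc i) p') \<and> (Suc i = 0 \<longrightarrow> p' = (initial_state n, \<lambda>_ _. 0))) \<and>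
        (i < len \<longrightarrow> (\<exists>t m. step i p p' t m))"
    proof (cases "i < len")
      case True
      have "valid_update n (G i) (us ! i)" using us True by (simp add: valid_updates_def G_def len_def)
      moreover have "G (Suc i) = apply_update (us ! i) (G i)" using True by (simp add: G_def len_def graph_after_Suc)
      moreover have "full (G i) (snd p) (fst p) \<or> fst p = initial_state n \<and> G i = {} \<and> snd p = (\<lambda>_ _. 0)"
        using h True by (simp add: Inv_def)
      ultimately obtain t' s' c' m where "exec w (program N) (receive (us ! i) (fst p)) t' s'" "full (G (Suc i)) c' s'"
        "pot (G (Suc i)) (mem s' ''lev'') + m \<le> pot (G i) (mem (fst p) ''lev'') + charge"
        "card (Dset (snd p) c') \<le> 2 * (L + 2) * m" "t' \<le> 3000 * (K * (L + 2) * m)"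
        using program_step[OF Kmin, of "G i" "snd p" "fst p" "us ! i"] by auto
      then have "Inv (Suc i) (s', c') \<and> step i p (s', c') t' m" by (simp add: Inv_def step_def)
      then show ?thesis by blast
    qed auto
  qed
  then obtain f where f: "\<And>i. i \<le> len \<Longrightarrow> Inv i (f i)" "f 0 = (initial_state n, \<lambda>_ _. 0)"
    "\<And>i. i < len \<Longrightarrow> \<exists>t m. step i (f i) (f (Suc i)) t m" by blast
  define s where "s i = fst (f i)" for i
  define c where "c i = snd (f i)" for i
  define t where "t i = (SOME t. \<exists>m. step i (f i) (f (Suc i)) t m)" for i
  define m where "m i = (SOME m. step i (f i) (f (Suc i)) (t i) m)" for i
  have st: "step i (f i) (f (Suc i)) (t i) (m i)" if "i < len" for i
  proof -
    have "\<exists>m. step i (f i) (f (Suc i)) (t i) m" unfolding t_def by (rule someI_ex[OF f(3)[OF that]])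
    then show ?thesis unfolding m_def by (rule someI_ex)
  qed
  \<comment> \<open>The telescoped form for a prefix of the sequence.\<close>
  have acc: "(\<Sum>i<k. m i) + pot (G k) (mem (s k) ''lev'') \<le> k * charge" if "k \<le> len" for k
    using that
  proof (induction k)
    case 0
    then show ?case using f(2) by (simp add: s_def G0 initial_state_def pot_initial)
  next
    case (Suc k)
    then show ?case using st[of k] by (simp add: step_def s_def)
  qed
  have sm: "(\<Sum>i<len. m i) \<le> len * charge" using acc[of len] by simp
  have vw: "view (G i) (c i) (s i)" if "i \<le> len" for i
    using f(1)[OF that] unfolding Inv_def s_def c_def
  proof
    assume "fst (f i) = initial_state n \<and> G i = {} \<and> snd (f i) = (\<lambda>_ _. 0)"
    then show "view (G i) (snd (f i)) (fst (f i))" by (simp add: view_def wfE_def cedge_def adj_def)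
  qed (rule full_view)
  have "dynamic_run w (program N) n us t s"
    using f(2) st unfolding dynamic_run_def len_def[symmetric] by (auto simp: s_def step_def)
  moreover have "proper_edge_coloring (G i) (real (max_degree n (G i)) + (4 + \<epsilon>) * real (arboricity n (G i)))
        (stored_coloring n (G i) (s i))" if "i \<le> len" for i
    using f(1)[OF that] unfolding Inv_def s_def
  proof
    assume "fst (f i) = initial_state n \<and> G i = {} \<and> snd (f i) = (\<lambda>_ _. 0)"
    then show "proper_edge_coloring (G i) (real (max_degree n (G i)) + (4 + \<epsilon>) * real (arboricity n (G i)))
        (stored_coloring n (G i) (fst (f i)))" by (simp add: proper_edge_coloring_def stored_coloring_def)
  qed (rule full_proper[OF _ N2 eps])
  moreover have "(\<Sum>i<len. recourse (stored_coloring n (G i) (s i)) (stored_coloring n (G (Suc i)) (s (Suc i)))) \<le> 2 * (L + 2) * (len * charge)"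
  proof -
    have "recourse (stored_coloring n (G i) (s i)) (stored_coloring n (G (Suc i)) (s (Suc i))) \<le> 2 * (L + 2) * m i" if "i < len" for i
    proof -
      have "recourse (stored_coloring n (G i) (s i)) (stored_coloring n (G (Suc i)) (s (Suc i))) \<le> card (Dset (c i) (c (Suc i)))"
        by (rule recourse_le) (use that vw[of i] vw[of "Suc i"] in auto)
      also have "\<dots> \<le> 2 * (L + 2) * m i" using st[OF that] by (simp add: step_def c_def)
      finally show ?thesis .
    qed
    then have "(\<Sum>i<len. recourse (stored_coloring n (G i) (s i)) (stored_coloring n (G (Suc i)) (s (Suc i)))) \<le> (\<Sum>i<len. 2 * (L + 2) * m i)"
      by (intro sum_mono) auto
    also have "\<dots> = 2 * (L + 2) * (\<Sum>i<len. m i)" by (rule sum_distrib_left[symmetric])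
    also have "\<dots> \<le> 2 * (L + 2) * (len * charge)" by (rule mult_le_mono2[OF sm])
    finally show ?thesis .
  qed
  moreover have "(\<Sum>i<len. t i) \<le> 3000 * (K * (L + 2) * (len * charge))"
  proof -
    have "t i \<le> 3000 * (K * (L + 2)) * m i" if "i < len" for i
      using st[OF that] unfolding step_def by (simp only: mult.assoc)
    then have "(\<Sum>i<len. t i) \<le> (\<Sum>i<len. 3000 * (K * (L + 2)) * m i)"
      by (intro sum_mono) (simp only: lessThan_iff)
    also have "\<dots> = 3000 * (K * (L + 2)) * (\<Sum>i<len. m i)" by (rule sum_distrib_left[symmetric])
    also have "\<dots> \<le> 3000 * (K * (L + 2)) * (len * charge)" by (rule mult_le_mono2[OF sm])
    finally show ?thesis by (simp only: mult.assoc)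
  qed
  ultimately show ?thesis unfolding G_def len_def by blast
qed

lemma size_bounds: "L + 2 \<le> 4 * (N\<^sup>2 * K\<^sup>2)" "charge \<le> 100 * (N ^ 3 * K\<^sup>2)"
proof -
  have K1: "1 \<le> K" using K_ge2 by simp
  have L: "L = 2 * (N\<^sup>2 * K\<^sup>2)" by (simp add: L_def R_def J_def power2_eq_square)
  have "1 \<le> N\<^sup>2 * K\<^sup>2" using N1 K1 by simp
  then show "L + 2 \<le> 4 * (N\<^sup>2 * K\<^sup>2)" using L by linarith
  define X where "X = N ^ 3 * K\<^sup>2"
  have NL: "N * L = 2 * X" by (simp add: L X_def power3_eq_cube power2_eq_square)
  have "1 * L \<le> N * L" using N1 by (rule mult_le_mono1)
  moreover have "1 \<le> X" using N1 K1 by (simp add: X_def)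
  moreover have "J \<le> X"
  proof -
    have "N ^ 1 * K ^ 1 \<le> N ^ 3 * K\<^sup>2" using N1 K1 by (intro mult_mono power_increasing) auto
    then show ?thesis by (simp add: J_def X_def)
  qed
  moreover have "charge = 8 * L + 12 + 32 * (N * L) + 2 * J" by (simp add: charge_def)
  ultimately show "charge \<le> 100 * (N ^ 3 * K\<^sup>2)" using NL unfolding X_def[symmetric] by linarith
qed

end

text \<open>Everything is polynomial in \<open>X = n / \<epsilon>\<close>, and since
  \<open>2 \<le> X\<close>, numerical constants are absorbed by powers of \<open>X\<close>. The
  cubed term is at most \<open>2 ^ 11 * X ^ 4 \<le> X ^ 15\<close> and
  \<open>1000 * N \<le> 2 ^ 13 * X \<le> X ^ 14\<close>, so the exponent is
  \<open>3 * 15 + 14 = 59\<close>.\<close>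

lemma word_size_suffices:
  fixes \<epsilon> :: real
  assumes n: "2 \<le> n" and e: "0 < \<epsilon>" "\<epsilon> < 1" and N: "real N \<le> 13 / \<epsilon>" and K: "2 ^ K \<le> 4 * n"
    and w: "real w \<ge> real (59::nat) * log 2 (real n / \<epsilon>)"
  shows "1000 * N * (2 * N * K * (N * K) + 2 + 2 * 2 ^ K) ^ 3 \<le> 2 ^ w"
proof -
  define X where "X = real n / \<epsilon>"
  have nX: "real n \<le> X" using e n by (simp add: X_def field_simps)
  have X2: "2 \<le> X" using n nX by linarith
  have NX: "real N \<le> 7 * X"
  proof -
    have "13 / \<epsilon> \<le> 7 * X" using n e by (simp add: X_def field_simps)
    then show ?thesis using N by linarith
  qed
  have "real (2 ^ K) \<le> real (4 * n)" using K by (simp only: of_nat_le_iff)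
  then have "(2::real) ^ K \<le> 4 * real n" by simp
  then have P: "(2::real) ^ K \<le> 4 * X" using nX by linarith
  have "real K < 2 ^ K" by (rule of_nat_less_two_power)
  then have KX: "real K \<le> 4 * X" using P by linarith
  have p: "(1::real) \<le> X ^ k" for k using X2 by (simp add: one_le_power)
  have "real N * real K \<le> 7 * X * (4 * X)" using NX KX X2 by (intro mult_mono) auto
  then have "(real N * real K) * (real N * real K) \<le> (7 * X * (4 * X)) * (7 * X * (4 * X))" using NX KX X2 by (intro mult_mono) auto
  then have 1: "2 * real N * real K * (real N * real K) \<le> 1568 * X ^ 4" by (simp add: power4_eq_xxxx mult_ac)
  have "X ^ 1 \<le> X ^ 4" using X2 by (intro power_increasing) auto
  then have "X \<le> X ^ 4" by simp
  then have "2 * real N * real K * (real N * real K) + 2 + 2 * 2 ^ K \<le> 2048 * X ^ 4" using 1 P p[of 4] by linarith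
  also have "\<dots> \<le> X ^ 11 * X ^ 4" using power_mono[OF X2, of 11] X2 by (intro mult_right_mono) auto
  also have "\<dots> = X ^ 15" by (simp flip: power_add)
  finally have "(2 * real N * real K * (real N * real K) + 2 + 2 * 2 ^ K) ^ 3 \<le> (X ^ 15) ^ 3" by (intro power_mono) auto
  moreover have "1000 * real N \<le> X ^ 14"
  proof -
    have "1000 * real N \<le> 8192 * X" using NX X2 by linarith
    also have "\<dots> \<le> X ^ 13 * X" using power_mono[OF X2, of 13] X2 by (intro mult_right_mono) auto
    also have "\<dots> = X ^ 14" by (simp add: power_Suc2[of X 13] flip: power_Suc2)
    finally show ?thesis .
  qed
  ultimately have "1000 * real N * (2 * real N * real K * (real N * real K) + 2 + 2 * 2 ^ K) ^ 3 \<le> X ^ 14 * (X ^ 15) ^ 3"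
    using X2 by (intro mult_mono) auto
  also have "\<dots> = X ^ 59" by (simp flip: power_mult power_add)
  also have "\<dots> = 2 powr (log 2 X * 59)"
  proof -
    have "2 powr (log 2 X * 59) = X powr 59" using X2 by (simp flip: powr_powr)
    also have "\<dots> = X powr real 59" by simp
    also have "\<dots> = X ^ 59" using X2 by (intro powr_realpow) simp
    finally show ?thesis by simp
  qed
  also have "\<dots> \<le> 2 powr real w" using w by (intro powr_mono) (simp_all add: X_def mult.commute)
  also have "\<dots> = 2 ^ w" by (simp add: powr_realpow)
  finally have "real (1000 * N * (2 * N * K * (N * K) + 2 + 2 * 2 ^ K) ^ 3) \<le> real (2 ^ w)"
    by (simp only: of_nat_mult of_nat_add of_nat_power of_nat_numeral)
  then show ?thesis by (simp only: of_nat_le_iff)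
qed

text \<open>Minimality of \<open>K\<close> gives \<open>K \<le> log 2 n + 2\<close>, and
  \<open>1 \<le> log 2 n\<close> turns the summand 2 into a factor.\<close>

lemma depth_log:
  assumes n: "2 \<le> n" and K: "\<And>j. j < K \<Longrightarrow> 2 ^ j < 2 * n" "2 * n \<le> 2 ^ K"
  shows "real K \<le> 3 * log 2 (real n)" "2 ^ K \<le> 4 * n" "1 \<le> log 2 (real n)"
proof -
  show l1: "1 \<le> log 2 (real n)" using n by (simp add: le_log_iff)
  have "K \<noteq> 0" using K(2) n by (intro notI) simp
  then obtain j where j: "K = Suc j" by (cases K) auto
  have lt: "2 ^ j < 2 * n" using K(1) j by simp
  then show "2 ^ K \<le> 4 * n" by (simp add: j)
  have "real (2 ^ j) < real (2 * n)" using lt by (simp only: of_nat_less_iff)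
  then have "real j < log 2 (2 * real n)" by (intro less_log_of_power) simp_all
  also have "log 2 (2 * real n) = 1 + log 2 (real n)" using n by (simp add: log_mult)
  finally have "real j < 1 + log 2 (real n)" .
  then show "real K \<le> 3 * log 2 (real n)" using l1 j by simp
qed

theorem theorem4p1:
  "\<exists>C::real. \<exists>c::nat. C > 0 \<and> c \<ge> 1 \<and>
    (\<forall>\<epsilon>::real. 0 < \<epsilon> \<and> \<epsilon> < 1 \<longrightarrow>
      (\<exists>P::com. \<forall>(n::nat) (w::nat) (us::update list).
        valid_updates n us \<and> real w \<ge> real c * log 2 (real n / \<epsilon>) \<longrightarrow>
        (\<exists>t s. dynamic_run w P n us t s \<and>
          (\<forall>i \<le> length us.
             proper_edge_coloring (graph_after us i)
               (real (max_degree n (graph_after us i))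
                  + (4 + \<epsilon>) * real (arboricity n (graph_after us i)))
               (stored_coloring n (graph_after us i) (s i))) \<and>
          real (\<Sum>i < length us.
                  recourse (stored_coloring n (graph_after us i) (s i))
                    (stored_coloring n (graph_after us (Suc i)) (s (Suc i))))
            \<le> C * real (length us) * (log 2 (real n) ^ 4 / \<epsilon> ^ 5) \<and>
          (\<forall>\<Delta>::nat. (\<forall>i \<le> length us. max_degree n (graph_after us i) \<le> \<Delta>) \<longrightarrow>
             real (\<Sum>i < length us. t i)
               \<le> C * real (length us)
                   * (log 2 (real n) ^ 5 * max 1 (log 2 (real \<Delta>)) / \<epsilon> ^ 6)))))"
proof -
  \<comment> \<open>\<open>1200000 = 3000 * 4 * 100\<close> collects the constants of
    \<open>run_exists\<close> and \<open>size_bounds\<close>; the powers come from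
    \<open>N \<le> 13 / \<epsilon>\<close> and \<open>K \<le> 3 * log 2 n\<close>.\<close>
  define C :: real where "C = 1200000 * 13 ^ 5 * 3 ^ 5"
  have "\<exists>t s. dynamic_run w (program (nat \<lceil>12 / \<epsilon>\<rceil>)) n us t s \<and>
          (\<forall>i \<le> length us.
             proper_edge_coloring (graph_after us i)
               (real (max_degree n (graph_after us i))
                  + (4 + \<epsilon>) * real (arboricity n (graph_after us i)))
               (stored_coloring n (graph_after us i) (s i))) \<and>
          real (\<Sum>i < length us.
                  recourse (stored_coloring n (graph_after us i) (s i))
                    (stored_coloring n (graph_after us (Suc i)) (s (Suc i))))
            \<le> C * real (length us) * (log 2 (real n) ^ 4 / \<epsilon> ^ 5) \<and>
          (\<forall>\<Delta>::nat. (\<forall>i \<le> length us. max_degree n (graph_after us i) \<le> \<Delta>) \<longrightarrow>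
             real (\<Sum>i < length us. t i)
               \<le> C * real (length us)
                   * (log 2 (real n) ^ 5 * max 1 (log 2 (real \<Delta>)) / \<epsilon> ^ 6))"
    if e: "0 < \<epsilon>" "\<epsilon> < 1" and us: "valid_updates n us" and w: "real w \<ge> real (59::nat) * log 2 (real n / \<epsilon>)"
    for \<epsilon> :: real and n w :: nat and us
  proof (cases "us = []")
    case True
    then show ?thesis
      by (intro exI[of _ "\<lambda>_. 0"] exI[of _ "\<lambda>_. initial_state n"])
        (simp add: dynamic_run_def proper_edge_coloring_def stored_coloring_def graph_after_def)
  next
    case False
    \<comment> \<open>A nonempty valid sequence needs two distinct nodes; this gives
      \<open>2 \<le> n\<close>, on which the logarithmic bounds rest.\<close>
    then have "valid_update n (graph_after us 0) (us ! 0)" using us by (simp add: valid_updates_def)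
    then have n: "2 \<le> n" by (cases "us ! 0") auto
    define N where "N = nat \<lceil>12 / \<epsilon>\<rceil>"
    have N: "12 / \<epsilon> \<le> real N" "real N \<le> 12 / \<epsilon> + 1" using e by (simp_all add: N_def real_nat_ceiling_ge)
    have e1: "1 \<le> 1 / \<epsilon>" using e by simp
    have N13: "real N \<le> 13 / \<epsilon>" using N(2) e1 by (simp add: field_simps)
    have "12 \<le> real N" using N(1) e1 by (simp add: field_simps) 
    then have N2: "2 \<le> N" by simp
    have eps: "12 / real N \<le> \<epsilon>" using N(1) e N2 by (simp add: field_simps)
    define K where "K = (LEAST k. 2 * n \<le> 2 ^ k)"
    have K: "2 * n \<le> 2 ^ K" unfolding K_def by (rule LeastI[of _ "2 * n"]) (simp add: less_imp_le)
    have Kmin: "2 ^ j < 2 * n" if "j < K" for j using not_less_Least[OF that[unfolded K_def]] by simp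
    note Kb = depth_log[OF n Kmin K]
    interpret ctx w n N K
      by standard (use n N2 K word_size_suffices[OF n e N13 Kb(2) w] in auto)
    obtain t s where r: "dynamic_run w (program N) n us t s"
      "\<forall>i \<le> length us. proper_edge_coloring (graph_after us i)
        (real (max_degree n (graph_after us i)) + (4 + \<epsilon>) * real (arboricity n (graph_after us i)))
        (stored_coloring n (graph_after us i) (s i))"
     "(\<Sum>i < length us. recourse (stored_coloring n (graph_after us i) (s i))
        (stored_coloring n (graph_after us (Suc i)) (s (Suc i)))) \<le> 2 * (L + 2) * (length us * charge)"
     "(\<Sum>i < length us. t i) \<le> 3000 * (K * (L + 2) * (length us * charge))"
      using run_exists[OF Kmin N2 eps us] by blast
    define l where "l = log 2 (real n)"
    have l1: "1 \<le> l" and Kl: "real K \<le> 3 * l" using Kb by (simp_all add: l_def)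
    have N5: "real N ^ 5 \<le> 13 ^ 5 / \<epsilon> ^ 5"
      using power_mono[OF N13, of 5] by (simp add: power_divide)
    have gen1: "2 * (4 * (A * B)) * (T * (100 * (D * B))) = T * (800 * (A * D * (B * B)))" for A B D T :: nat by algebra
    have gen2: "3000 * (k * (4 * (A * B)) * (T * (100 * (D * B)))) = T * (1200000 * (A * D * (k * (B * B))))" for A B D T k :: nat by algebra
    have p5: "N ^ 5 = N\<^sup>2 * N ^ 3" "K ^ 4 = K\<^sup>2 * K\<^sup>2" "K ^ 5 = K * (K\<^sup>2 * K\<^sup>2)"
      by (simp_all flip: power_add power_Suc)
    have "2 * (L + 2) * (length us * charge) \<le> 2 * (4 * (N\<^sup>2 * K\<^sup>2)) * (length us * (100 * (N ^ 3 * K\<^sup>2)))"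
      by (intro mult_mono size_bounds order_refl) auto
    also have "\<dots> = length us * (800 * (N ^ 5 * K ^ 4))" unfolding p5 by (rule gen1)
    finally have "real (2 * (L + 2) * (length us * charge)) \<le> real (length us * (800 * (N ^ 5 * K ^ 4)))" by (simp only: of_nat_le_iff)
    also have "\<dots> = real (length us) * (800 * (real N ^ 5 * real K ^ 4))" by simp
    also have "\<dots> \<le> real (length us) * (800 * (13 ^ 5 / \<epsilon> ^ 5 * (3 * l) ^ 4))"
      using l1 e by (intro mult_left_mono mult_mono N5 power_mono Kl) auto
    also have "\<dots> = 800 * 13 ^ 5 * 3 ^ 4 * (real (length us) * (l ^ 4 / \<epsilon> ^ 5))" by (simp add: power_mult_distrib)
    also have "\<dots> \<le> C * (real (length us) * (l ^ 4 / \<epsilon> ^ 5))"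
      using l1 e by (intro mult_right_mono) (auto simp: C_def)
    finally have "real (2 * (L + 2) * (length us * charge)) \<le> C * real (length us) * (l ^ 4 / \<epsilon> ^ 5)"
      by (simp only: mult.assoc)
    moreover have "real (\<Sum>i < length us. recourse (stored_coloring n (graph_after us i) (s i))
        (stored_coloring n (graph_after us (Suc i)) (s (Suc i)))) \<le> real (2 * (L + 2) * (length us * charge))"
      using r(3) by (simp only: of_nat_le_iff)
    ultimately have rec: "real (\<Sum>i < length us. recourse (stored_coloring n (graph_after us i) (s i))
        (stored_coloring n (graph_after us (Suc i)) (s (Suc i)))) \<le> C * real (length us) * (l ^ 4 / \<epsilon> ^ 5)"
      by linarith
    have "3000 * (K * (L + 2) * (length us * charge)) \<le> 3000 * (K * (4 * (N\<^sup>2 * K\<^sup>2)) * (length us * (100 * (N ^ 3 * K\<^sup>2))))"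
      by (intro mult_mono size_bounds order_refl) auto
    also have "\<dots> = length us * (1200000 * (N ^ 5 * K ^ 5))" unfolding p5 by (rule gen2)
    finally have "real (3000 * (K * (L + 2) * (length us * charge))) \<le> real (length us * (1200000 * (N ^ 5 * K ^ 5)))" by (simp only: of_nat_le_iff)
    also have "\<dots> = real (length us) * (1200000 * (real N ^ 5 * real K ^ 5))" by simp
    also have "\<dots> \<le> real (length us) * (1200000 * (13 ^ 5 / \<epsilon> ^ 5 * (3 * l) ^ 5))"
      using l1 e by (intro mult_left_mono mult_mono N5 power_mono Kl) auto
    also have "\<dots> = C * real (length us) * (l ^ 5 / \<epsilon> ^ 5)" by (simp add: C_def power_mult_distrib)
    finally have "real (3000 * (K * (L + 2) * (length us * charge))) \<le> C * real (length us) * (l ^ 5 / \<epsilon> ^ 5)" .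
    moreover have "real (\<Sum>i < length us. t i) \<le> real (3000 * (K * (L + 2) * (length us * charge)))"
      using r(4) by (simp only: of_nat_le_iff)
    ultimately have tm: "real (\<Sum>i < length us. t i) \<le> C * real (length us) * (l ^ 5 / \<epsilon> ^ 5)"
      by linarith
    \<comment> \<open>The time has been bounded with \<open>l ^ 5 / \<epsilon> ^ 5\<close>; because
      \<open>\<epsilon> < 1\<close> and the maximum is at least 1, this implies the stated form for
      every \<open>\<Delta>\<close>.\<close>
    have tm2: "real (\<Sum>i < length us. t i) \<le> C * real (length us) * (l ^ 5 * max 1 (log 2 (real \<Delta>)) / \<epsilon> ^ 6)" for \<Delta> :: nat
    proof -
      have "l ^ 5 / \<epsilon> ^ 5 \<le> l ^ 5 * max 1 (log 2 (real \<Delta>)) / \<epsilon> ^ 6"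
      proof (rule frac_le)
        have "l ^ 5 * 1 \<le> l ^ 5 * max 1 (log 2 (real \<Delta>))" using l1 by (intro mult_left_mono) auto
        then show "l ^ 5 \<le> l ^ 5 * max 1 (log 2 (real \<Delta>))" by simp
        show "\<epsilon> ^ 6 \<le> \<epsilon> ^ 5" using e by (intro power_decreasing) auto
      qed (use l1 e in auto)
      then have "C * real (length us) * (l ^ 5 / \<epsilon> ^ 5) \<le> C * real (length us) * (l ^ 5 * max 1 (log 2 (real \<Delta>)) / \<epsilon> ^ 6)"
        by (intro mult_left_mono) (auto simp: C_def)
      then show ?thesis using tm by linarith
    qed
    show ?thesis
      unfolding N_def[symmetric] l_def[symmetric] using r(1,2) rec tm2 by blast
  qed
  note main = this
  have "C > 0" by (simp add: C_def)
  show ?thesis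
    apply (rule exI[of _ C], rule exI[of _ "59::nat"])
    apply (intro conjI allI impI, fact, simp)
    subgoal for \<epsilon>
      by (rule exI[of _ "program (nat \<lceil>12 / \<epsilon>\<rceil>)"], intro allI impI, rule main) blast+
    done
qed

end
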